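(* Let $\Sigma$ be any regular fine mixed subdivision of $n\Delta_{d-1}$, considered as a labeled polyhedral complex with each vertex labeled by the monomial $\mathbf{x}^{\mathbf{t}}$, $\mathbf{t}$ its coarse type, and each face labeled by the least common multiple of the labels of its vertices. Then, for any field $\Bbbk$, $\Sigma$ supports a minimal cellular resolution of $\langle x_1,\dots,x_d\rangle^n\subset\Bbbk[x_1,\dots,x_d]$.
   Context: $\Delta_{d-1}=\operatorname{conv}\{e_1,\dots,e_d\}\subset\mathbb{R}^d$. A mixed cell of $n\Delta_{d-1}$ is a Minkowski sum $\tau=\Delta_{I_1}+\dots+\Delta_{I_n}$ with $\emptyset\ne I_j\subseteq[d]$, $\Delta_I=\operatorname{conv}\{e_i:i\in I\}$ (the decomposition is part of the data); a mixed subdivision is a polyhedral subdivision of $n\Delta_{d-1}$ into mixed cells corresponding under the Cayley trick to a polyhedral subdivision of $\Delta_{n-1}\times\Delta_{d-1}$, where $\tau$ corresponds to $\operatorname{conv}\{(e_j,e_k): k\in I_j\}$. It is regular if the corresponding subdivision of $\Delta_{n-1}\times\Delta_{d-1}$ is regular (induced as the lower convex hull of a lifting of the vertices), and fine if it is minimal under refinement among mixed subdivisions, equivalently if the corresponding subdivision of $\Delta_{n-1}\times\Delta_{d-1}$ is a triangulation. The coarse type $\mathbf{t}(\tau)\in\mathbb{N}^d$ of $\tau$ has $k$-th coordinate $\#\{j: k\in I_j\}$; $\mathbf{x}^{\mathbf{t}}=x_1^{t_1}\cdots x_d^{t_d}$. Cellular resolution: let $S=\Bbbk[x_1,\dots,x_m]$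 and let $\mathcal{P}$ be an oriented polyhedral complex with labels $\mathbf{a}_H\in\mathbb{N}^m$ satisfying $\mathbf{a}_H=\max\{\mathbf{a}_G: G\subsetneq H\text{ a nonempty face}\}$ (componentwise) for all cells $H$ of positive dimension (monomial labels are identified with exponent vectors). Put $F_i=\bigoplus_{\dim H=i}S(-\mathbf{a}_H)$ with basis $e_H$, and differential $F_i\to F_{i-1}$, $e_H\mapsto\sum_{G\subset H,\ \dim G=\dim H-1}\varepsilon(H,G)\,\mathbf{x}^{\mathbf{a}_H-\mathbf{a}_G}e_G$, where $\varepsilon(H,G)$ is the coefficient in the cellular boundary map. $\mathcal{P}$ supports a cellular resolution of a monomial ideal $I$ if this complex is exact in positive homological degrees and the cokernel of $F_1\to F_0$ is isomorphic to $I$ as a $\mathbb{Z}^m$-graded module; it is minimal if the resolution is a minimal free resolution. *)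

theory Defs
  imports
    "HOL-Analysis.Analysis"
    "HOL-Library.Poly_Mapping"
    "Jordan_Normal_Form.Determinant"
begin

section \<open>Polyhedral complexes and subdivisions\<close>

text \<open>The empty polytope is never a cell; two disjoint cells meet in the empty face.\<close>

definition polyhedral_complex :: "'v::euclidean_space set set \<Rightarrow> bool" where
  "polyhedral_complex P \<longleftrightarrow>
     finite P \<and>
     (\<forall>C\<in>P. polytope C \<and> C \<noteq> {}) \<and>
     (\<forall>C\<in>P. \<forall>F. F face_of C \<and> F \<noteq> {} \<longrightarrow> F \<in> P) \<and>
     (\<forall>C\<in>P. \<forall>D\<in>P. (C \<inter> D) face_of C \<and> (C \<inter> D) face_of D)"

definition polyhedral_subdivision :: "'v::euclidean_space set set \<Rightarrow> 'v set \<Rightarrow> bool" where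
  "polyhedral_subdivision P X \<longleftrightarrow> polyhedral_complex P \<and> \<Union>P = X"


section \<open>Mixed subdivisions of a dilated simplex\<close>

text \<open>
  The index sets \<open>[n]\<close> and \<open>[d]\<close> are the finite types \<open>'n\<close> and \<open>'d\<close>. A tuple
  \<open>I :: 'n \<Rightarrow> 'd set\<close> of nonempty sets is a mixed cell together with its decomposition.
\<close>

definition simplex_face :: "'d::finite set \<Rightarrow> (real^'d) set" where
  "simplex_face K = convex hull ((\<lambda>k. axis k 1) ` K)"

definition mixed_cell :: "('n::finite \<Rightarrow> 'd::finite set) \<Rightarrow> (real^'d) set" where
  "mixed_cell I = (\<Sum>j\<in>UNIV. simplex_face (I j))"

definition dilated_simplex :: "nat \<Rightarrow> (real^'d::finite) set" where
  "dilated_simplex n = (\<lambda>x. real n *\<^sub>R x) ` simplex_face UNIV"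

definition simplex_product :: "((real^'n::finite) \<times> (real^'d::finite)) set" where
  "simplex_product = simplex_face UNIV \<times> simplex_face UNIV"

definition product_vertex :: "'n::finite \<Rightarrow> 'd::finite \<Rightarrow> (real^'n) \<times> (real^'d)" where
  "product_vertex j k = (axis j 1, axis k 1)"

definition cayley_cell :: "('n::finite \<Rightarrow> 'd::finite set) \<Rightarrow> ((real^'n) \<times> (real^'d)) set" where
  "cayley_cell I = convex hull {product_vertex j k | j k. k \<in> I j}"

text \<open>
  Subdivisions of the product of simplices introduce no new vertices. Here some of the sets
  \<open>I j\<close> may be empty: this happens for those cells that lie over a proper face of the first factor.
\<close>

definition product_subdivision :: "((real^'n::finite) \<times> (real^'d::finite)) set set \<Rightarrow> bool" where
  "product_subdivision T \<longleftrightarrow>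
     polyhedral_subdivision T simplex_product \<and> (\<forall>C\<in>T. \<exists>I. C = cayley_cell I)"

definition cayley_corresponds ::
    "('n::finite \<Rightarrow> 'd::finite set) set \<Rightarrow> ((real^'n) \<times> (real^'d)) set set \<Rightarrow> bool" where
  "cayley_corresponds \<Sigma> T \<longleftrightarrow> \<Sigma> = {I. (\<forall>j. I j \<noteq> {}) \<and> cayley_cell I \<in> T}"

definition mixed_complex :: "('n::finite \<Rightarrow> 'd::finite set) set \<Rightarrow> (real^'d) set set" where
  "mixed_complex \<Sigma> = mixed_cell ` \<Sigma>"

definition mixed_subdivision :: "('n::finite \<Rightarrow> 'd::finite set) set \<Rightarrow> bool" where
  "mixed_subdivision \<Sigma> \<longleftrightarrow>
     polyhedral_subdivision (mixed_complex \<Sigma>) (dilated_simplex CARD('n)) \<and>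
     (\<exists>T. product_subdivision T \<and> cayley_corresponds \<Sigma> T)"

definition refines :: "('n \<Rightarrow> 'd set) set \<Rightarrow> ('n \<Rightarrow> 'd set) set \<Rightarrow> bool" where
  "refines \<Sigma>' \<Sigma> \<longleftrightarrow> (\<forall>I'\<in>\<Sigma>'. \<exists>I\<in>\<Sigma>. \<forall>j. I' j \<subseteq> I j)"

definition fine_mixed_subdivision :: "('n::finite \<Rightarrow> 'd::finite set) set \<Rightarrow> bool" where
  "fine_mixed_subdivision \<Sigma> \<longleftrightarrow>
     mixed_subdivision \<Sigma> \<and>
     (\<forall>\<Sigma>'. mixed_subdivision \<Sigma>' \<and> refines \<Sigma>' \<Sigma> \<longrightarrow> \<Sigma>' = \<Sigma>)"

text \<open>
  The last coordinate is the height; a lower face is one on which a linear functional with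
  height coefficient 1 attains its minimum over the polytope.
\<close>

definition lower_face :: "('v::euclidean_space \<times> real) set \<Rightarrow> ('v \<times> real) set \<Rightarrow> bool" where
  "lower_face F Q \<longleftrightarrow>
     F \<noteq> {} \<and>
     (\<exists>u c. (\<forall>p\<in>Q. c \<le> u \<bullet> fst p + snd p) \<and> F = {p\<in>Q. u \<bullet> fst p + snd p = c})"

definition lifted_product ::
    "('n::finite \<Rightarrow> 'd::finite \<Rightarrow> real) \<Rightarrow> (((real^'n) \<times> (real^'d)) \<times> real) set" where
  "lifted_product w = convex hull {(product_vertex j k, w j k) | j k. True}"

definition regular_product_subdivision ::
    "((real^'n::finite) \<times> (real^'d::finite)) set set \<Rightarrow> bool" where
  "regular_product_subdivision T \<longleftrightarrow>
     product_subdivision T \<and>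
     (\<exists>w. T = {fst ` F | F. lower_face F (lifted_product w)})"

definition regular_mixed_subdivision :: "('n::finite \<Rightarrow> 'd::finite set) set \<Rightarrow> bool" where
  "regular_mixed_subdivision \<Sigma> \<longleftrightarrow>
     mixed_subdivision \<Sigma> \<and>
     (\<exists>T. regular_product_subdivision T \<and> cayley_corresponds \<Sigma> T)"

definition coarse_type :: "('n::finite \<Rightarrow> 'd set) \<Rightarrow> 'd \<Rightarrow> nat" where
  "coarse_type I k = card {j. k \<in> I j}"

text \<open>Exponent vector of the least common multiple of the labels of the vertices of \<open>H\<close>.\<close>

definition lcm_label :: "('n::finite \<Rightarrow> 'd::finite set) set \<Rightarrow> (real^'d) set \<Rightarrow> 'd \<Rightarrow> nat" where
  "lcm_label \<Sigma> H k =
     Max {coarse_type I k | I. I \<in> \<Sigma> \<and> aff_dim (mixed_cell I) = 0 \<and> mixed_cell I face_of H}"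


section \<open>Polynomial rings\<close>

text \<open>\<open>('m \<Rightarrow>\<^sub>0 nat) \<Rightarrow>\<^sub>0 'k\<close> with the convolution product is the polynomial ring over \<open>'k\<close>
  with one variable for each element of \<open>'m\<close>.\<close>

type_synonym ('m, 'k) mpolynomial = "('m \<Rightarrow>\<^sub>0 nat) \<Rightarrow>\<^sub>0 'k"

definition var :: "'m \<Rightarrow> ('m, 'k::comm_ring_1) mpolynomial" where
  "var i = Poly_Mapping.single (Poly_Mapping.single i 1) 1"

definition monom_of :: "('m::finite \<Rightarrow> nat) \<Rightarrow> ('m, 'k::comm_ring_1) mpolynomial" where
  "monom_of t = (\<Prod>i\<in>UNIV. var i ^ t i)"

definition homogeneous :: "('m \<Rightarrow> int) \<Rightarrow> ('m, 'k::zero) mpolynomial \<Rightarrow> bool" where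
  "homogeneous b p \<longleftrightarrow> (\<forall>t\<in>Poly_Mapping.keys p. \<forall>i. int (Poly_Mapping.lookup t i) = b i)"

definition ideal_generated :: "'a::comm_ring_1 set \<Rightarrow> 'a set" where
  "ideal_generated X = module.span (*) X"

primrec ideal_power :: "'a::comm_ring_1 set \<Rightarrow> nat \<Rightarrow> 'a set" where
  "ideal_power J 0 = UNIV"
| "ideal_power J (Suc n) = ideal_generated {a * b | a b. a \<in> J \<and> b \<in> ideal_power J n}"

definition irrelevant_ideal :: "('m, 'k::comm_ring_1) mpolynomial set" where
  "irrelevant_ideal = ideal_generated (range var)"


section \<open>Orientations and incidence numbers\<close>

text \<open>An orientation of a cell is given by an ordered basis of its space of directions.\<close>

definition oriented_complex ::
    "'v::euclidean_space set set \<Rightarrow> ('v set \<Rightarrow> 'v list) \<Rightarrow> bool" where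
  "oriented_complex P ori \<longleftrightarrow>
     polyhedral_complex P \<and>
     (\<forall>H\<in>P. distinct (ori H) \<and> independent (set (ori H)) \<and>
            span (set (ori H)) = span {x - y | x y. x \<in> H \<and> y \<in> H})"

text \<open>
  If \<open>bs\<close> and \<open>cs\<close> are ordered bases of the same subspace, with \<open>bs = M cs\<close> for an invertible
  matrix \<open>M\<close>, then the matrix of inner products of \<open>bs\<close> with \<open>cs\<close> is \<open>M\<close> times the Gram matrix
  of \<open>cs\<close>. The latter has positive determinant, so the sign below is that of \<open>det M\<close>.
\<close>

definition relative_orientation :: "'v::euclidean_space list \<Rightarrow> 'v list \<Rightarrow> int" where
  "relative_orientation bs cs =
     (let D = Determinant.det
                (Matrix.mat (length cs) (length cs) (\<lambda>(i, j). bs ! i \<bullet> cs ! j))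
      in if D > 0 then 1 else if D < 0 then - 1 else 0)"

text \<open>
  The coefficient of a facet \<open>G\<close> in the cellular boundary of \<open>H\<close>, with the convention that an
  outward pointing vector comes first. The difference of a point of \<open>G\<close> and a point of \<open>H - G\<close>
  points outward, and the sign does not depend on the choice of these two points.
\<close>

definition incidence ::
    "('v::euclidean_space set \<Rightarrow> 'v list) \<Rightarrow> 'v set \<Rightarrow> 'v set \<Rightarrow> int" where
  "incidence ori H G =
     relative_orientation (((SOME x. x \<in> G) - (SOME y. y \<in> H - G)) # ori G) (ori H)"


section \<open>Cellular resolutions\<close>

definition label_compatible ::
    "'v::euclidean_space set set \<Rightarrow> ('v set \<Rightarrow> 'm \<Rightarrow> nat) \<Rightarrow> bool" where
  "label_compatible P a \<longleftrightarrow>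
     (\<forall>H\<in>P. aff_dim H > 0 \<longrightarrow>
        (\<forall>i. a H i = Max {a G i | G. G face_of H \<and> G \<noteq> {} \<and> G \<noteq> H}))"

text \<open>
  An element of the free module on the \<open>i\<close>-dimensional cells is its coordinate function, which
  vanishes off these cells. The shifts of the grading enter through \<open>chain_homogeneous\<close>.
\<close>

definition chains ::
    "'v::euclidean_space set set \<Rightarrow> nat \<Rightarrow> ('v set \<Rightarrow> ('m, 'k::comm_ring_1) mpolynomial) set" where
  "chains P i = {f. \<forall>H. f H \<noteq> 0 \<longrightarrow> H \<in> P \<and> aff_dim H = int i}"

definition chain_homogeneous ::
    "('v set \<Rightarrow> 'm \<Rightarrow> nat) \<Rightarrow> ('m \<Rightarrow> int) \<Rightarrow>
     ('v set \<Rightarrow> ('m, 'k::comm_ring_1) mpolynomial) \<Rightarrow> bool" where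
  "chain_homogeneous a b f \<longleftrightarrow> (\<forall>H. homogeneous (\<lambda>i. b i - int (a H i)) (f H))"

text \<open>The differentials in all degrees at once; the subtraction of exponents does not truncate
  when the labels are compatible.\<close>

definition cellular_diff ::
    "'v::euclidean_space set set \<Rightarrow> ('v set \<Rightarrow> 'v list) \<Rightarrow> ('v set \<Rightarrow> 'm::finite \<Rightarrow> nat) \<Rightarrow>
     ('v set \<Rightarrow> ('m, 'k::comm_ring_1) mpolynomial) \<Rightarrow> ('v set \<Rightarrow> ('m, 'k) mpolynomial)" where
  "cellular_diff P ori a f G =
     (\<Sum>H\<in>{H\<in>P. G facet_of H}.
        of_int (incidence ori H G) * monom_of (\<lambda>i. a H i - a G i) * f H)"

text \<open>The equivalence relation on the chains of degree 0 whose quotient is the cokernel of the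
  differential from degree 1 to degree 0.\<close>

definition coker_rel ::
    "'v::euclidean_space set set \<Rightarrow> ('v set \<Rightarrow> 'v list) \<Rightarrow> ('v set \<Rightarrow> 'm::finite \<Rightarrow> nat) \<Rightarrow>
     (('v set \<Rightarrow> ('m, 'k::comm_ring_1) mpolynomial) \<times>
      ('v set \<Rightarrow> ('m, 'k) mpolynomial)) set" where
  "coker_rel P ori a =
     {(f, g). f \<in> chains P 0 \<and> g \<in> chains P 0 \<and>
              (\<lambda>H. f H - g H) \<in> cellular_diff P ori a ` chains P 1}"

definition coker_graded_iso ::
    "'v::euclidean_space set set \<Rightarrow> ('v set \<Rightarrow> 'v list) \<Rightarrow> ('v set \<Rightarrow> 'm::finite \<Rightarrow> nat) \<Rightarrow>
     ('m, 'k::comm_ring_1) mpolynomial set \<Rightarrow> bool" where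
  "coker_graded_iso P ori a J \<longleftrightarrow>
     (let R = coker_rel P ori a in
      \<exists>\<psi>. bij_betw \<psi> (chains P 0 // R) J \<and>
        (\<forall>f\<in>chains P 0. \<forall>g\<in>chains P 0.
           \<psi> (R `` {\<lambda>H. f H + g H}) = \<psi> (R `` {f}) + \<psi> (R `` {g})) \<and>
        (\<forall>s. \<forall>f\<in>chains P 0. \<psi> (R `` {\<lambda>H. s * f H}) = s * \<psi> (R `` {f})) \<and>
        (\<forall>b. \<forall>f\<in>chains P 0. chain_homogeneous a b f \<longrightarrow> homogeneous b (\<psi> (R `` {f}))))"

definition supports_cellular_resolution ::
    "'v::euclidean_space set set \<Rightarrow> ('v set \<Rightarrow> 'v list) \<Rightarrow> ('v set \<Rightarrow> 'm::finite \<Rightarrow> nat) \<Rightarrow>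
     ('m, 'k::comm_ring_1) mpolynomial set \<Rightarrow> bool" where
  "supports_cellular_resolution P ori a J \<longleftrightarrow>
     oriented_complex P ori \<and>
     label_compatible P a \<and>
     (\<forall>i\<ge>1. {f \<in> chains P i. cellular_diff P ori a f =
                (\<lambda>_. (0 :: ('m, 'k) mpolynomial))}
            = cellular_diff P ori a ` chains P (Suc i)) \<and>
     coker_graded_iso P ori a J"

text \<open>Minimality: the image of each differential lies in the irrelevant ideal times the target.\<close>

definition supports_minimal_cellular_resolution ::
    "'v::euclidean_space set set \<Rightarrow> ('v set \<Rightarrow> 'v list) \<Rightarrow> ('v set \<Rightarrow> 'm::finite \<Rightarrow> nat) \<Rightarrow>
     ('m, 'k::comm_ring_1) mpolynomial set \<Rightarrow> bool" where
  "supports_minimal_cellular_resolution P ori a J \<longleftrightarrow>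
     supports_cellular_resolution P ori a J \<and>
     (\<forall>i\<ge>1. \<forall>f\<in>chains P i. \<forall>G.
        cellular_diff P ori a f G \<in> (irrelevant_ideal :: ('m, 'k) mpolynomial set))"

end

theory Submission
  imports Defs
begin

text \<open>
  A lifting \<open>w\<close> inducing a regular mixed subdivision is a tropical hyperplane arrangement: its
  mixed cells are the tuples \<open>I\<close> with \<open>I\<^sub>j = argmin\<^sub>k (w\<^sub>j\<^sub>k + z\<^sub>k)\<close>, where \<open>z\<close> ranges over
  \<open>\<real>\<^sup>d\<close>. Perturbing \<open>w\<close> refines the subdivision, so a fine one comes from a generic \<open>w\<close>, for
  which the bipartite graph of every cell is a forest. Then the cells are closed under passing to
  nonempty subtuples, they are products of simplices, their labels are the coarse types, and by
  integrality of transportation polytopes over forests every lattice point of \<open>n\<Delta>\<^sub>d\<^sub>-\<^sub>1\<close> is a vertex.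

  In multidegree \<open>\<beta>\<close> the complex is the chain complex of the cells with coarse type at most \<open>\<beta>\<close>.
  The corresponding points \<open>z\<close> form a set that is closed under pointwise minima and under adding
  constants. It follows that, once some rows of the tuple are prescribed, the possible values of a
  further row are all nonempty subsets of one set. This yields an acyclic matching with a single
  critical cell, a vertex, so the complex has the homology of a point.
\<close>

no_notation Matrix.vec_index (infixl "$" 100)
no_notation Matrix.scalar_prod (infix "\<bullet>" 70)

section \<open>Lower faces of a polytope\<close>

text \<open>A mixed subdivision has to be polyhedral twice: as a subdivision of the dilated simplex
  and, through its Cayley cells, of the product of simplices. Each weight matrix therefore has two
  lifted polytopes, \<open>lifted_product\<close> and \<open>lifted_sum\<close>, and one theorem on
  lower faces serves both. That small perturbations refine is a closedness statement: for a fixed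
  tuple with nonempty rows, the weights having a cell that contains it form a finitely generated
  cone. Fineness then identifies the perturbed subdivision with the given one. Points of cells are
  linked to types by linear programming duality for transportation problems, with column potentials
  z and row minima y. Homology is computed by a matching and not topologically, because then only
  the incidence numbers 1 and -1 are inverted, which works over every field alike; the geometry of
  orientations enters only through these signs, the vanishing of the squared boundary and the
  cancellation at the ends of an edge.\<close>

lemma lower_face_iff:
  "lower_face F Q \<longleftrightarrow>
     F \<noteq> {} \<and> (\<exists>u c. (\<forall>p\<in>Q. c \<le> (u, 1) \<bullet> p) \<and> F = {p\<in>Q. (u, 1) \<bullet> p = c})"
  by (simp add: lower_face_def inner_prod_def)

lemma lower_face_imp_face_of:
  assumes "convex Q" "lower_face F Q"
  shows "F face_of Q"
proof -
  obtain u c where uc: "\<And>p. p \<in> Q \<Longrightarrow> c \<le> (u, 1) \<bullet> p" "F = {p\<in>Q. (u, 1) \<bullet> p = c}"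
    using assms(2) by (auto simp: lower_face_iff)
  have "(Q \<inter> {p. (u, 1) \<bullet> p = c}) face_of Q"
    by (rule face_of_Int_supporting_hyperplane_ge) (use assms(1) uc in auto)
  then show ?thesis
    unfolding uc(2) by (simp only: Int_def mem_Collect_eq)
qed

text \<open>The face is exposed in \<open>Q\<close> by some functional \<open>(a1, s)\<close> that
  is maximal on \<open>G\<close>. Subtracting it from a multiple N of the functional cutting out
  \<open>F\<close> gives one that is minimal exactly on \<open>G\<close>; dividing by its height
  coefficient normalizes it.\<close>

lemma face_of_lower_face:
  assumes Q: "polytope Q" and F: "lower_face F Q" and G: "G face_of F" "G \<noteq> {}"
  shows "lower_face G Q"
proof -
  obtain u c where uc: "\<And>p. p \<in> Q \<Longrightarrow> c \<le> (u, 1) \<bullet> p" "F = {p\<in>Q. (u, 1) \<bullet> p = c}"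
    using F by (auto simp: lower_face_iff)
  have "G face_of Q"
    using lower_face_imp_face_of[OF polytope_imp_convex[OF Q] F] G(1) face_of_trans by blast
  then have "G exposed_face_of Q"
    using exposed_face_of_polyhedron polytope_imp_polyhedron[OF Q] by blast
  then obtain a b where ab: "Q \<subseteq> {p. a \<bullet> p \<le> b}" "G = Q \<inter> {p. a \<bullet> p = b}"
    by (auto simp: exposed_face_of_def)
  obtain a1 s where a: "a = (a1, s)" by (cases a)
  \<comment> \<open>This choice makes both N and the height coefficient r = N - s positive, whatever
    the sign of s.\<close>
  define N r where "N = \<bar>s\<bar> + 1" and "r = N - s"
  have N: "N > 0" "r > 0" by (auto simp: N_def r_def)
  define u' where "u' = (N *\<^sub>R u - a1) /\<^sub>R r"
  have eq: "(u', 1) \<bullet> p = (N * ((u, 1) \<bullet> p) - a \<bullet> p) / r" for p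
  proof -
    have "r * ((u', 1) \<bullet> p) = N * (u \<bullet> fst p) - a1 \<bullet> fst p + r * snd p"
      using N(2) by (simp add: u'_def inner_prod_def inner_diff_left distrib_left)
    then show ?thesis
      using N(2) by (simp add: a inner_prod_def r_def field_simps)
  qed
  have GF: "G \<subseteq> F" using G(1) by (rule face_of_imp_subset)
  have "(N * c - b) / r \<le> (u', 1) \<bullet> p" if "p \<in> Q" for p
  proof -
    have "N * c \<le> N * ((u, 1) \<bullet> p)" "a \<bullet> p \<le> b"
      using uc(1)[OF that] N(1) ab(1) that by auto
    then show ?thesis unfolding eq using N(2) by (intro divide_right_mono) auto
  qed
  moreover have "G = {p\<in>Q. (u', 1) \<bullet> p = (N * c - b) / r}"
  proof (intro equalityI subsetI CollectI conjI; (elim CollectE conjE)?)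
    fix p assume p: "p \<in> G"
    then show "p \<in> Q" using ab by auto
    show "(u', 1) \<bullet> p = (N * c - b) / r" unfolding eq using p GF ab uc by auto
  next
    fix p assume p: "p \<in> Q" "(u', 1) \<bullet> p = (N * c - b) / r"
    have "N * c \<le> N * ((u, 1) \<bullet> p)" "a \<bullet> p \<le> b"
      using uc(1)[OF p(1)] N(1) ab(1) p(1) by auto
    moreover have "N * ((u, 1) \<bullet> p) - a \<bullet> p = N * c - b"
      using p(2) N(2) unfolding eq by simp
    ultimately have "a \<bullet> p = b" by linarith
    then show "p \<in> G" using ab p by auto
  qed
  ultimately show ?thesis using G(2) unfolding lower_face_iff by blast
qed

lemma inj_on_fst_lower_face: "lower_face F Q \<Longrightarrow> inj_on fst F"
  by (auto simp: lower_face_def inj_on_def prod_eq_iff)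

text \<open>Segments of the image lift to segments of \<open>F\<close>. By injectivity the lifted
  segment passes through the point of \<open>G\<close> over the given base point, so the face
  property upstairs applies.\<close>

lemma face_of_fst_image:
  fixes F :: "('a::real_vector \<times> 'b::real_vector) set"
  assumes F: "convex F" "inj_on fst F" and G: "G face_of F"
  shows "fst ` G face_of fst ` F"
proof -
  have GF: "G \<subseteq> F" and cG: "convex G" using G by (auto simp: face_of_def)
  have "fst p \<in> fst ` G \<and> fst q \<in> fst ` G"
    if pq: "p \<in> F" "q \<in> F" and r: "r \<in> G" and seg: "fst r \<in> open_segment (fst p) (fst q)" for p q r
  proof -
    obtain t where t: "0 < t" "t < 1" "fst r = (1 - t) *\<^sub>R fst p + t *\<^sub>R fst q" "fst p \<noteq> fst q"
      using seg by (auto simp: in_segment)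
    define r' where "r' = (1 - t) *\<^sub>R p + t *\<^sub>R q"
    have "r' \<in> F" unfolding r'_def using F(1) pq t by (simp add: convex_alt)
    moreover have "fst r' = fst r" unfolding r'_def t(3) by simp
    ultimately have "r = r'" using F(2) r GF by (auto simp: inj_on_def)
    then have "r \<in> open_segment p q" using t unfolding r'_def in_segment by auto
    then have "p \<in> G" "q \<in> G" using G pq r by (auto simp: face_of_def)
    then show ?thesis by blast
  qed
  then show ?thesis
    unfolding face_of_def using GF convex_linear_image[OF linear_fst cG] by auto
qed

lemma face_of_fst_vimage:
  fixes F :: "('a::real_vector \<times> 'b::real_vector) set"
  assumes F: "convex F" and K: "K face_of fst ` F"
  shows "{p\<in>F. fst p \<in> K} face_of F"
proof -
  have "convex (F \<inter> fst -` K)"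
    using F K by (intro convex_Int convex_linear_vimage linear_fst) (auto simp: face_of_def)
  moreover have "fst a \<in> K \<and> fst b \<in> K"
    if "a \<in> F" "b \<in> F" "x \<in> F" "fst x \<in> K" "x \<in> open_segment a b" for a b x
  \<comment> \<open>A segment inside a fibre projects to a single point, to which the face property
    of \<open>K\<close> says nothing.\<close>
  proof (cases "fst a = fst b")
    case True
    then have "fst x = fst a" using that(5) by (auto simp: in_segment simp flip: scaleR_add_left)
    then show ?thesis using that True by simp
  next
    case False
    then have "fst x \<in> open_segment (fst a) (fst b)" using that(5) by (auto simp: in_segment)
    then show ?thesis using K that by (auto simp: face_of_def)
  qed
  ultimately have "F \<inter> fst -` K face_of F"
    unfolding face_of_def by (metis IntD1 IntD2 IntI Int_lower1 vimageE vimageI)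
  then show ?thesis by (simp add: Int_def vimage_def)
qed

text \<open>The lowest point of \<open>Q\<close> over x lies on the relative boundary of the upward
  closure \<open>E\<close> of \<open>Q\<close>. A supporting hyperplane of \<open>E\<close> there is
  not vertical, because x is relatively interior to the projection, so it can be rescaled to height
  coefficient 1.\<close>

lemma rel_interior_lower_face:
  fixes Q :: "('v::euclidean_space \<times> real) set"
  assumes Q: "polytope Q" and x: "x \<in> rel_interior (fst ` Q)"
  shows "\<exists>F. lower_face F Q \<and> x \<in> fst ` F"
proof -
  let ?S = "fst ` Q"
  have cQ: "convex Q" "compact Q" using Q polytope_imp_convex polytope_imp_compact by auto
  have cS: "convex ?S" using cQ(1) convex_linear_image linear_fst by blast
  have xS: "x \<in> ?S" using x rel_interior_subset by blast
  have "compact (Q \<inter> {p. fst p = x})"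
    by (intro compact_Int_closed cQ closed_Collect_eq continuous_intros)
  moreover have "Q \<inter> {p. fst p = x} \<noteq> {}" using xS by auto
  ultimately obtain p where p: "p \<in> Q" "fst p = x" "\<And>q. q \<in> Q \<Longrightarrow> fst q = x \<Longrightarrow> snd p \<le> snd q"
    using continuous_attains_inf[of "Q \<inter> {p. fst p = x}" snd] continuous_on_snd continuous_on_id by blast
  define h where "h = snd p"
  define E where "E = {q. \<exists>s. (fst q, s) \<in> Q \<and> s \<le> snd q}"
  have E: "convex E"
  proof (unfold convex_alt, intro ballI allI impI)
    fix a b and t :: real assume a: "a \<in> E" and b: "b \<in> E" and t: "0 \<le> t \<and> t \<le> 1"
    obtain r s where "(fst a, r) \<in> Q" "r \<le> snd a" "(fst b, s) \<in> Q" "s \<le> snd b"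
      using a b by (auto simp: E_def)
    moreover from this have "(1 - t) *\<^sub>R (fst a, r) + t *\<^sub>R (fst b, s) \<in> Q"
      using cQ(1) t unfolding convex_alt by blast
    moreover have "(1 - t) * r + t * s \<le> (1 - t) * snd a + t * snd b"
      using calculation t by (intro add_mono mult_left_mono) auto
    ultimately show "(1 - t) *\<^sub>R a + t *\<^sub>R b \<in> E"
      by (auto simp: E_def)
  qed
  have ph: "p = (x, h)" using p(2) by (auto simp: h_def)
  have inE: "(x, t) \<in> E \<longleftrightarrow> h \<le> t" for t
  proof
    assume "(x, t) \<in> E"
    then obtain s where "(x, s) \<in> Q" "s \<le> t" by (auto simp: E_def)
    then show "h \<le> t" using p(3)[of "(x, s)"] by (simp add: h_def)
  next
    assume "h \<le> t"
    then show "(x, t) \<in> E" using p(1) unfolding ph by (auto simp: E_def)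
  qed
  have QE: "Q \<subseteq> E" by (auto simp: E_def)
  have nri: "(x, h) \<notin> rel_interior E"
  proof
    assume "(x, h) \<in> rel_interior E"
    moreover have x1: "(x, h + 1) \<in> E" by (simp add: inE)
    \<comment> \<open>A relatively interior point could be overshot a little on the way down from
      \<open>(x, h + 1)\<close>, below the minimal height.\<close>
    ultimately obtain e where "e > 1" "(1 - e) *\<^sub>R (x, h + 1) + e *\<^sub>R (x, h) \<in> E"
      using convex_rel_interior_iff[OF E, of "(x, h)"] by blast
    moreover have "(1 - e) *\<^sub>R (x, h + 1) + e *\<^sub>R (x, h) = (x, h + 1 - e)"
      by (simp add: algebra_simps)
    ultimately show False using inE by simp
  qed
  obtain a where a: "a \<noteq> 0" "\<And>y. y \<in> E \<Longrightarrow> a \<bullet> (x, h) \<le> a \<bullet> y"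
    "\<And>y. y \<in> rel_interior E \<Longrightarrow> a \<bullet> (x, h) < a \<bullet> y"
    using supporting_hyperplane_rel_boundary[OF E, of "(x,h)"] inE nri by auto
  obtain a1 s where as: "a = (a1, s)" by (cases a)
  have s0: "s \<ge> 0" using a(2)[of "(x, h+1)"] inE by (simp add: as inner_prod_def algebra_simps)
  have "s \<noteq> 0"
  proof
    \<comment> \<open>A vertical hyperplane would support the projection at a relatively interior
      point, hence contain all of it, and so could not be strictly below the relative interior of
      \<open>E\<close>.\<close>
    assume s: "s = 0"
    have le: "a1 \<bullet> x \<le> a1 \<bullet> y" if "y \<in> ?S" for y
      using that a(2) QE by (auto simp: as s inner_prod_def)
    have eq: "a1 \<bullet> y = a1 \<bullet> x" if y: "y \<in> ?S" for y
    proof -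
      obtain e where e: "e > 1" "(1 - e) *\<^sub>R y + e *\<^sub>R x \<in> ?S"
        using convex_rel_interior_iff[OF cS, of x] x y by blast
      have "a1 \<bullet> x \<le> (1 - e) * (a1 \<bullet> y) + e * (a1 \<bullet> x)"
        using le[OF e(2)] by (simp add: inner_add_right)
      then have "(e - 1) * (a1 \<bullet> y) \<le> (e - 1) * (a1 \<bullet> x)" by (simp add: algebra_simps)
      then have "a1 \<bullet> y \<le> a1 \<bullet> x" using e(1) by simp
      then show ?thesis using le[OF y] by simp
    qed
    have "rel_interior E \<noteq> {}" using rel_interior_eq_empty[OF E] inE by auto
    then obtain q where q: "q \<in> rel_interior E" by auto
    then have "q \<in> E" using rel_interior_subset by blast
    then obtain s' where "(fst q, s') \<in> Q" by (auto simp: E_def)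
    then have "fst q \<in> ?S" by (metis fst_conv image_eqI)
    then show False using a(3)[OF q] eq[of "fst q"] by (simp add: as s inner_prod_def)
  qed
  then have s: "s > 0" using s0 by simp
  define u c where "u = a1 /\<^sub>R s" and "c = (u, 1) \<bullet> (x, h)"
  have eq: "(u, 1) \<bullet> q = (a \<bullet> q) / s" for q
    using s by (simp add: u_def as inner_prod_def field_simps)
  have "c \<le> (u, 1) \<bullet> q" if "q \<in> Q" for q
    unfolding c_def eq using divide_right_mono[OF a(2) less_imp_le[OF s]] that QE by blast
  then have "lower_face {q\<in>Q. (u, 1) \<bullet> q = c} Q"
    unfolding lower_face_iff using p(1) ph c_def by fast
  moreover have "p \<in> {q\<in>Q. (u, 1) \<bullet> q = c}"
    using p(1) ph c_def by simp
  then have "x \<in> fst ` {q\<in>Q. (u, 1) \<bullet> q = c}"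
    using p(2) by blast
  ultimately show ?thesis by blast
qed

text \<open>Over a common base point two lower faces have the same height, since each contains a
  lowest point of \<open>Q\<close> there; so intersections of projections come from intersections of
  faces. Covering is known over the relative interior only and extends because a finite union of
  polytopes is closed.\<close>

theorem lower_faces_polyhedral_subdivision:
  fixes Q :: "('v::euclidean_space \<times> real) set"
  assumes Q: "polytope Q"
  shows "polyhedral_subdivision {fst ` F | F. lower_face F Q} (fst ` Q)"
proof -
  let ?P = "{fst ` F | F. lower_face F Q}"
  have cQ: "convex Q" using Q polytope_imp_convex by auto
  have face: "F face_of Q" if "lower_face F Q" for F
    using lower_face_imp_face_of[OF cQ that] .
  have poly: "polytope F" if "lower_face F Q" for F
    using face[OF that] Q face_of_polytope_polytope by blast
  have fin: "finite ?P"
  proof -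
    have "finite ((`) fst ` {F. F face_of Q})"
      using finite_polytope_faces[OF Q] by simp
    then show ?thesis by (rule rev_finite_subset) (use face in blast)
  qed
  have pol: "polytope C \<and> C \<noteq> {}" if C: "C \<in> ?P" for C
  proof -
    obtain F where "C = fst ` F" "lower_face F Q" using C by blast
    then show ?thesis
      using polytope_linear_image[OF linear_fst poly] lower_face_def by blast
  qed
  have faces: "K \<in> ?P" if C: "C \<in> ?P" and K: "K face_of C" "K \<noteq> {}" for C K
  proof -
    obtain F where F: "C = fst ` F" "lower_face F Q" using C by blast
    define G where "G = {p\<in>F. fst p \<in> K}"
    have KG: "K = fst ` G"
      using face_of_imp_subset[OF K(1)] unfolding F(1) G_def by blast
    have "G face_of F" unfolding G_def
      by (rule face_of_fst_vimage) (use K(1) F poly[OF F(2)] polytope_imp_convex in blast)+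
    then have "lower_face G Q" using face_of_lower_face[OF Q F(2)] K(2) KG by blast
    then show ?thesis using KG by blast
  qed
  have int: "(fst ` F \<inter> fst ` G) face_of fst ` F" if F: "lower_face F Q" and G: "lower_face G Q" for F G
  proof -
    have "fst ` F \<inter> fst ` G = fst ` (F \<inter> G)"
    proof (intro equalityI subsetI)
      fix x assume "x \<in> fst ` F \<inter> fst ` G"
      then obtain p q where pq: "p \<in> F" "fst p = x" "q \<in> G" "fst q = x" by auto
      have "p \<in> Q" "q \<in> Q"
        using pq face_of_imp_subset[OF face[OF F]] face_of_imp_subset[OF face[OF G]] by blast+
      obtain u c where "\<And>r. r \<in> Q \<Longrightarrow> c \<le> u \<bullet> fst r + snd r" "F = {p \<in> Q. u \<bullet> fst p + snd p = c}"
        using F unfolding lower_face_def by blast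
      then have "snd p \<le> snd q" using pq \<open>q \<in> Q\<close> by fastforce
      obtain u c where "\<And>r. r \<in> Q \<Longrightarrow> c \<le> u \<bullet> fst r + snd r" "G = {p \<in> Q. u \<bullet> fst p + snd p = c}"
        using G unfolding lower_face_def by blast
      then have "snd q \<le> snd p" using pq \<open>p \<in> Q\<close> by fastforce
      then have "p = q" using pq \<open>snd p \<le> snd q\<close> by (simp add: prod_eq_iff)
      then show "x \<in> fst ` (F \<inter> G)" using pq by auto
    qed auto
    moreover have "(F \<inter> G) face_of F"
      using face_of_Int[OF face[OF F] face[OF G]] face[OF F]
      by (meson Int_lower1 face_of_imp_subset face_of_subset)
    ultimately show ?thesis
      using face_of_fst_image[OF polytope_imp_convex[OF poly[OF F]] inj_on_fst_lower_face[OF F]] by simp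
  qed
  have "\<Union>?P = fst ` Q"
  proof
    show "\<Union>?P \<subseteq> fst ` Q" unfolding lower_face_def by blast
    have "rel_interior (fst ` Q) \<subseteq> \<Union>?P" using rel_interior_lower_face[OF Q] by blast
    moreover have "closed (\<Union>?P)"
      by (rule closed_Union[OF fin]) (use pol polytope_imp_closed in blast)
    ultimately have "closure (rel_interior (fst ` Q)) \<subseteq> \<Union>?P" by (simp add: closure_minimal)
    then show "fst ` Q \<subseteq> \<Union>?P"
      unfolding convex_closure_rel_interior[OF convex_linear_image[OF linear_fst cQ]]
      by (rule order_trans[OF closure_subset])
  qed
  moreover have "polyhedral_complex ?P"
    unfolding polyhedral_complex_def
  proof (intro conjI ballI allI impI)
    fix C D assume CD: "C \<in> ?P" "D \<in> ?P"
    obtain F G where FG: "C = fst ` F" "lower_face F Q" "D = fst ` G" "lower_face G Q"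
      using CD by blast
    show "(C \<inter> D) face_of C" unfolding FG by (rule int[OF FG(2,4)])
    show "(C \<inter> D) face_of D" unfolding FG using int[OF FG(4,2)] by (simp add: Int_commute)
  next
    fix C K assume "C \<in> ?P" "K face_of C \<and> K \<noteq> {}"
    then show "K \<in> ?P" using faces by blast
  qed (use fin pol in blast)+
  ultimately show ?thesis unfolding polyhedral_subdivision_def by simp
qed

section \<open>Types of a tropical hyperplane arrangement\<close>

text \<open>Coefficients are indexed by \<open>K\<close> and not by the image, so coinciding points
  \<open>f k\<close> cause no case distinctions.\<close>

lemma convex_hull_image:
  fixes f :: "'i \<Rightarrow> 'v::real_vector"
  assumes "finite K"
  shows "convex hull (f ` K) = {\<Sum>k\<in>K. u k *\<^sub>R f k | u. (\<forall>k\<in>K. 0 \<le> u k) \<and> sum u K = 1}"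
    (is "_ = ?R")
proof
  have "f k \<in> ?R" if "k \<in> K" for k
  proof -
    have "(\<Sum>l\<in>K. (if l = k then 1 else 0) *\<^sub>R f l) = (\<Sum>l\<in>K. if l = k then f l else 0)"
      by (intro sum.cong) auto
    then have "f k = (\<Sum>l\<in>K. (if l = k then 1 else 0) *\<^sub>R f l)" using assms that by simp
    moreover have "sum (\<lambda>l. if l = k then 1 else (0::real)) K = 1" using assms that by simp
    moreover have "\<forall>l\<in>K. 0 \<le> (if l = k then 1 else (0::real))" by simp
    ultimately show ?thesis
      by (intro CollectI exI[of _ "\<lambda>l. if l = k then 1 else 0"]) blast
  qed
  moreover have "convex ?R"
  proof (rule convexI)
    fix x y and s t :: real
    assume x: "x \<in> ?R" and y: "y \<in> ?R" and st: "0 \<le> s" "0 \<le> t" "s + t = 1"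
    obtain u where u: "x = (\<Sum>k\<in>K. u k *\<^sub>R f k)" "\<forall>k\<in>K. 0 \<le> u k" "sum u K = 1" using x by blast
    obtain v where v: "y = (\<Sum>k\<in>K. v k *\<^sub>R f k)" "\<forall>k\<in>K. 0 \<le> v k" "sum v K = 1" using y by blast
    let ?w = "\<lambda>k. s * u k + t * v k"
    have "s *\<^sub>R x + t *\<^sub>R y = (\<Sum>k\<in>K. ?w k *\<^sub>R f k)"
      unfolding u(1) v(1) by (simp add: scaleR_sum_right sum.distrib scaleR_add_left)
    moreover have "\<forall>k\<in>K. 0 \<le> ?w k" using u v st by simp
    moreover have "sum ?w K = 1"
      using u v st by (simp add: sum.distrib flip: sum_distrib_left)
    ultimately show "s *\<^sub>R x + t *\<^sub>R y \<in> ?R" by (intro CollectI exI[of _ ?w]) blast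
  qed
  ultimately show "convex hull (f ` K) \<subseteq> ?R" by (intro hull_minimal) auto
  show "?R \<subseteq> convex hull (f ` K)"
  proof
    fix x assume "x \<in> ?R"
    then obtain u where u: "x = (\<Sum>k\<in>K. u k *\<^sub>R f k)" "\<forall>k\<in>K. 0 \<le> u k" "sum u K = 1" by blast
    show "x \<in> convex hull (f ` K)" unfolding u(1)
    proof (rule convex_sum[OF assms convex_convex_hull u(3)])
      fix k assume k: "k \<in> K"
      show "0 \<le> u k" using u(2) k by simp
      show "f k \<in> convex hull (f ` K)" using k by (intro hull_inc imageI)
    qed
  qed
qed

text \<open>The excess of the functional over c at a convex combination is the same combination of
  the excesses at the generators. These are nonnegative, so where c is attained only tight
  generators carry weight.\<close>

lemma lower_face_convex_hull:
  fixes f :: "'i::finite \<Rightarrow> 'v::euclidean_space" and h :: "'i \<Rightarrow> real"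
  defines "Q \<equiv> convex hull range (\<lambda>i. (f i, h i))"
  assumes c: "\<And>i. c \<le> u \<bullet> f i + h i"
  shows "fst ` {p\<in>Q. u \<bullet> fst p + snd p = c} = convex hull (f ` {i. u \<bullet> f i + h i = c})"
    and "p \<in> Q \<Longrightarrow> c \<le> u \<bullet> fst p + snd p"
proof -
  let ?K = "{i. u \<bullet> f i + h i = c}"
  have val: "u \<bullet> fst (\<Sum>i\<in>UNIV. \<mu> i *\<^sub>R (f i, h i)) + snd (\<Sum>i\<in>UNIV. \<mu> i *\<^sub>R (f i, h i))
       = c + (\<Sum>i\<in>UNIV. \<mu> i * (u \<bullet> f i + h i - c))" if "sum \<mu> UNIV = 1" for \<mu> :: "'i \<Rightarrow> real"
    using that by (simp add: fst_sum snd_sum inner_sum_right sum.distrib sum_subtractf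
        algebra_simps flip: sum_distrib_right sum_distrib_left)
  show le: "c \<le> u \<bullet> fst p + snd p" if p: "p \<in> Q" for p
  proof -
    obtain \<mu> where \<mu>: "p = (\<Sum>i\<in>UNIV. \<mu> i *\<^sub>R (f i, h i))" "\<forall>i. 0 \<le> \<mu> i" "sum \<mu> UNIV = 1"
      using p unfolding Q_def convex_hull_image[OF finite] by blast
    show ?thesis unfolding \<mu>(1) val[OF \<mu>(3)] using \<mu>(2) c by (simp add: sum_nonneg)
  qed
  show "fst ` {p\<in>Q. u \<bullet> fst p + snd p = c} = convex hull (f ` ?K)"
  proof (intro equalityI subsetI)
    fix x assume "x \<in> fst ` {p\<in>Q. u \<bullet> fst p + snd p = c}"
    then obtain p where p: "p \<in> Q" "u \<bullet> fst p + snd p = c" "x = fst p" by auto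
    obtain \<mu> where \<mu>: "p = (\<Sum>i\<in>UNIV. \<mu> i *\<^sub>R (f i, h i))" "\<forall>i. 0 \<le> \<mu> i" "sum \<mu> UNIV = 1"
      using p(1) unfolding Q_def convex_hull_image[OF finite] by blast
    have "(\<Sum>i\<in>UNIV. \<mu> i * (u \<bullet> f i + h i - c)) = 0"
      using p(2) val[OF \<mu>(3)] unfolding \<mu>(1) by simp
    then have "\<forall>i. \<mu> i * (u \<bullet> f i + h i - c) = 0"
      using sum_nonneg_eq_0_iff[of UNIV "\<lambda>i. \<mu> i * (u \<bullet> f i + h i - c)"] \<mu>(2) c by simp
    then have z: "\<mu> i = 0" if "i \<notin> ?K" for i using that by auto
    have "x = (\<Sum>i\<in>UNIV. \<mu> i *\<^sub>R f i)" unfolding p(3) \<mu>(1) by (simp add: fst_sum)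
    also have "\<dots> = (\<Sum>i\<in>?K. \<mu> i *\<^sub>R f i)"
      by (rule sum.mono_neutral_right) (use z in auto)
    finally have "x = (\<Sum>i\<in>?K. \<mu> i *\<^sub>R f i)" .
    moreover have "sum \<mu> ?K = sum \<mu> UNIV"
      by (rule sum.mono_neutral_left) (use z in auto)
    ultimately show "x \<in> convex hull (f ` ?K)"
      using \<mu>(2,3) unfolding convex_hull_image[OF finite] by auto
  next
    fix x assume "x \<in> convex hull (f ` ?K)"
    moreover have "f ` ?K \<subseteq> fst ` {p\<in>Q. u \<bullet> fst p + snd p = c}"
    proof (rule image_subsetI)
      fix i assume "i \<in> ?K"
      moreover have "(f i, h i) \<in> Q" unfolding Q_def by (intro hull_inc rangeI)
      ultimately show "f i \<in> fst ` {p\<in>Q. u \<bullet> fst p + snd p = c}"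
        by (intro image_eqI[of _ _ "(f i, h i)"]) auto
    qed
    moreover have "convex {p\<in>Q. u \<bullet> fst p + snd p = c}"
    proof -
      have "{p. u \<bullet> fst p + snd p = c} = {p. (u, 1) \<bullet> p = c}" by (simp add: inner_prod_def)
      then have "convex (Q \<inter> {p. u \<bullet> fst p + snd p = c})"
        using convex_hyperplane by (metis convex_Int convex_convex_hull Q_def)
      then show ?thesis by (simp only: Int_def mem_Collect_eq)
    qed
    ultimately show "x \<in> fst ` {p\<in>Q. u \<bullet> fst p + snd p = c}"
      by (meson convex_linear_image hull_minimal linear_fst subsetD)
  qed
qed

lemma lower_faces_convex_hull:
  fixes f :: "'i::finite \<Rightarrow> 'v::euclidean_space" and h :: "'i \<Rightarrow> real"
  shows "{fst ` F | F. lower_face F (convex hull range (\<lambda>i. (f i, h i)))} =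
    {convex hull (f ` {i. u \<bullet> f i + h i = c}) | u c.
       (\<forall>i. c \<le> u \<bullet> f i + h i) \<and> (\<exists>i. u \<bullet> f i + h i = c)}" (is "?L = ?R")
proof (intro equalityI subsetI)
  let ?Q = "convex hull range (\<lambda>i. (f i, h i))"
  fix C assume "C \<in> ?L"
  then obtain F u c where F: "C = fst ` F" "F \<noteq> {}" "\<forall>p\<in>?Q. c \<le> u \<bullet> fst p + snd p"
    "F = {p\<in>?Q. u \<bullet> fst p + snd p = c}" unfolding lower_face_def by blast
  have c: "c \<le> u \<bullet> f i + h i" for i
    using F(3) hull_inc[of "(f i, h i)" "range (\<lambda>i. (f i, h i))" convex] by fastforce
  have C: "C = convex hull (f ` {i. u \<bullet> f i + h i = c})"
    unfolding F(1,4) by (rule lower_face_convex_hull(1)[OF c])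
  have "C \<noteq> {}" using F(1,2) by simp
  then have "\<exists>i. u \<bullet> f i + h i = c" unfolding C by auto
  then show "C \<in> ?R" using C c by blast
next
  let ?Q = "convex hull range (\<lambda>i. (f i, h i))"
  fix C assume "C \<in> ?R"
  then obtain u c i where C: "C = convex hull (f ` {i. u \<bullet> f i + h i = c})"
    "\<And>i. c \<le> u \<bullet> f i + h i" "u \<bullet> f i + h i = c" by blast
  let ?F = "{p\<in>?Q. u \<bullet> fst p + snd p = c}"
  have CF: "C = fst ` ?F" unfolding C(1) by (rule lower_face_convex_hull(1)[OF C(2), symmetric])
  have "f i \<in> C" unfolding C(1) using C(3) by (auto intro: hull_inc)
  then have "?F \<noteq> {}" unfolding CF by blast
  then have "lower_face ?F ?Q"
    unfolding lower_face_def using lower_face_convex_hull(2)[where c = c and u = u and f = f and h = h, OF C(2)] by blast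
  then show "C \<in> ?L" using CF by blast
qed


definition min_type :: "('n \<Rightarrow> 'd \<Rightarrow> real) \<Rightarrow> ('d \<Rightarrow> real) \<Rightarrow> 'n \<Rightarrow> 'd set" where
  "min_type w z j = {k. \<forall>l. w j k + z k \<le> w j l + z l}"

lemma min_type_eqI:
  assumes "\<And>j k. y j \<le> w j k + z k" "\<And>j. \<exists>k. w j k + z k = y j"
  shows "min_type w z j = {k. w j k + z k = y j}"
  using assms unfolding min_type_def by (metis order_antisym)

text \<open>The row minima y and the vector z form a pair of dual potentials: an inequality
  everywhere, with equality exactly on the type. Later proofs work with this pair instead of
  comparing entries.\<close>

lemma min_type_ex:
  fixes w :: "'n \<Rightarrow> 'd::finite \<Rightarrow> real"
  shows "\<exists>y. (\<forall>j k. y j \<le> w j k + z k) \<and> (\<forall>j. \<exists>k. w j k + z k = y j) \<and>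
    (\<forall>j. min_type w z j = {k. w j k + z k = y j})"
proof -
  define y where "y j = Min (range (\<lambda>k. w j k + z k))" for j
  have 1: "y j \<le> w j k + z k" for j k unfolding y_def by simp
  have 2: "\<exists>k. w j k + z k = y j" for j
  proof -
    have "y j \<in> range (\<lambda>k. w j k + z k)" unfolding y_def by (rule Min_in) auto
    then show ?thesis by (elim imageE) (rule exI, erule sym)
  qed
  show ?thesis by (intro exI[of _ y] conjI allI 1 2 min_type_eqI)
qed

lemma min_type_nonempty: "min_type w z j \<noteq> ({} :: 'd::finite set)"
proof -
  obtain y where "\<exists>k. w j k + z k = y j" "min_type w z j = {k. w j k + z k = y j}"
    using min_type_ex[of w z] by blast
  then show ?thesis by simp
qed

lemma cayley_cell_image:
  "cayley_cell I = convex hull ((\<lambda>(j, k). product_vertex j k) ` {(j, k). k \<in> I j})"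
  unfolding cayley_cell_def by (rule arg_cong[where f = "\<lambda>X. convex hull X"]) auto

text \<open>The functional with coordinates \<open>(axis j 1, axis k 1)\<close> is 2 at this vertex
  and at most 1 at every other one, so no hull of other vertices contains it. Hence a Cayley cell
  determines its tuple.\<close>

lemma product_vertex_in_cayley_cell: "product_vertex j k \<in> cayley_cell I \<longleftrightarrow> k \<in> I j"
proof
  show "k \<in> I j \<Longrightarrow> product_vertex j k \<in> cayley_cell I"
    unfolding cayley_cell_def by (auto intro: hull_inc)
  assume p: "product_vertex j k \<in> cayley_cell I"
  show "k \<in> I j"
  proof (rule ccontr)
    assume "k \<notin> I j"
    then have "{product_vertex j k |j k. k \<in> I j} \<subseteq> {p. (axis j 1, axis k 1) \<bullet> p \<le> 1}"
      by (auto simp: product_vertex_def inner_prod_def inner_axis_axis)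
    then have "cayley_cell I \<subseteq> {p. (axis j 1, axis k 1) \<bullet> p \<le> 1}"
      unfolding cayley_cell_def by (rule hull_minimal) (rule convex_halfspace_le)
    then show False using p by (auto simp: product_vertex_def inner_prod_def inner_axis_axis)
  qed
qed

lemma cayley_cell_inject:
  assumes "cayley_cell I = cayley_cell J"
  shows "I = J"
proof
  fix j
  have "k \<in> I j \<longleftrightarrow> k \<in> J j" for k
    using product_vertex_in_cayley_cell[of j k I] product_vertex_in_cayley_cell[of j k J] assms by simp
  then show "I j = J j" by blast
qed

lemma lifted_product_eq:
  "lifted_product w = convex hull range (\<lambda>i. ((\<lambda>(j, k). product_vertex j k) i, (\<lambda>(j, k). w j k) i))"
proof -
  have "{(product_vertex j k, w j k) |j k. True}
      = range (\<lambda>i. ((\<lambda>(j, k). product_vertex j k) i, (\<lambda>(j, k). w j k) i))"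
    unfolding full_SetCompr_eq[symmetric] by auto
  then show ?thesis unfolding lifted_product_def by simp
qed

text \<open>A functional on the product space is a pair of vectors: the second is z, and the first
  is -y up to the constant c, which y absorbs.\<close>

lemma lower_faces_lifted_product:
  "{fst ` F | F. lower_face F (lifted_product w)} =
   {cayley_cell (\<lambda>j. {k. w j k + z k = y j}) | y z.
      (\<forall>j k. y j \<le> w j k + z k) \<and> (\<exists>j k. w j k + z k = y j)}" (is "_ = ?R")
proof -
  let ?f = "\<lambda>(j::'a, k::'b). product_vertex j k" and ?h = "\<lambda>(j, k). w j k"
  have val: "(u::(real^'a) \<times> (real^'b)) \<bullet> ?f i + ?h i = fst u $ fst i + snd u $ snd i + w (fst i) (snd i)" for u i
    by (cases i) (simp add: product_vertex_def inner_prod_def inner_axis)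
  have "{convex hull (?f ` {i. u \<bullet> ?f i + ?h i = c}) | u c.
       (\<forall>i. c \<le> u \<bullet> ?f i + ?h i) \<and> (\<exists>i. u \<bullet> ?f i + ?h i = c)} = ?R" (is "?L = _")
  proof (intro equalityI subsetI)
    fix C assume "C \<in> ?L"
    then obtain u c where C: "C = convex hull (?f ` {i. u \<bullet> ?f i + ?h i = c})"
      "\<forall>i. c \<le> u \<bullet> ?f i + ?h i" "\<exists>i. u \<bullet> ?f i + ?h i = c" by blast
    define y z where "y j = c - fst u $ j" and "z k = snd u $ k" for j k
    have iff: "u \<bullet> ?f i + ?h i = c \<longleftrightarrow> w (fst i) (snd i) + z (snd i) = y (fst i)" for i
      unfolding val y_def z_def by linarith
    have "C = cayley_cell (\<lambda>j. {k. w j k + z k = y j})"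
      unfolding C(1) cayley_cell_image iff by (intro arg_cong[where f = "\<lambda>X. convex hull X"] image_cong) auto
    moreover have "\<forall>j k. y j \<le> w j k + z k"
      using C(2) unfolding val y_def z_def by (auto simp: algebra_simps)
    moreover have "\<exists>j k. w j k + z k = y j" using C(3) unfolding iff by auto
    ultimately show "C \<in> ?R" by blast
  next
    fix C assume "C \<in> ?R"
    then obtain y z where C: "C = cayley_cell (\<lambda>j. {k. w j k + z k = y j})"
      "\<forall>j k. y j \<le> w j k + z k" "\<exists>j k. w j k + z k = y j" by blast
    define u where "u = ((\<chi> j. - y j), (\<chi> k. z k))"
    have iff: "u \<bullet> ?f i + ?h i = 0 \<longleftrightarrow> w (fst i) (snd i) + z (snd i) = y (fst i)" for i
      unfolding val u_def by auto
    have "C = convex hull (?f ` {i. u \<bullet> ?f i + ?h i = 0})"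
      unfolding C(1) cayley_cell_image iff by (intro arg_cong[where f = "\<lambda>X. convex hull X"] image_cong) auto
    moreover have "\<forall>i. 0 \<le> u \<bullet> ?f i + ?h i" using C(2) unfolding val u_def by (auto simp: algebra_simps)
    moreover have "\<exists>i. u \<bullet> ?f i + ?h i = 0" using C(3) unfolding iff by auto
    ultimately show "C \<in> ?L" by blast
  qed
  then show ?thesis unfolding lifted_product_eq lower_faces_convex_hull .
qed

text \<open>If no row is empty, every bound y j is attained and is therefore the minimum of its row.
  The lower faces with an empty row lie over a proper face of the first factor.\<close>

lemma cayley_corresponds_lower_faces:
  fixes w :: "'n::finite \<Rightarrow> 'd::finite \<Rightarrow> real"
  shows "cayley_corresponds \<Sigma> {fst ` F | F. lower_face F (lifted_product w)} \<longleftrightarrow>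
         \<Sigma> = range (min_type w)"
proof -
  have "{I. (\<forall>j. I j \<noteq> {}) \<and> cayley_cell I \<in> {fst ` F | F. lower_face F (lifted_product w)}}
      = range (min_type w)" (is "?L = _")
  proof (intro equalityI subsetI)
    fix I assume "I \<in> ?L"
    then obtain y z where ne: "\<And>j. I j \<noteq> {}" and y: "\<And>j k. y j \<le> w j k + z k"
      and I: "cayley_cell I = cayley_cell (\<lambda>j. {k. w j k + z k = y j})"
      unfolding lower_faces_lifted_product by blast
    have I: "I = (\<lambda>j. {k. w j k + z k = y j})" by (rule cayley_cell_inject[OF I])
    then have "I j = min_type w z j" for j
      using min_type_eqI[of y w z] y ne by fastforce
    then show "I \<in> range (min_type w)" by blast
  next
    fix I assume "I \<in> range (min_type w)"
    then obtain z where I: "I = min_type w z" by blast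
    obtain y where y: "\<And>j k. y j \<le> w j k + z k" "\<And>j. \<exists>k. w j k + z k = y j"
      "\<And>j. min_type w z j = {k. w j k + z k = y j}" using min_type_ex[of w z] by blast
    have "I = (\<lambda>j. {k. w j k + z k = y j})" using I y(3) by auto
    then have "cayley_cell I \<in> {fst ` F | F. lower_face F (lifted_product w)}"
      using y(1,2) unfolding lower_faces_lifted_product by blast
    moreover have "\<forall>j. I j \<noteq> {}" unfolding I using min_type_nonempty[of w z] by simp
    ultimately have "(\<forall>j. I j \<noteq> {}) \<and> cayley_cell I \<in> {fst ` F | F. lower_face F (lifted_product w)}"
      by (rule conjI[rotated])
    then show "I \<in> ?L" unfolding mem_Collect_eq .
  qed
  then show ?thesis unfolding cayley_corresponds_def by blast
qed

lemma regular_product_subdivision_lower_faces: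
  "regular_product_subdivision {fst ` F | F. lower_face F (lifted_product (w :: 'n::finite \<Rightarrow> 'd::finite \<Rightarrow> real))}"
proof -
  have Q: "polytope (lifted_product w)"
    unfolding lifted_product_eq by (rule polytope_convex_hull) simp
  have "fst ` lifted_product w = convex hull (fst ` range (\<lambda>i. ((\<lambda>(j, k). product_vertex j k) i, (\<lambda>(j, k). w j k) i)))"
    unfolding lifted_product_eq by (rule convex_hull_linear_image[OF linear_fst])
  also have "fst ` range (\<lambda>i. ((\<lambda>(j, k). product_vertex j k) i, (\<lambda>(j, k). w j k) i)) =
      (\<lambda>(j, k). (axis j 1, axis k 1)) ` (UNIV \<times> UNIV)"
    unfolding image_image UNIV_Times_UNIV by (rule image_cong) (auto simp: product_vertex_def)
  also have "\<dots> = range (\<lambda>j. axis j 1) \<times> range (\<lambda>k. axis k 1)"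
    by (rule image_paired_Times)
  also have "convex hull \<dots> = simplex_product"
    unfolding simplex_product_def simplex_face_def by (rule convex_hull_Times)
  finally have "polyhedral_subdivision {fst ` F | F. lower_face F (lifted_product w)} simplex_product"
    using lower_faces_polyhedral_subdivision[OF Q] by (simp only:)
  moreover have "\<forall>C\<in>{fst ` F | F. lower_face F (lifted_product w)}. \<exists>I. C = cayley_cell I"
    unfolding lower_faces_lifted_product by blast
  ultimately show ?thesis
    unfolding regular_product_subdivision_def product_subdivision_def
    by (intro conjI exI[of _ w] refl)
qed

section \<open>Mixed cells as transportation polytopes\<close>

text \<open>Row j holds the barycentric coordinates of a point of the j-th summand, so these
  matrices parametrize the decompositions of the points of a mixed cell.\<close>

definition transport :: "('n \<Rightarrow> 'd::finite set) \<Rightarrow> ('n \<Rightarrow> 'd \<Rightarrow> real) \<Rightarrow> bool" where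
  "transport I m \<longleftrightarrow> (\<forall>j k. 0 \<le> m j k) \<and> (\<forall>j k. k \<notin> I j \<longrightarrow> m j k = 0) \<and> (\<forall>j. (\<Sum>k\<in>UNIV. m j k) = 1)"

definition column_sums :: "('n::finite \<Rightarrow> 'd::finite \<Rightarrow> real) \<Rightarrow> real^'d" where
  "column_sums m = (\<chi> k. \<Sum>j\<in>UNIV. m j k)"

lemma axis_sum_component:
  "(\<Sum>k\<in>K. u k *\<^sub>R axis k (1::real)) $ l = (if l \<in> K then u l else 0)"
  for u :: "'d::finite \<Rightarrow> real"
proof -
  have "(\<Sum>k\<in>K. u k *\<^sub>R axis k (1::real)) $ l = (\<Sum>k\<in>K. if l = k then u k else 0)"
    by (simp only: sum_component, rule sum.cong) (auto simp: axis_def)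
  then show ?thesis by (simp add: sum.delta)
qed

lemma axis_sum: "(\<Sum>k\<in>UNIV. u k *\<^sub>R axis k (1::real)) = (\<chi> k. u k)"
  unfolding Finite_Cartesian_Product.vec_eq_iff axis_sum_component by simp

lemma simplex_face_iff:
  "x \<in> simplex_face K \<longleftrightarrow> (\<forall>k. 0 \<le> x $ k) \<and> (\<forall>k. k \<notin> K \<longrightarrow> x $ k = 0) \<and> (\<Sum>k\<in>UNIV. x $ k) = 1"
proof
  assume "x \<in> simplex_face K"
  then obtain u where u: "x = (\<Sum>k\<in>K. u k *\<^sub>R axis k (1::real))" "\<forall>k\<in>K. 0 \<le> u k" "sum u K = 1"
    unfolding simplex_face_def convex_hull_image[OF finite] by blast
  have "(\<Sum>k\<in>UNIV. x $ k) = sum u K" unfolding u(1) axis_sum_component by (simp add: sum.If_cases)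
  then show "(\<forall>k. 0 \<le> x $ k) \<and> (\<forall>k. k \<notin> K \<longrightarrow> x $ k = 0) \<and> (\<Sum>k\<in>UNIV. x $ k) = 1"
    using u(2,3) unfolding u(1) axis_sum_component by simp
next
  assume x: "(\<forall>k. 0 \<le> x $ k) \<and> (\<forall>k. k \<notin> K \<longrightarrow> x $ k = 0) \<and> (\<Sum>k\<in>UNIV. x $ k) = 1"
  have "x = (\<Sum>k\<in>K. (x $ k) *\<^sub>R axis k (1::real))"
    unfolding Finite_Cartesian_Product.vec_eq_iff axis_sum_component using x by auto
  moreover have "(\<Sum>k\<in>K. x $ k) = (\<Sum>k\<in>UNIV. x $ k)"
    by (rule sum.mono_neutral_left) (use x in auto)
  then have "(\<Sum>k\<in>K. x $ k) = 1" using x by simp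
  ultimately show "x \<in> simplex_face K"
    unfolding simplex_face_def convex_hull_image[OF finite] using x
    by (intro CollectI exI[of _ "vec_nth x"]) simp
qed

lemma mixed_cell_iff: "x \<in> mixed_cell I \<longleftrightarrow> (\<exists>m. transport I m \<and> x = column_sums m)"
proof
  assume "x \<in> mixed_cell I"
  then obtain s where s: "x = sum s UNIV" "\<forall>j. s j \<in> simplex_face (I j)"
    unfolding mixed_cell_def set_sum_alt[OF finite] by blast
  have "transport I (\<lambda>j k. s j $ k)" using s(2) unfolding transport_def simplex_face_iff by blast
  moreover have "x = column_sums (\<lambda>j k. s j $ k)"
    unfolding s(1) column_sums_def by (simp add: Finite_Cartesian_Product.vec_eq_iff)
  ultimately show "\<exists>m. transport I m \<and> x = column_sums m" by blast
next
  assume "\<exists>m. transport I m \<and> x = column_sums m"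
  then obtain m where m: "transport I m" "x = column_sums m" by blast
  have "x = (\<Sum>j\<in>UNIV. \<chi> k. m j k)" unfolding m(2) column_sums_def by (simp add: Finite_Cartesian_Product.vec_eq_iff)
  moreover have "\<forall>j\<in>UNIV. (\<chi> k. m j k) \<in> simplex_face (I j)"
    using m(1) unfolding transport_def simplex_face_iff by simp
  ultimately show "x \<in> mixed_cell I"
    unfolding mixed_cell_def set_sum_alt[OF finite]
    by (intro CollectI exI[of _ "\<lambda>j. \<chi> k. m j k"] conjI)
qed

lemma transport_ex: "(\<And>j. I j \<noteq> {}) \<Longrightarrow> \<exists>m. transport (I :: 'n \<Rightarrow> 'd::finite set) m"
proof -
  assume ne: "\<And>j. I j \<noteq> {}"
  define c where "c j = (SOME k. k \<in> I j)" for j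
  have c: "c j \<in> I j" for j unfolding c_def using ne by (simp add: some_in_eq)
  have "transport I (\<lambda>j k. if k = c j then 1 else 0)"
    unfolding transport_def using c by auto
  then show ?thesis by blast
qed

text \<open>Weak duality and complementary slackness: the two values differ by the sum of the
  nonnegative terms \<open>m j k * (w j k + z k - y j)\<close>, which all vanish exactly when m
  lives on the tight entries.\<close>

lemma transport_value:
  fixes w :: "'n::finite \<Rightarrow> 'd::finite \<Rightarrow> real"
  assumes m: "transport I m" and y: "\<And>j k. y j \<le> w j k + z k"
  shows "(\<Sum>j\<in>UNIV. y j) \<le> (\<Sum>j\<in>UNIV. \<Sum>k\<in>UNIV. m j k * (w j k + z k))"
    and "(\<Sum>j\<in>UNIV. \<Sum>k\<in>UNIV. m j k * (w j k + z k)) = (\<Sum>j\<in>UNIV. y j) \<longleftrightarrow>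
         transport (\<lambda>j. {k. w j k + z k = y j}) m"
proof -
  let ?s = "\<Sum>j\<in>UNIV. \<Sum>k\<in>UNIV. m j k * (w j k + z k - y j)"
  have m0: "0 \<le> m j k" and m1: "(\<Sum>k\<in>UNIV. m j k) = 1" for j k using m by (auto simp: transport_def)
  have eq: "(\<Sum>j\<in>UNIV. \<Sum>k\<in>UNIV. m j k * (w j k + z k)) = (\<Sum>j\<in>UNIV. y j) + ?s"
    by (simp add: right_diff_distrib sum_subtractf m1 flip: sum_distrib_right)
  have pos: "0 \<le> m j k * (w j k + z k - y j)" for j k using m0 y by simp
  then have "0 \<le> ?s" by (simp add: sum_nonneg)
  then show "(\<Sum>j\<in>UNIV. y j) \<le> (\<Sum>j\<in>UNIV. \<Sum>k\<in>UNIV. m j k * (w j k + z k))" unfolding eq by simp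
  have "?s = 0 \<longleftrightarrow> (\<forall>j. (\<Sum>k\<in>UNIV. m j k * (w j k + z k - y j)) = 0)"
    using pos by (subst sum_nonneg_eq_0_iff) (auto simp: sum_nonneg)
  also have "\<dots> \<longleftrightarrow> (\<forall>j k. m j k * (w j k + z k - y j) = 0)"
    using pos by (subst sum_nonneg_eq_0_iff) auto
  also have "\<dots> \<longleftrightarrow> transport (\<lambda>j. {k. w j k + z k = y j}) m"
    unfolding transport_def using m0 m1 by auto
  finally show "(\<Sum>j\<in>UNIV. \<Sum>k\<in>UNIV. m j k * (w j k + z k)) = (\<Sum>j\<in>UNIV. y j) \<longleftrightarrow>
         transport (\<lambda>j. {k. w j k + z k = y j}) m" unfolding eq by simp
qed

lemma polytope_set_sum: "finite A \<Longrightarrow> (\<And>j. j \<in> A \<Longrightarrow> polytope (S j)) \<Longrightarrow> polytope (sum S A)"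
  for S :: "'j \<Rightarrow> 'v::euclidean_space set"
proof (induction A rule: finite_induct)
  case empty
  then show ?case using polytope_sing[of 0] by (simp add: set_zero)
next
  case (insert j A)
  obtain U V where "finite U" "S j = convex hull U" "finite V" "sum S A = convex hull V"
    using insert unfolding polytope_def by blast
  then have "S j + sum S A = convex hull (U + V)" "finite (U + V)"
    by (simp_all add: convex_hull_set_plus finite_set_plus)
  then show ?case using insert(1,2) by (simp add: polytope_convex_hull)
qed

text \<open>The Minkowski counterpart of \<open>lifted_product\<close>; its lower faces project to
  the mixed cells themselves and so produce the polyhedral complex in the dilated simplex.\<close>

definition lifted_sum :: "('n::finite \<Rightarrow> 'd::finite \<Rightarrow> real) \<Rightarrow> ((real^'d) \<times> real) set" where
  "lifted_sum w = (\<Sum>j\<in>UNIV. convex hull range (\<lambda>k. (axis k 1, w j k)))"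

lemma polytope_lifted_sum: "polytope (lifted_sum w)"
  unfolding lifted_sum_def by (intro polytope_set_sum polytope_convex_hull) auto

lemma lifted_sum_iff:
  "p \<in> lifted_sum w \<longleftrightarrow>
    (\<exists>m. transport (\<lambda>_. UNIV) m \<and> p = (column_sums m, \<Sum>j\<in>UNIV. \<Sum>k\<in>UNIV. m j k * w j k))"
proof -
  have hull: "q \<in> convex hull range (\<lambda>k. (axis k 1, w j k)) \<longleftrightarrow>
      (\<exists>u. (\<forall>k. 0 \<le> u k) \<and> sum u UNIV = 1 \<and> q = ((\<chi> k. u k), \<Sum>k\<in>UNIV. u k * w j k))" for q j
  proof -
    have "(\<Sum>k\<in>UNIV. u k *\<^sub>R (axis k 1, w j k)) = ((\<chi> k. u k), \<Sum>k\<in>UNIV. u k * w j k)" for u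
      by (simp add: prod_eq_iff fst_sum snd_sum axis_sum)
    then show ?thesis unfolding convex_hull_image[OF finite] by auto
  qed
  show ?thesis
  proof
    assume "p \<in> lifted_sum w"
    then obtain s where s: "p = sum s UNIV" "\<forall>j. s j \<in> convex hull range (\<lambda>k. (axis k 1, w j k))"
      unfolding lifted_sum_def set_sum_alt[OF finite] by blast
    obtain m where m: "\<forall>j. (\<forall>k. 0 \<le> m j k) \<and> sum (m j) UNIV = 1 \<and> s j = ((\<chi> k. m j k), \<Sum>k\<in>UNIV. m j k * w j k)"
      using s(2) unfolding hull by metis
    have "transport (\<lambda>_. UNIV) m" using m unfolding transport_def by simp
    moreover have "p = (column_sums m, \<Sum>j\<in>UNIV. \<Sum>k\<in>UNIV. m j k * w j k)"
      unfolding s(1) using m by (simp add: prod_eq_iff fst_sum snd_sum column_sums_def Finite_Cartesian_Product.vec_eq_iff)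
    ultimately show "\<exists>m. transport (\<lambda>_. UNIV) m \<and> p = (column_sums m, \<Sum>j\<in>UNIV. \<Sum>k\<in>UNIV. m j k * w j k)"
      by blast
  next
    assume "\<exists>m. transport (\<lambda>_. UNIV) m \<and> p = (column_sums m, \<Sum>j\<in>UNIV. \<Sum>k\<in>UNIV. m j k * w j k)"
    then obtain m where m: "transport (\<lambda>_. UNIV) m" "p = (column_sums m, \<Sum>j\<in>UNIV. \<Sum>k\<in>UNIV. m j k * w j k)"
      by blast
    let ?s = "\<lambda>j. ((\<chi> k. m j k), \<Sum>k\<in>UNIV. m j k * w j k)"
    have "p = sum ?s UNIV"
      unfolding m(2) by (simp add: prod_eq_iff fst_sum snd_sum column_sums_def Finite_Cartesian_Product.vec_eq_iff)
    moreover have "\<forall>j\<in>UNIV. ?s j \<in> convex hull range (\<lambda>k. (axis k 1, w j k))"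
      using m(1) unfolding hull transport_def by blast
    ultimately show "p \<in> lifted_sum w"
      unfolding lifted_sum_def set_sum_alt[OF finite] by (intro CollectI exI[of _ ?s] conjI)
  qed
qed

lemma inner_column_sums: "u \<bullet> column_sums m = (\<Sum>j\<in>UNIV. \<Sum>k\<in>UNIV. m j k * u $ k)"
proof -
  have "u \<bullet> column_sums m = (\<Sum>k\<in>UNIV. \<Sum>j\<in>UNIV. m j k * u $ k)"
    unfolding column_sums_def inner_vec_def by (simp add: sum_distrib_left mult.commute)
  then show ?thesis by (subst sum.swap)
qed

lemma lifted_sum_face:
  assumes y: "\<And>j k. y j \<le> w j k + u $ k" and ex: "\<And>j. \<exists>k. w j k + u $ k = y j"
  shows "p \<in> lifted_sum w \<Longrightarrow> sum y UNIV \<le> u \<bullet> fst p + snd p"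
    and "fst ` {p \<in> lifted_sum w. u \<bullet> fst p + snd p = sum y UNIV} = mixed_cell (min_type w (($) u))"
proof -
  have val: "u \<bullet> fst p + snd p = (\<Sum>j\<in>UNIV. \<Sum>k\<in>UNIV. m j k * (w j k + u $ k))"
    if "p = (column_sums m, \<Sum>j\<in>UNIV. \<Sum>k\<in>UNIV. m j k * w j k)" for p m
    unfolding that fst_conv snd_conv inner_column_sums by (simp add: distrib_left sum.distrib)
  have I: "min_type w (($) u) = (\<lambda>j. {k. w j k + u $ k = y j})"
    using min_type_eqI[of y w "($) u", OF y ex] by (rule ext)
  show "sum y UNIV \<le> u \<bullet> fst p + snd p" if p: "p \<in> lifted_sum w" for p
  proof -
    obtain m where m: "transport (\<lambda>_. UNIV) m" "p = (column_sums m, \<Sum>j\<in>UNIV. \<Sum>k\<in>UNIV. m j k * w j k)"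
      using p unfolding lifted_sum_iff by blast
    show ?thesis unfolding val[OF m(2)] by (rule transport_value(1)[where w = w and z = "($) u", OF m(1) y])
  qed
  show "fst ` {p \<in> lifted_sum w. u \<bullet> fst p + snd p = sum y UNIV} = mixed_cell (min_type w (($) u))"
  proof (intro equalityI subsetI)
    fix x assume "x \<in> fst ` {p \<in> lifted_sum w. u \<bullet> fst p + snd p = sum y UNIV}"
    then obtain p where p: "p \<in> lifted_sum w" "u \<bullet> fst p + snd p = sum y UNIV" "x = fst p" by blast
    obtain m where m: "transport (\<lambda>_. UNIV) m" "p = (column_sums m, \<Sum>j\<in>UNIV. \<Sum>k\<in>UNIV. m j k * w j k)"
      using p(1) unfolding lifted_sum_iff by blast
    have "transport (min_type w (($) u)) m"
      using p(2) unfolding val[OF m(2)] I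
      by (rule transport_value(2)[where w = w and z = "($) u", OF m(1) y, THEN iffD1])
    then show "x \<in> mixed_cell (min_type w (($) u))"
      unfolding mixed_cell_iff p(3) m(2) by auto
  next
    fix x assume "x \<in> mixed_cell (min_type w (($) u))"
    then obtain m where m: "transport (min_type w (($) u)) m" "x = column_sums m"
      unfolding mixed_cell_iff by blast
    let ?p = "(column_sums m, \<Sum>j\<in>UNIV. \<Sum>k\<in>UNIV. m j k * w j k)"
    have m': "transport (\<lambda>_. UNIV) m" using m(1) unfolding transport_def by blast
    have "?p \<in> lifted_sum w" unfolding lifted_sum_iff using m' by blast
    moreover have "u \<bullet> fst ?p + snd ?p = sum y UNIV"
      unfolding val[OF refl] using m(1) unfolding I
      by (rule transport_value(2)[where w = w and z = "($) u", OF m' y, THEN iffD2])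
    ultimately show "x \<in> fst ` {p \<in> lifted_sum w. u \<bullet> fst p + snd p = sum y UNIV}"
      unfolding m(2) by (intro image_eqI[of _ _ ?p]) auto
  qed
qed

text \<open>For every direction u the minimum over the lifted sum is the sum of the row minima, so a
  supporting level c has no freedom left and the face is the one described by
  \<open>lifted_sum_face\<close>.\<close>

lemma lower_faces_lifted_sum:
  "{fst ` F | F. lower_face F (lifted_sum w)} = mixed_complex (range (min_type w))"
proof (intro equalityI subsetI)
  fix C assume "C \<in> {fst ` F | F. lower_face F (lifted_sum w)}"
  then obtain F u c where F: "C = fst ` F" "F \<noteq> {}" "\<And>p. p \<in> lifted_sum w \<Longrightarrow> c \<le> u \<bullet> fst p + snd p"
    "F = {p\<in>lifted_sum w. u \<bullet> fst p + snd p = c}" unfolding lower_face_def by blast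
  obtain y where y: "\<And>j k. y j \<le> w j k + u $ k" "\<And>j. \<exists>k. w j k + u $ k = y j"
    using min_type_ex[of w "($) u"] by blast
  note face = lifted_sum_face[where y = y and w = w and u = u, OF y]
  obtain p where p: "p \<in> lifted_sum w" "u \<bullet> fst p + snd p = c" using F(2,4) by blast
  have "\<exists>m. transport (min_type w (($) u)) m" by (rule transport_ex) (rule min_type_nonempty)
  then have "mixed_cell (min_type w (($) u)) \<noteq> {}" using mixed_cell_iff by blast
  then obtain q where q: "q \<in> lifted_sum w" "u \<bullet> fst q + snd q = sum y UNIV" unfolding face(2)[symmetric] by blast
  have "c = sum y UNIV" using F(3)[OF q(1)] face(1)[OF p(1)] p(2) q(2) by linarith
  then have "C = mixed_cell (min_type w (($) u))" using F(1,4) face(2) by simp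
  then show "C \<in> mixed_complex (range (min_type w))" unfolding mixed_complex_def by blast
next
  fix C assume "C \<in> mixed_complex (range (min_type w))"
  then obtain z where C: "C = mixed_cell (min_type w z)" unfolding mixed_complex_def by blast
  define u where "u = (\<chi> k. z k)"
  have zu: "($) u = z" by (simp add: u_def fun_eq_iff)
  obtain y where y: "\<And>j k. y j \<le> w j k + u $ k" "\<And>j. \<exists>k. w j k + u $ k = y j"
    using min_type_ex[of w "($) u"] by blast
  note face = lifted_sum_face[where y = y and w = w and u = u, OF y]
  let ?F = "{p \<in> lifted_sum w. u \<bullet> fst p + snd p = sum y UNIV}"
  have CF: "C = fst ` ?F" unfolding C face(2) zu ..
  have "\<exists>m. transport (min_type w z) m" by (rule transport_ex) (rule min_type_nonempty)
  then have "C \<noteq> {}" unfolding C using mixed_cell_iff by blast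
  then have "?F \<noteq> {}" unfolding CF by blast
  then have "lower_face ?F (lifted_sum w)" unfolding lower_face_def using face(1) by blast
  then show "C \<in> {fst ` F | F. lower_face F (lifted_sum w)}" using CF by blast
qed

lemma fst_lifted_sum: "fst ` lifted_sum (w :: 'n::finite \<Rightarrow> 'd::finite \<Rightarrow> real) = dilated_simplex CARD('n)"
proof (intro equalityI subsetI)
  fix x assume "x \<in> fst ` lifted_sum w"
  then obtain p where p: "p \<in> lifted_sum w" "x = fst p" by blast
  obtain m where "transport (\<lambda>_. UNIV) m" "p = (column_sums m, \<Sum>j\<in>UNIV. \<Sum>k\<in>UNIV. m j k * w j k)"
    using p(1) unfolding lifted_sum_iff by blast
  then have m: "transport (\<lambda>_. UNIV) m" "x = column_sums m" using p(2) by simp_all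
  let ?s = "x /\<^sub>R real CARD('n)"
  have n0: "real CARD('n) > 0" by simp
  have nn: "x $ k \<ge> 0" for k using m by (auto simp: column_sums_def transport_def intro!: sum_nonneg)
  have "(\<Sum>k\<in>UNIV. x $ k) = (\<Sum>j\<in>(UNIV::'n set). \<Sum>k\<in>UNIV. m j k)"
    unfolding m(2) column_sums_def by (simp add: sum.swap[of _ "UNIV::'n set"])
  also have "\<dots> = real CARD('n)" using m(1) by (simp add: transport_def)
  finally have "?s \<in> simplex_face UNIV"
    unfolding simplex_face_iff using nn n0 by (simp flip: sum_distrib_left)
  moreover have "x = real CARD('n) *\<^sub>R ?s" using n0 by simp
  ultimately show "x \<in> dilated_simplex CARD('n)" unfolding dilated_simplex_def by (rule image_eqI[rotated])
next
  fix x :: "real^'d" assume "x \<in> dilated_simplex CARD('n)"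
  then obtain s :: "real^'d" where s: "s \<in> simplex_face UNIV" "x = real CARD('n) *\<^sub>R s"
    unfolding dilated_simplex_def by blast
  have "transport (\<lambda>_::'n. UNIV) (\<lambda>j k. s $ k)" using s(1) unfolding simplex_face_iff transport_def by simp
  moreover have "x = column_sums (\<lambda>(j::'n) k. s $ k)"
    unfolding s(2) column_sums_def by (simp add: Finite_Cartesian_Product.vec_eq_iff)
  ultimately have "(x, \<Sum>(j::'n)\<in>UNIV. \<Sum>k\<in>UNIV. s $ k * w j k) \<in> lifted_sum w"
    unfolding lifted_sum_iff by blast
  then show "x \<in> fst ` lifted_sum w" by (rule image_eqI[rotated]) simp
qed

lemma mixed_subdivision_min_type: "mixed_subdivision (range (min_type w))"
proof -
  have "polyhedral_subdivision (mixed_complex (range (min_type w))) (dilated_simplex CARD('a))"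
    using lower_faces_polyhedral_subdivision[OF polytope_lifted_sum[of w]]
    unfolding lower_faces_lifted_sum fst_lifted_sum .
  moreover have "product_subdivision {fst ` F | F. lower_face F (lifted_product w)}"
    using regular_product_subdivision_lower_faces unfolding regular_product_subdivision_def by blast
  moreover have "cayley_corresponds (range (min_type w)) {fst ` F | F. lower_face F (lifted_product w)}"
    unfolding cayley_corresponds_lower_faces ..
  ultimately show ?thesis unfolding mixed_subdivision_def by blast
qed

lemma regular_mixed_subdivision_ex:
  assumes "regular_mixed_subdivision \<Sigma>"
  shows "\<exists>w. \<Sigma> = range (min_type w)"
  using assms cayley_corresponds_lower_faces
  unfolding regular_mixed_subdivision_def regular_product_subdivision_def by blast

section \<open>Generic weights\<close>

text \<open>Acyclicity of the bipartite graph with edges (j, k) for k in \<open>I j\<close>, encoded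
  linearly: the vectors e_j + e_k of its edges are independent exactly when there is no cycle. Both
  uses, killing balanced matrices and finding potentials, become linear algebra.\<close>

definition forest :: "('n::finite \<Rightarrow> 'd::finite set) \<Rightarrow> bool" where
  "forest I \<longleftrightarrow> independent {product_vertex j k | j k. k \<in> I j}"

lemma product_vertex_inject [simp]: "product_vertex j k = product_vertex j' k' \<longleftrightarrow> j = j' \<and> k = k'"
  by (simp add: product_vertex_def axis_eq_axis)

lemma forest_mono: "forest I \<Longrightarrow> (\<And>j. J j \<subseteq> I j) \<Longrightarrow> forest J"
  unfolding forest_def by (rule independent_mono) auto

lemma sum_product_vertex:
  "(\<Sum>j\<in>UNIV. \<Sum>k\<in>UNIV. c j k *\<^sub>R product_vertex j k) = ((\<chi> j. \<Sum>k\<in>UNIV. c j k), (\<chi> k. \<Sum>j\<in>UNIV. c j k))"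
proof -
  have "(\<Sum>j\<in>UNIV. \<Sum>k\<in>UNIV. c j k *\<^sub>R axis j (1::real)) = (\<chi> j. \<Sum>k\<in>UNIV. c j k)"
    unfolding scaleR_sum_left[symmetric] axis_sum ..
  moreover have "(\<Sum>j\<in>UNIV. \<Sum>k\<in>UNIV. c j k *\<^sub>R axis k (1::real)) = (\<chi> k. \<Sum>j\<in>UNIV. c j k)"
    by (subst sum.swap) (unfold scaleR_sum_left[symmetric] axis_sum, rule refl)
  ultimately show ?thesis by (simp add: prod_eq_iff fst_sum snd_sum product_vertex_def)
qed

lemma sum_edges:
  fixes h :: "'n::finite \<Rightarrow> 'd::finite \<Rightarrow> 'v::comm_monoid_add"
  assumes "\<And>j k. k \<notin> I j \<Longrightarrow> h j k = 0"
  shows "(\<Sum>j\<in>UNIV. \<Sum>k\<in>UNIV. h j k) = (\<Sum>i\<in>Sigma UNIV I. h (fst i) (snd i))"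
proof -
  have "(\<Sum>j\<in>UNIV. \<Sum>k\<in>UNIV. h j k) = (\<Sum>j\<in>UNIV. \<Sum>k\<in>I j. h j k)"
    by (intro sum.cong refl sum.mono_neutral_right) (use assms in auto)
  also have "\<dots> = (\<Sum>i\<in>Sigma UNIV I. h (fst i) (snd i))" by (simp add: sum.Sigma case_prod_unfold)
  finally show ?thesis .
qed

lemma edges_image: "{product_vertex j k | j k. k \<in> I j} = (\<lambda>i. product_vertex (fst i) (snd i)) ` Sigma UNIV I"
proof (intro equalityI subsetI)
  fix x assume "x \<in> {product_vertex j k | j k. k \<in> I j}"
  then obtain j k where "x = product_vertex j k" "k \<in> I j" by blast
  then show "x \<in> (\<lambda>i. product_vertex (fst i) (snd i)) ` Sigma UNIV I"
    by (intro image_eqI[of _ _ "(j, k)"]) auto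
qed auto

text \<open>A linear relation among edge vectors is a matrix supported on the edges whose row sums
  and column sums vanish, these being the two components of the combination.\<close>

lemma forest_iff:
  "forest I \<longleftrightarrow> (\<forall>c. (\<forall>j k. k \<notin> I j \<longrightarrow> c j k = 0) \<and> (\<forall>j. (\<Sum>k\<in>UNIV. c j k) = (0::real)) \<and>
     (\<forall>k. (\<Sum>j\<in>UNIV. c j k) = 0) \<longrightarrow> (\<forall>j k. c j k = 0))"
proof -
  let ?f = "\<lambda>i. product_vertex (fst i) (snd i)"
  have inj: "inj_on ?f (Sigma UNIV I)" by (auto simp: inj_on_def)
  have ind: "forest I \<longleftrightarrow> (\<forall>u. (\<Sum>i\<in>Sigma UNIV I. u (?f i) *\<^sub>R ?f i) = 0 \<longrightarrow> (\<forall>i\<in>Sigma UNIV I. u (?f i) = 0))"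
    unfolding forest_def edges_image independent_explicit by (simp add: sum.reindex[OF inj])
  show ?thesis
  proof (intro iffI allI impI)
    fix c j k
    assume I: "forest I" and c: "(\<forall>j k. k \<notin> I j \<longrightarrow> c j k = 0) \<and> (\<forall>j. (\<Sum>k\<in>UNIV. c j k) = (0::real)) \<and>
     (\<forall>k. (\<Sum>j\<in>UNIV. c j k) = 0)"
    define u where "u v = c (fst (the_inv ?f v)) (snd (the_inv ?f v))" for v
    have inj': "inj ?f" by (auto simp: inj_on_def)
    have u: "u (?f i) = c (fst i) (snd i)" for i unfolding u_def the_inv_f_f[OF inj'] ..
    have "(\<Sum>i\<in>Sigma UNIV I. u (?f i) *\<^sub>R ?f i) = (\<Sum>j\<in>UNIV. \<Sum>k\<in>UNIV. c j k *\<^sub>R product_vertex j k)"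
      unfolding u by (rule sum_edges[symmetric]) (use c in auto)
    also have "\<dots> = 0" unfolding sum_product_vertex using c by (simp add: zero_prod_def Finite_Cartesian_Product.vec_eq_iff)
    finally have "\<forall>i\<in>Sigma UNIV I. c (fst i) (snd i) = 0" using I[unfolded ind, rule_format, of u] unfolding u by blast
    then show "c j k = 0" using c by (cases "k \<in> I j") auto
  next
    assume R: "\<forall>c. (\<forall>j k. k \<notin> I j \<longrightarrow> c j k = 0) \<and> (\<forall>j. (\<Sum>k\<in>UNIV. c j k) = (0::real)) \<and>
     (\<forall>k. (\<Sum>j\<in>UNIV. c j k) = 0) \<longrightarrow> (\<forall>j k. c j k = 0)"
    show "forest I" unfolding ind
    proof (intro allI impI)
      fix u assume u: "(\<Sum>i\<in>Sigma UNIV I. u (?f i) *\<^sub>R ?f i) = 0"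
      define c where "c j k = (if k \<in> I j then u (product_vertex j k) else 0)" for j k
      have "(\<Sum>j\<in>UNIV. \<Sum>k\<in>UNIV. c j k *\<^sub>R product_vertex j k)
          = (\<Sum>i\<in>Sigma UNIV I. c (fst i) (snd i) *\<^sub>R ?f i)"
        by (rule sum_edges) (auto simp: c_def)
      also have "\<dots> = (\<Sum>i\<in>Sigma UNIV I. u (?f i) *\<^sub>R ?f i)"
        by (rule sum.cong) (auto simp: c_def)
      finally have "(\<Sum>j\<in>UNIV. \<Sum>k\<in>UNIV. c j k *\<^sub>R product_vertex j k) = 0" using u by simp
      then have "(\<forall>j. (\<Sum>k\<in>UNIV. c j k) = 0) \<and> (\<forall>k. (\<Sum>j\<in>UNIV. c j k) = 0)"
        unfolding sum_product_vertex by (simp add: zero_prod_def Finite_Cartesian_Product.vec_eq_iff)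
      moreover have "\<forall>j k. k \<notin> I j \<longrightarrow> c j k = 0" by (simp add: c_def)
      ultimately have c0: "c j k = 0" for j k using R[rule_format, of c] by blast
      show "\<forall>i\<in>Sigma UNIV I. u (?f i) = 0"
      proof
        fix i assume "i \<in> Sigma UNIV I"
        then show "u (?f i) = 0" using c0[of "fst i" "snd i"] by (auto simp: c_def)
      qed
    qed
  qed
qed

lemma forest_zero:
  assumes "forest I" "\<And>j k. k \<notin> I j \<Longrightarrow> c j k = 0" "\<And>j. (\<Sum>k\<in>UNIV. c j k) = (0::real)"
    "\<And>k. (\<Sum>j\<in>UNIV. c j k) = 0"
  shows "c j k = 0"
  using assms unfolding forest_iff by blast

text \<open>The dual form of independence: a linear functional can be prescribed on the edge
  vectors, and its values at the basis vectors of the two factors are the potentials.\<close>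

lemma forest_potential:
  assumes "forest I"
  shows "\<exists>(a::'n::finite \<Rightarrow> real) b. \<forall>j (k::'d::finite). k \<in> I j \<longrightarrow> a j + b k = g j k"
proof -
  let ?f = "\<lambda>i. product_vertex (fst i) (snd i)" and ?S = "{product_vertex j k | j k. k \<in> I j}"
  have inj: "inj ?f" by (auto simp: inj_on_def)
  obtain G :: "(real^'n) \<times> (real^'d) \<Rightarrow> real" where G: "linear G"
    "\<forall>x\<in>?S. G x = g (fst (the_inv ?f x)) (snd (the_inv ?f x))"
    using real_vector.linear_independent_extend[OF assms[unfolded forest_def],
        of "\<lambda>x. g (fst (the_inv ?f x)) (snd (the_inv ?f x))"] by auto
  have "G (axis j 1, 0) + G (0, axis k 1) = g j k" if k: "k \<in> I j" for j k
  proof -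
    have "(axis j 1, 0) + (0, axis k 1) = ?f (j, k)" by (simp add: product_vertex_def)
    then have "G (axis j 1, 0) + G (0, axis k 1) = G (?f (j, k))"
      using linear_add[OF G(1)] by metis
    moreover have pS: "?f (j, k) \<in> ?S" using k by auto
    have "G (?f (j, k)) = g j k" unfolding bspec[OF G(2) pS] the_inv_f_f[OF inj] by simp
    ultimately show ?thesis by simp
  qed
  then show ?thesis by (intro exI[of _ "\<lambda>j. G (axis j 1, 0)"] exI[of _ "\<lambda>k. G (0, axis k 1)"]) blast
qed

lemma convex_cone_sum:
  assumes "convex_cone C" "finite A" "\<And>i. i \<in> A \<Longrightarrow> f i \<in> C"
  shows "sum f A \<in> C"
  using assms(2,3) by (induction A rule: finite_induct)
    (auto intro: convex_cone_contains_0[OF assms(1)] convex_cone_add[OF assms(1)])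

section \<open>Weights admitting a given cell, and their perturbation\<close>

definition tight_weights :: "('n::finite \<Rightarrow> 'd::finite set) \<Rightarrow> ((real^'d)^'n) set" where
  "tight_weights I = {W. \<exists>y z. \<forall>j k. y j \<le> W $ j $ k + z k \<and> (k \<in> I j \<longrightarrow> W $ j $ k + z k = y j)}"

text \<open>The set is a projection along y and z, so closedness is not immediate; it follows
  because finitely generated cones are closed. The generators are one unit of slack at each non-edge
  and the two-sided shifts of whole rows and whole columns.\<close>

lemma closed_tight_weights: "closed (tight_weights (I :: 'n::finite \<Rightarrow> 'd::finite set))"
proof -
  define E :: "'n \<Rightarrow> 'd \<Rightarrow> (real^'d)^'n" where "E j k = (\<chi> j'. \<chi> k'. if j' = j \<and> k' = k then 1 else 0)" for j k
  define R :: "'n \<Rightarrow> (real^'d)^'n" where "R j = (\<chi> j'. \<chi> k'. if j' = j then 1 else 0)" for j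
  define K :: "'d \<Rightarrow> (real^'d)^'n" where "K k = (\<chi> j'. \<chi> k'. if k' = k then 1 else 0)" for k
  define S where "S = {E j k | j k. k \<notin> I j} \<union> range R \<union> range (\<lambda>j. - R j) \<union> range K \<union> range (\<lambda>k. - K k)"
  have fin: "finite S"
  proof -
    have "{E j k | j k. k \<notin> I j} \<subseteq> (\<lambda>(j, k). E j k) ` UNIV" by auto
    then have "finite {E j k | j k. k \<notin> I j}" by (rule finite_subset) simp
    then show ?thesis unfolding S_def by simp
  qed
  have cone: "convex_cone (tight_weights I)"
    unfolding convex_cone_iff
  proof (intro conjI allI impI ballI)
    show "0 \<in> tight_weights I" unfolding tight_weights_def
      by (intro CollectI exI[of _ "\<lambda>_. 0"]) simp
  next
    fix U V assume "U \<in> tight_weights I" "V \<in> tight_weights I"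
    then obtain y z y' z' where
      "\<forall>j k. y j \<le> U $ j $ k + z k \<and> (k \<in> I j \<longrightarrow> U $ j $ k + z k = y j)"
      "\<forall>j k. y' j \<le> V $ j $ k + z' k \<and> (k \<in> I j \<longrightarrow> V $ j $ k + z' k = y' j)"
      unfolding tight_weights_def by blast
    then show "U + V \<in> tight_weights I" unfolding tight_weights_def
      by (intro CollectI exI[of _ "\<lambda>j. y j + y' j"] exI[of _ "\<lambda>k. z k + z' k"])
        (smt (verit, best) vector_add_component)
  next
    fix V c assume "V \<in> tight_weights I" and c: "(0::real) \<le> c"
    then obtain y z where V: "\<And>j k. y j \<le> V $ j $ k + z k" "\<And>j k. k \<in> I j \<Longrightarrow> V $ j $ k + z k = y j"
      unfolding tight_weights_def by blast
    have "c * y j \<le> c * V $ j $ k + c * z k" for j k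
      using mult_left_mono[OF V(1) c] by (simp add: distrib_left)
    moreover have "c * V $ j $ k + c * z k = c * y j" if "k \<in> I j" for j k
      using V(2)[OF that] by (simp flip: distrib_left)
    ultimately show "c *\<^sub>R V \<in> tight_weights I" unfolding tight_weights_def
      by (intro CollectI exI[of _ "\<lambda>j. c * y j"] exI[of _ "\<lambda>k. c * z k"]) simp
  qed
  have "S \<subseteq> tight_weights I"
  proof -
    have "E j k \<in> tight_weights I" if "k \<notin> I j" for j k
      unfolding tight_weights_def E_def using that by (intro CollectI exI[of _ "\<lambda>_. 0"]) auto
    moreover have "s *\<^sub>R R j \<in> tight_weights I" for s j
      unfolding tight_weights_def R_def
      by (intro CollectI exI[of _ "\<lambda>i. if i = j then s else 0"] exI[of _ "\<lambda>_. 0"]) auto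
    then have "R j \<in> tight_weights I" "- R j \<in> tight_weights I" for j
      by (metis scaleR_one, metis scaleR_minus1_left)
    moreover have "s *\<^sub>R K k \<in> tight_weights I" for s k
      unfolding tight_weights_def K_def
      by (intro CollectI exI[of _ "\<lambda>i. if i = k then - s else 0"] exI[of _ "\<lambda>_. 0"]) auto
    then have "K k \<in> tight_weights I" "- K k \<in> tight_weights I" for k
      by (metis scaleR_one, metis scaleR_minus1_left)
    ultimately show ?thesis unfolding S_def by blast
  qed
  then have "convex_cone hull S \<subseteq> tight_weights I" using cone by (rule hull_minimal)
  moreover have "tight_weights I \<subseteq> convex_cone hull S"
  proof
    fix W assume "W \<in> tight_weights I"
    then obtain y z where W: "\<And>j k. y j \<le> W $ j $ k + z k" "\<And>j k. k \<in> I j \<Longrightarrow> W $ j $ k + z k = y j"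
      unfolding tight_weights_def by blast
    note C = convex_cone_convex_cone_hull[of S]
    have inS: "r \<in> S \<Longrightarrow> r \<in> convex_cone hull S" for r by (rule hull_inc)
    have pm: "s *\<^sub>R r \<in> convex_cone hull S" if "r \<in> S" "- r \<in> S" for s r
    proof (cases "s \<ge> 0")
      case True
      then show ?thesis using convex_cone_scaleR[OF C] inS that(1) by blast
    next
      case False
      then have "(- s) *\<^sub>R (- r) \<in> convex_cone hull S"
        using convex_cone_scaleR[OF C, of "- s" "- r"] inS that(2) by simp
      then show ?thesis by simp
    qed
    have 1: "(\<Sum>j\<in>UNIV. \<Sum>k\<in>UNIV. (W $ j $ k + z k - y j) *\<^sub>R E j k) \<in> convex_cone hull S"
    proof (intro convex_cone_sum[OF C] finite)
      fix j k
      show "(W $ j $ k + z k - y j) *\<^sub>R E j k \<in> convex_cone hull S"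
      proof (cases "k \<in> I j")
        case True
        then show ?thesis using W(2) convex_cone_contains_0[OF C] by simp
      next
        case False
        then have "E j k \<in> S" unfolding S_def by blast
        then show ?thesis using convex_cone_scaleR[OF C] inS W(1)[of j k] by simp
      qed
    qed
    have 2: "(\<Sum>j\<in>UNIV. y j *\<^sub>R R j) \<in> convex_cone hull S"
      by (intro convex_cone_sum[OF C] finite pm) (auto simp: S_def)
    have 3: "(\<Sum>k\<in>UNIV. (- z k) *\<^sub>R K k) \<in> convex_cone hull S"
      by (intro convex_cone_sum[OF C] finite pm) (auto simp: S_def)
    \<comment> \<open>Entrywise this is W = (W + z - y) + y - z: slack, row shifts by y, column
      shifts by -z.\<close>
    let ?T = "(\<Sum>j\<in>UNIV. \<Sum>k\<in>UNIV. (W $ j $ k + z k - y j) *\<^sub>R E j k) + (\<Sum>j\<in>UNIV. y j *\<^sub>R R j)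
        + (\<Sum>k\<in>UNIV. (- z k) *\<^sub>R K k)"
    have "W = ?T"
      unfolding Finite_Cartesian_Product.vec_eq_iff
    proof (intro allI)
      fix j k
      have "(\<Sum>j'\<in>UNIV. \<Sum>k'\<in>UNIV. (W $ j' $ k' + z k' - y j') *\<^sub>R E j' k') $ j $ k
          = (\<Sum>j'\<in>UNIV. \<Sum>k'\<in>UNIV. if k = k' then if j = j' then W $ j' $ k' + z k' - y j' else 0 else 0)"
        by (simp only: sum_component, intro sum.cong refl) (auto simp: E_def)
      also have "\<dots> = W $ j $ k + z k - y j" by (simp add: sum.delta)
      finally have 1: "(\<Sum>j'\<in>UNIV. \<Sum>k'\<in>UNIV. (W $ j' $ k' + z k' - y j') *\<^sub>R E j' k') $ j $ k
          = W $ j $ k + z k - y j" .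
      have "(\<Sum>j\<in>UNIV. y j *\<^sub>R R j) $ j $ k = (\<Sum>j'\<in>UNIV. if j = j' then y j' else 0)"
        by (simp only: sum_component, intro sum.cong refl) (auto simp: R_def)
      moreover have "(\<Sum>k\<in>UNIV. (- z k) *\<^sub>R K k) $ j $ k = (\<Sum>k'\<in>UNIV. if k = k' then - z k' else 0)"
        by (simp only: sum_component, intro sum.cong refl) (auto simp: K_def)
      ultimately show "W $ j $ k = ?T $ j $ k" using 1 by simp
    qed
    then show "W \<in> convex_cone hull S" using convex_cone_add[OF C convex_cone_add[OF C 1 2] 3] by simp
  qed
  ultimately have "tight_weights I = convex_cone hull S" by blast
  then show ?thesis using closed_convex_cone_hull[OF fin] by simp
qed

lemma tight_weights_min_type:
  fixes w :: "'n::finite \<Rightarrow> 'd::finite \<Rightarrow> real"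
  assumes "\<And>j. I j \<noteq> {}"
  shows "(\<chi> j. \<chi> k. w j k) \<in> tight_weights I \<longleftrightarrow> (\<exists>z. \<forall>j. I j \<subseteq> min_type w z j)"
proof
  assume "(\<chi> j. \<chi> k. w j k) \<in> tight_weights I"
  then obtain y z where yz: "\<And>j k. y j \<le> w j k + z k" "\<And>j k. k \<in> I j \<Longrightarrow> w j k + z k = y j"
    unfolding tight_weights_def by auto
  have "I j \<subseteq> min_type w z j" for j
    unfolding min_type_def using yz by fastforce
  then show "\<exists>z. \<forall>j. I j \<subseteq> min_type w z j" by blast
next
  assume "\<exists>z. \<forall>j. I j \<subseteq> min_type w z j"
  then obtain z where z: "\<And>j. I j \<subseteq> min_type w z j" by blast
  obtain y where y: "\<forall>j k. y j \<le> w j k + z k" "\<forall>j. min_type w z j = {k. w j k + z k = y j}"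
    using min_type_ex[of w z] by blast
  show "(\<chi> j. \<chi> k. w j k) \<in> tight_weights I"
    unfolding tight_weights_def
  proof (intro CollectI exI[of _ y] exI[of _ z] allI conjI impI)
    fix j k
    show "y j \<le> (\<chi> j. \<chi> k. w j k) $ j $ k + z k" using y(1) by simp
    assume "k \<in> I j"
    then have "k \<in> min_type w z j" using z by blast
    then show "(\<chi> j. \<chi> k. w j k) $ j $ k + z k = y j" using y(2) by simp
  qed
qed

text \<open>The new weights must lie in the open set \<open>U\<close> that avoids
  \<open>tight_weights I\<close> for every tuple not tight for w, which gives refinement, and off
  finitely many hyperplanes, which gives forests. A nonempty open set is not negligible, so both can
  be achieved.\<close>

lemma generic_refinement:
  fixes w :: "'n::finite \<Rightarrow> 'd::finite \<Rightarrow> real"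
  shows "\<exists>w'. (\<forall>z. forest (min_type w' z)) \<and> refines (range (min_type w')) (range (min_type w))"
proof -
  let ?W = "\<chi> j. \<chi> k. w j k"
  define U where "U = (\<Inter>I\<in>{I. ?W \<notin> tight_weights I}. - tight_weights I)"
  have "open U" unfolding U_def by (intro open_INT) (auto simp: closed_tight_weights open_Compl)
  moreover have "?W \<in> U" unfolding U_def by blast
  ultimately have negU: "\<not> negligible U" using open_not_negligible by blast
  have "\<exists>c. (\<forall>j k. k \<notin> I j \<longrightarrow> c j k = 0) \<and> (\<forall>j. (\<Sum>k\<in>UNIV. c j k) = (0::real)) \<and>
     (\<forall>k. (\<Sum>j\<in>UNIV. c j k) = 0) \<and> (\<exists>j k. c j k \<noteq> 0)" if "\<not> forest I" for I :: "'n \<Rightarrow> 'd set"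
    using that unfolding forest_iff by blast
  then obtain c where c: "(\<forall>j k. k \<notin> I j \<longrightarrow> c I j k = 0) \<and> (\<forall>j. (\<Sum>k\<in>UNIV. c I j k) = (0::real)) \<and>
     (\<forall>k. (\<Sum>j\<in>UNIV. c I j k) = 0) \<and> (\<exists>j k. c I j k \<noteq> 0)" if "\<not> forest I" for I :: "'n \<Rightarrow> 'd set"
    by metis
  \<comment> \<open>For a tuple that is no forest, c is a nonzero balanced matrix on its edges. If
    the tuple is a type of some weights, pairing them with c gives the sum of c (y - z), which is 0;
    so all such weights lie on a hyperplane.\<close>
  define N where "N = (\<Union>I\<in>{I. \<not> forest I}. {W :: (real^'d)^'n. (\<chi> j. \<chi> k. c I j k) \<bullet> W = 0})"
  have "negligible N" unfolding N_def
  proof (rule negligible_Union, simp)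
    fix X assume "X \<in> (\<lambda>I. {W. (\<chi> j. \<chi> k. c I j k) \<bullet> W = 0}) ` {I. \<not> forest I}"
    then obtain I where I: "\<not> forest I" "X = {W. (\<chi> j. \<chi> k. c I j k) \<bullet> W = 0}" by blast
    then obtain j k where "c I j k \<noteq> 0" using c by blast
    then have "(\<chi> j. \<chi> k. c I j k) \<noteq> 0" by (auto simp: Finite_Cartesian_Product.vec_eq_iff)
    then show "negligible X" unfolding I(2) by (intro negligible_hyperplane disjI1)
  qed
  then have "\<not> U \<subseteq> N" using negU negligible_subset by blast
  then obtain W where W: "W \<in> U" "W \<notin> N" by blast
  define w' where "w' j k = W $ j $ k" for j k
  have W': "W = (\<chi> j. \<chi> k. w' j k)" by (simp add: w'_def Finite_Cartesian_Product.vec_eq_iff)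
  have "forest (min_type w' z)" for z
  proof (rule ccontr)
    assume nf: "\<not> forest (min_type w' z)"
    let ?c = "c (min_type w' z)"
    obtain y where y: "\<forall>j. min_type w' z j = {k. w' j k + z k = y j}"
      using min_type_ex[of w' z] by blast
    have eq: "?c j k * w' j k = ?c j k * y j - ?c j k * z k" for j k
    proof (cases "k \<in> min_type w' z j")
      case True
      then have "w' j k + z k = y j" using y by blast
      then have "w' j k = y j - z k" by simp
      then show ?thesis by (simp add: right_diff_distrib)
    next
      case False
      then show ?thesis using c[OF nf] by simp
    qed
    have "(\<chi> j. \<chi> k. ?c j k) \<bullet> W = (\<Sum>j\<in>UNIV. \<Sum>k\<in>UNIV. ?c j k * w' j k)"
      unfolding W' inner_vec_def by simp
    also have "\<dots> = (\<Sum>j\<in>UNIV. \<Sum>k\<in>UNIV. ?c j k * y j) - (\<Sum>j\<in>UNIV. \<Sum>k\<in>UNIV. ?c j k * z k)"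
      unfolding eq by (simp add: sum_subtractf)
    also have "(\<Sum>j\<in>UNIV. \<Sum>k\<in>UNIV. ?c j k * y j) = 0" using c[OF nf] by (simp flip: sum_distrib_right)
    also have "(\<Sum>j\<in>UNIV. \<Sum>k\<in>UNIV. ?c j k * z k) = 0"
      using c[OF nf] by (subst sum.swap) (simp flip: sum_distrib_right)
    finally have "W \<in> N" unfolding N_def using nf by auto
    then show False using W(2) by blast
  qed
  moreover have "refines (range (min_type w')) (range (min_type w))"
    unfolding refines_def
  proof
    fix I assume "I \<in> range (min_type w')"
    then obtain z where z: "I = min_type w' z" by blast
    have ne: "\<And>j. I j \<noteq> {}" unfolding z by (rule min_type_nonempty)
    have "W \<in> tight_weights I" unfolding W' tight_weights_min_type[OF ne] using z by blast
    then have "?W \<in> tight_weights I" using W(1) unfolding U_def by blast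
    then show "\<exists>I'\<in>range (min_type w). \<forall>j. I j \<subseteq> I' j" unfolding tight_weights_min_type[OF ne] by blast
  qed
  ultimately show ?thesis by blast
qed

section \<open>Dimension and integrality of mixed cells\<close>

definition directions :: "'v::real_vector set \<Rightarrow> 'v set" where
  "directions H = {x - y | x y. x \<in> H \<and> y \<in> H}"

lemma span_directions:
  assumes "a \<in> H"
  shows "span (directions H) = span ((\<lambda>x. x - a) ` H)"
proof (rule antisym)
  have "x - y \<in> span ((\<lambda>x. x - a) ` H)" if "x \<in> H" "y \<in> H" for x y
  proof -
    have "(x - a) - (y - a) \<in> span ((\<lambda>x. x - a) ` H)"
      using that by (intro span_diff span_base imageI)
    then show ?thesis by simp
  qed
  then show "span (directions H) \<subseteq> span ((\<lambda>x. x - a) ` H)"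
    by (intro span_minimal) (auto simp: directions_def)
  show "span ((\<lambda>x. x - a) ` H) \<subseteq> span (directions H)"
    using assms by (intro span_mono) (auto simp: directions_def)
qed

lemma aff_dim_directions:
  fixes H :: "'v::euclidean_space set"
  assumes "H \<noteq> {}"
  shows "aff_dim H = int (dim (directions H))"
proof -
  obtain a where a: "a \<in> H" using assms by blast
  have "aff_dim H = int (dim ((\<lambda>x. x - a) ` H))"
    by (rule aff_dim_eq_dim_subtract) (use a hull_inc in fast)
  also have "\<dots> = int (dim (span (directions H)))"
    by (simp add: span_directions[OF a])
  finally show ?thesis by simp
qed

text \<open>Stated for families because the spanning vectors of a cell are indexed by edges. A
  repeated member would give the relation with coefficients 1 and -1, whence injectivity.\<close>

lemma independent_family:
  fixes f :: "'i \<Rightarrow> 'v::real_vector"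
  assumes "finite K" and z: "\<And>u. (\<Sum>i\<in>K. u i *\<^sub>R f i) = 0 \<Longrightarrow> \<forall>i\<in>K. u i = (0::real)"
  shows "independent (f ` K)" "inj_on f K"
proof -
  show inj: "inj_on f K"
  proof (rule inj_onI, rule ccontr)
    fix x y assume xy: "x \<in> K" "y \<in> K" "f x = f y" "x \<noteq> y"
    let ?u = "\<lambda>i. if i = x then 1 else if i = y then - 1 else (0::real)"
    have "(\<Sum>i\<in>K. ?u i *\<^sub>R f i) = (\<Sum>i\<in>{x, y}. ?u i *\<^sub>R f i)"
      by (rule sum.mono_neutral_right) (use xy assms in auto)
    also have "\<dots> = 0" using xy by simp
    finally show False using z[of ?u] xy(1) by auto
  qed
  show "independent (f ` K)"
  proof (rule ccontr)
    assume "\<not> independent (f ` K)"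
    then obtain u where u: "\<exists>v\<in>f ` K. u v \<noteq> 0" "(\<Sum>v\<in>f ` K. u v *\<^sub>R v) = 0"
      using real_vector.dependent_finite[of "f ` K"] assms(1) by auto
    have "(\<Sum>i\<in>K. u (f i) *\<^sub>R f i) = 0" using u(2) by (simp add: sum.reindex[OF inj])
    then show False using z[of "\<lambda>i. u (f i)"] u(1) by auto
  qed
qed

lemma transport_mono: "transport J m \<Longrightarrow> (\<And>j. J j \<subseteq> I j) \<Longrightarrow> transport I m"
  unfolding transport_def by blast

definition vertex_transport :: "('n \<Rightarrow> 'd) \<Rightarrow> 'n \<Rightarrow> 'd \<Rightarrow> real" where
  "vertex_transport c j k = (if k = c j then 1 else 0)"

lemma transport_vertex: "(\<And>j. c j \<in> I j) \<Longrightarrow> transport I (vertex_transport (c :: 'n \<Rightarrow> 'd::finite))"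
  unfolding transport_def vertex_transport_def by auto

lemma column_sums_vertex: "column_sums (vertex_transport c) = (\<Sum>j\<in>UNIV. axis (c j) 1)"
  unfolding column_sums_def vertex_transport_def Finite_Cartesian_Product.vec_eq_iff
  by (auto simp: axis_def intro!: sum.cong)

definition cell_dim :: "('n::finite \<Rightarrow> 'd set) \<Rightarrow> nat" where
  "cell_dim I = (\<Sum>j\<in>UNIV. card (I j) - 1)"

text \<open>Fix an element c j in each row. The differences \<open>f (j, k)\<close>, one for every
  other element of a row, span the directions of the cell; a relation among them turns into a
  balanced matrix on the edges, which vanishes on a forest.\<close>

lemma mixed_cell_dim:
  fixes I :: "'n::finite \<Rightarrow> 'd::finite set"
  assumes F: "forest I" and ne: "\<And>j. I j \<noteq> {}"
  shows "aff_dim (mixed_cell I) = int (cell_dim I)"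
proof -
  define c where "c j = (SOME k. k \<in> I j)" for j
  have c: "c j \<in> I j" for j unfolding c_def using ne by (simp add: some_in_eq)
  define K where "K = Sigma UNIV (\<lambda>j. I j - {c j})"
  define f :: "'n \<times> 'd \<Rightarrow> real^'d" where "f i = axis (snd i) 1 - axis (c (fst i)) 1" for i
  have cardK: "card K = cell_dim I"
    unfolding K_def cell_dim_def using c by (simp add: card_SigmaI)
  have z: "\<forall>i\<in>K. u i = 0" if u: "(\<Sum>i\<in>K. u i *\<^sub>R f i) = 0" for u :: "'n \<times> 'd \<Rightarrow> real"
  proof -
    define s where "s j = (\<Sum>k\<in>I j - {c j}. u (j, k))" for j
    \<comment> \<open>The entry at \<open>c j\<close> is filled in so that each row sums to zero;
      the column sums are then the coordinates of the given relation.\<close>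
    define v where "v j k = (if k = c j then - s j else if k \<in> I j then u (j, k) else 0)" for j k
    have row: "(\<Sum>k\<in>UNIV. v j k *\<^sub>R b k) = (\<Sum>k\<in>I j - {c j}. u (j, k) *\<^sub>R (b k - b (c j)))"
      for j and b :: "'d \<Rightarrow> 'x::real_vector"
    proof -
      have "(\<Sum>k\<in>UNIV. v j k *\<^sub>R b k) = (\<Sum>k\<in>insert (c j) (I j - {c j}). v j k *\<^sub>R b k)"
        by (rule sum.mono_neutral_right) (auto simp: v_def)
      also have "\<dots> = v j (c j) *\<^sub>R b (c j) + (\<Sum>k\<in>I j - {c j}. v j k *\<^sub>R b k)"
        by (rule sum.insert) auto
      also have "(\<Sum>k\<in>I j - {c j}. v j k *\<^sub>R b k) = (\<Sum>k\<in>I j - {c j}. u (j, k) *\<^sub>R b k)"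
        by (rule sum.cong) (auto simp: v_def)
      also have "v j (c j) = - s j" by (simp add: v_def)
      finally show ?thesis
        by (simp add: s_def scaleR_diff_right sum_subtractf scaleR_sum_left)
    qed
    have "v j k = 0" for j k
    proof (rule forest_zero[OF F])
      show "v j k = 0" if "k \<notin> I j" for j k using that c by (auto simp: v_def)
      show "(\<Sum>k\<in>UNIV. v j k) = 0" for j using row[of j "\<lambda>_. 1::real"] by simp
      have "(\<Sum>j\<in>UNIV. \<Sum>k\<in>UNIV. v j k *\<^sub>R axis k (1::real)) = (\<Sum>j\<in>UNIV. \<Sum>k\<in>I j - {c j}. u (j, k) *\<^sub>R f (j, k))"
        unfolding row by (simp add: f_def)
      also have "\<dots> = (\<Sum>i\<in>K. u i *\<^sub>R f i)" unfolding K_def by (simp add: sum.Sigma)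
      finally have "(\<Sum>k\<in>UNIV. (\<Sum>j\<in>UNIV. v j k) *\<^sub>R axis k (1::real)) = 0"
        unfolding u scaleR_sum_left by (subst sum.swap)
      then show "(\<Sum>j\<in>UNIV. v j k) = 0" for k
        unfolding axis_sum by (simp add: Finite_Cartesian_Product.vec_eq_iff)
    qed
    then have "u (j, k) = 0" if "k \<in> I j" "k \<noteq> c j" for j k
      using that unfolding v_def by metis
    then show ?thesis unfolding K_def by auto
  qed
  have K: "independent (f ` K)" "inj_on f K" using independent_family[of K f, OF _ z] by auto
  have "span (directions (mixed_cell I)) = span (f ` K)"
  proof (rule antisym)
    have "x - y \<in> span (f ` K)" if "x \<in> mixed_cell I" "y \<in> mixed_cell I" for x y
    proof -
      obtain m m' where m: "transport I m" "x = column_sums m" and m': "transport I m'" "y = column_sums m'"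
        using \<open>x \<in> mixed_cell I\<close> \<open>y \<in> mixed_cell I\<close> unfolding mixed_cell_iff by blast
      let ?d = "\<lambda>j k. m j k - m' j k"
      have row: "(\<Sum>k\<in>UNIV. ?d j k) = 0" for j using m(1) m'(1) by (simp add: transport_def sum_subtractf)
      have "x - y = (\<chi> k. \<Sum>j\<in>UNIV. ?d j k)"
        unfolding m(2) m'(2) column_sums_def by (simp add: Finite_Cartesian_Product.vec_eq_iff sum_subtractf)
      also have "\<dots> = (\<Sum>j\<in>UNIV. \<Sum>k\<in>UNIV. ?d j k *\<^sub>R axis k (1::real))"
        unfolding axis_sum[symmetric] scaleR_sum_left by (rule sum.swap)
      also have "\<dots> = (\<Sum>j\<in>UNIV. \<Sum>k\<in>UNIV. ?d j k *\<^sub>R f (j, k))"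
      proof (rule sum.cong[OF refl])
        fix j
        have "(\<Sum>k\<in>UNIV. ?d j k *\<^sub>R f (j, k)) = (\<Sum>k\<in>UNIV. ?d j k *\<^sub>R axis k (1::real)) - (\<Sum>k\<in>UNIV. ?d j k) *\<^sub>R axis (c j) 1"
          by (simp only: f_def fst_conv snd_conv scaleR_diff_right, subst sum_subtractf, simp only: scaleR_sum_left)
        then show "(\<Sum>k\<in>UNIV. ?d j k *\<^sub>R axis k (1::real)) = (\<Sum>k\<in>UNIV. ?d j k *\<^sub>R f (j, k))"
          unfolding row by simp
      qed
      also have "\<dots> \<in> span (f ` K)"
      proof (intro span_sum)
        fix j k
        show "?d j k *\<^sub>R f (j, k) \<in> span (f ` K)"
        proof (cases "(j, k) \<in> K")
          case True
          then show ?thesis by (intro span_scale span_base imageI)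
        next
          case False
          then have "?d j k = 0 \<or> f (j, k) = 0"
            using m(1) m'(1) by (auto simp: K_def f_def transport_def)
          then show ?thesis by (auto simp: span_zero)
        qed
      qed
      finally show ?thesis .
    qed
    then show "span (directions (mixed_cell I)) \<subseteq> span (f ` K)"
      by (intro span_minimal) (auto simp: directions_def)
    have "f (j, k) \<in> directions (mixed_cell I)" if k: "k \<in> I j" for j k
    proof -
      \<comment> \<open>Changing the choice function in row j alone gives two points of the cell
        whose difference is the required vector.\<close>
      let ?x = "column_sums (vertex_transport (c(j := k)))" and ?y = "column_sums (vertex_transport c)"
      have "?x \<in> mixed_cell I" "?y \<in> mixed_cell I"
        unfolding mixed_cell_iff using transport_vertex[of "c(j := k)" I] transport_vertex[of c I] c k
        by (metis fun_upd_apply)+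
      moreover have "f (j, k) = ?x - ?y"
      proof -
        have "?x - ?y = (\<Sum>i\<in>UNIV. axis ((c(j := k)) i) 1 - axis (c i) 1)"
          unfolding column_sums_vertex sum_subtractf ..
        also have "\<dots> = (\<Sum>i\<in>UNIV. if i = j then f (j, k) else 0)"
          by (intro sum.cong) (auto simp: f_def)
        finally show ?thesis by simp
      qed
      ultimately show ?thesis unfolding directions_def by blast
    qed
    then have "f ` K \<subseteq> directions (mixed_cell I)" unfolding K_def by auto
    then show "span (f ` K) \<subseteq> span (directions (mixed_cell I))" by (rule span_mono)
  qed
  then have "dim (directions (mixed_cell I)) = dim (f ` K)" by (metis dim_span)
  also have "\<dots> = card (f ` K)" by (rule dim_eq_card_independent[OF K(1)])
  also have "\<dots> = cell_dim I" using card_image[OF K(2)] cardK by simp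
  finally have "dim (directions (mixed_cell I)) = cell_dim I" .
  moreover have "mixed_cell I \<noteq> {}" using transport_vertex[of c I] c mixed_cell_iff by blast
  ultimately show ?thesis using aff_dim_directions by metis
qed

text \<open>The edge vectors lie in the span of one vector for each row, its edge to column
  \<open>k0\<close>, and one for each further column, its difference with \<open>k0\<close>. An
  independent set has at most that many elements.\<close>

lemma forest_card:
  fixes I :: "'n::finite \<Rightarrow> 'd::finite set"
  assumes F: "forest I" and sub: "\<And>j k. k \<in> I j \<Longrightarrow> j \<in> R \<and> k \<in> C" and k0: "k0 \<in> C"
  shows "card (Sigma UNIV I) < card R + card C"
proof -
  let ?f = "\<lambda>i. product_vertex (fst i) (snd i)"
  let ?T = "(\<lambda>j. product_vertex j k0) ` R \<union> (\<lambda>k. (0, axis k 1 - axis k0 1)) ` (C - {k0})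
    :: ((real^'n) \<times> (real^'d)) set"
  have inj: "inj_on ?f (Sigma UNIV I)" by (auto simp: inj_on_def)
  have "?f ` Sigma UNIV I \<subseteq> span ?T"
  proof
    fix x assume "x \<in> ?f ` Sigma UNIV I"
    then obtain j k where x: "x = product_vertex j k" "k \<in> I j" by auto
    have jk: "j \<in> R" "k \<in> C" using sub x(2) by auto
    have 1: "product_vertex j k0 \<in> span ?T" using jk by (intro span_base) auto
    have 2: "(0, axis k 1 - axis k0 1) \<in> span ?T"
    proof (cases "k = k0")
      case True
      then show ?thesis using span_zero[of ?T] by (simp add: zero_prod_def)
    next
      case False
      then show ?thesis using jk by (intro span_base) auto
    qed
    have "x = product_vertex j k0 + (0, axis k 1 - axis k0 1)" unfolding x(1) product_vertex_def by simp
    then show "x \<in> span ?T" using span_add[OF 1 2] by simp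
  qed
  moreover have "independent (?f ` Sigma UNIV I)" using F unfolding forest_def edges_image .
  ultimately have "card (?f ` Sigma UNIV I) \<le> card ?T"
    using independent_span_bound[of ?T "?f ` Sigma UNIV I"] by auto
  also have "\<dots> \<le> card R + card (C - {k0})"
    by (rule order_trans[OF card_Un_le add_mono]) (auto intro: card_image_le)
  also have "\<dots> < card R + card C" using psubset_card_mono[of C "C - {k0}"] k0 by auto
  finally show ?thesis unfolding card_image[OF inj] .
qed

text \<open>Otherwise every row and every column meeting a fractional entry has at least two of them,
  which are too many edges for a forest.\<close>

lemma forest_transport_integral:
  fixes I :: "'n::finite \<Rightarrow> 'd::finite set"
  assumes F: "forest I" and m: "transport I m" and int: "\<And>k. column_sums m $ k \<in> \<int>"
  shows "m j k \<in> \<int>"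
proof (rule ccontr)
  assume nz: "m j k \<notin> \<int>"
  define E where "E j = {k. m j k \<notin> \<int>}" for j
  define R where "R = {j. E j \<noteq> {}}"
  define C where "C = {k. \<exists>j. k \<in> E j}"
  have EI: "E j \<subseteq> I j" for j unfolding E_def using m by (auto simp: transport_def) (metis Ints_0)
  have "forest E" by (rule forest_mono[OF F EI])
  moreover have "j \<in> R \<and> k \<in> C" if "k \<in> E j" for j k using that unfolding R_def C_def by auto
  moreover have "k \<in> C" using nz unfolding C_def E_def by auto
  ultimately have lt: "card (Sigma UNIV E) < card R + card C" by (rule forest_card)
  \<comment> \<open>A lone fractional term would be a difference of integers.\<close>
  have two: "2 \<le> card {i. g i \<notin> \<int>}" if s: "sum g UNIV \<in> \<int>" and i: "g i \<notin> \<int>"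
    for g :: "'i::finite \<Rightarrow> real" and i
  proof (rule ccontr)
    assume "\<not> 2 \<le> card {i. g i \<notin> \<int>}"
    moreover have "card {i. g i \<notin> \<int>} \<noteq> 0" using i by auto
    ultimately have "card {i. g i \<notin> \<int>} = 1" by linarith
    then have "{i. g i \<notin> \<int>} = {i}" using i by (metis card_1_singletonE mem_Collect_eq singletonD)
    then have "g l \<in> \<int>" if "l \<noteq> i" for l using that by blast
    then have "sum g (UNIV - {i}) \<in> \<int>" by (intro Ints_sum) auto
    moreover have "sum g UNIV = g i + sum g (UNIV - {i})" by (rule sum.remove) auto
    ultimately show False using s i by (metis Ints_diff add_diff_cancel_right')
  qed
  have row: "2 \<le> card (E j)" if "j \<in> R" for j
  proof -
    obtain k where "m j k \<notin> \<int>" using \<open>j \<in> R\<close> unfolding R_def E_def by blast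
    moreover have "sum (m j) UNIV \<in> \<int>" using m by (simp add: transport_def)
    ultimately show ?thesis unfolding E_def by (rule two[rotated])
  qed
  have col: "2 \<le> card {j. k \<in> E j}" if "k \<in> C" for k
  proof -
    obtain j where "m j k \<notin> \<int>" using \<open>k \<in> C\<close> unfolding C_def E_def by blast
    moreover have "(\<Sum>j\<in>UNIV. m j k) \<in> \<int>" using int[of k] by (simp add: column_sums_def)
    ultimately show ?thesis unfolding E_def using two[of "\<lambda>j. m j k"] by auto
  qed
  have "2 * card R \<le> (\<Sum>j\<in>R. card (E j))" using sum_mono[of R "\<lambda>_. 2" "\<lambda>j. card (E j)"] row by simp
  also have "\<dots> \<le> (\<Sum>j\<in>UNIV. card (E j))" by (rule sum_mono2) auto
  also have "\<dots> = card (Sigma UNIV E)" by (simp add: card_SigmaI)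
  finally have 1: "2 * card R \<le> card (Sigma UNIV E)" .
  have "2 * card C \<le> (\<Sum>k\<in>C. card {j. k \<in> E j})" using sum_mono[of C "\<lambda>_. 2" "\<lambda>k. card {j. k \<in> E j}"] col by simp
  also have "\<dots> \<le> (\<Sum>k\<in>UNIV. card {j. k \<in> E j})" by (rule sum_mono2) auto
  also have "\<dots> = card (Sigma UNIV (\<lambda>k. {j. k \<in> E j}))" by (simp add: card_SigmaI)
  also have "\<dots> = card (prod.swap ` Sigma UNIV E)"
    by (rule arg_cong[where f = card]) (auto simp: image_iff)
  also have "\<dots> = card (Sigma UNIV E)" by (rule card_image) simp
  finally have "2 * card C \<le> card (Sigma UNIV E)" .
  then show False using lt 1 by linarith
qed

section \<open>Cells of a generic arrangement\<close>

lemma coarse_type_mono: "(\<And>j. J j \<subseteq> I j) \<Longrightarrow> coarse_type J k \<le> coarse_type (I :: 'n::finite \<Rightarrow> _) k"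
  unfolding coarse_type_def by (rule card_mono) auto

text \<open>Both sides count the edges of the bipartite graph. Thus vertices have coarse types of
  total degree n, and the degree grows in step with the dimension, which is the source of
  minimality.\<close>

lemma sum_coarse_type:
  fixes I :: "'n::finite \<Rightarrow> 'd::finite set"
  assumes "\<And>j. I j \<noteq> {}"
  shows "(\<Sum>k\<in>UNIV. coarse_type I k) = cell_dim I + CARD('n)"
proof -
  have "(\<Sum>k\<in>UNIV. coarse_type I k) = card (Sigma UNIV (\<lambda>k. {j. k \<in> I j}))"
    unfolding coarse_type_def by (simp add: card_SigmaI)
  also have "\<dots> = card (prod.swap ` Sigma UNIV I)"
    by (rule arg_cong[where f = card]) (auto simp: image_iff)
  also have "\<dots> = card (Sigma UNIV I)" by (rule card_image) simp
  also have "\<dots> = (\<Sum>j\<in>UNIV. card (I j))" by (simp add: card_SigmaI)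
  also have "\<dots> = (\<Sum>j\<in>UNIV. (card (I j) - 1) + 1)"
  proof (rule sum.cong[OF refl])
    fix j
    have "card (I j) \<noteq> 0" using assms[of j] by simp
    then show "card (I j) = (card (I j) - 1) + 1" by linarith
  qed
  also have "\<dots> = cell_dim I + CARD('n)" unfolding cell_dim_def sum.distrib by simp
  finally show ?thesis .
qed

definition cell_facet :: "('n \<Rightarrow> 'd set) \<Rightarrow> ('n \<Rightarrow> 'd set) \<Rightarrow> bool" where
  "cell_facet J I \<longleftrightarrow> (\<exists>j k. k \<in> I j \<and> I j \<noteq> {k} \<and> J = I(j := I j - {k}))"

lemma cell_facet_sub: "cell_facet J I \<Longrightarrow> J j \<subseteq> I j"
  unfolding cell_facet_def by (auto split: if_splits)

lemma cell_facet_dim: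
  fixes I :: "'n::finite \<Rightarrow> 'd::finite set"
  assumes "cell_facet J I"
  shows "cell_dim I = Suc (cell_dim J)"
proof -
  obtain j k where jk: "k \<in> I j" "I j \<noteq> {k}" "J = I(j := I j - {k})"
    using assms unfolding cell_facet_def by blast
  have "I j - {k} \<noteq> {}" using jk(1,2) by blast
  then have "card (I j - {k}) \<noteq> 0" by simp
  moreover have "card (I j) = Suc (card (I j - {k}))" using jk(1) by (intro card_Suc_Diff1[symmetric]) auto
  moreover have "J j = I j - {k}" by (simp add: jk(3))
  ultimately have "card (I j) - 1 = (card (J j) - 1) + 1" by presburger
  moreover have "cell_dim I = (card (I j) - 1) + (\<Sum>i\<in>UNIV - {j}. card (I i) - 1)"
    unfolding cell_dim_def by (rule sum.remove) auto
  moreover have "cell_dim J = (card (J j) - 1) + (\<Sum>i\<in>UNIV - {j}. card (J i) - 1)"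
    unfolding cell_dim_def by (rule sum.remove) auto
  moreover have "(\<Sum>i\<in>UNIV - {j}. card (J i) - 1) = (\<Sum>i\<in>UNIV - {j}. card (I i) - 1)"
    by (rule sum.cong) (auto simp: jk(3))
  ultimately show ?thesis by simp
qed

text \<open>Tropical convexity: for two points normalized to the same minimum in row \<open>j\<close>, take the
  pointwise minimum.\<close>

lemma min_type_join:
  fixes w :: "'n::finite \<Rightarrow> 'd::finite \<Rightarrow> real"
  shows "\<exists>z''. min_type w z'' j = min_type w z j \<union> min_type w z' j \<and>
    (\<forall>i. min_type w z i = min_type w z' i \<longrightarrow> min_type w z'' i = min_type w z i) \<and>
    (\<forall>k. coarse_type (min_type w z'') k \<le> max (coarse_type (min_type w z) k) (coarse_type (min_type w z') k))"
proof -
  obtain y where y: "\<And>j k. y j \<le> w j k + z k" "\<And>j. \<exists>k. w j k + z k = y j"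
    "\<And>j. min_type w z j = {k. w j k + z k = y j}" using min_type_ex[of w z] by blast
  obtain y0 where y0: "\<And>j k. y0 j \<le> w j k + z' k" "\<And>j. \<exists>k. w j k + z' k = y0 j"
    "\<And>j. min_type w z' j = {k. w j k + z' k = y0 j}" using min_type_ex[of w z'] by blast
  \<comment> \<open>Adding the constant t to \<open>z'\<close> does not change its type and makes
    the two minima in row j equal.\<close>
  define t where "t = y j - y0 j"
  define v where "v k = z' k + t" for k
  define x where "x i = y0 i + t" for i
  have x: "\<And>i k. x i \<le> w i k + v k" "\<And>i. \<exists>k. w i k + v k = x i"
    "\<And>i. min_type w z' i = {k. w i k + v k = x i}"
    using y0 by (auto simp: x_def v_def add.assoc[symmetric])
  have xj: "x j = y j" by (simp add: x_def t_def)
  define u where "u k = min (z k) (v k)" for k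
  have type: "min_type w u i = {k. w i k + u k = min (x i) (y i)}" for i
  proof (rule min_type_eqI)
    fix i k
    show "min (x i) (y i) \<le> w i k + u k" using x(1)[of i k] y(1)[of i k] unfolding u_def by linarith
  next
    fix i
    obtain k where k: "w i k + v k = x i" using x(2) by blast
    obtain l where l: "w i l + z l = y i" using y(2) by blast
    show "\<exists>k. w i k + u k = min (x i) (y i)"
    proof (cases "x i \<le> y i")
      case True
      then have "w i k + u k = min (x i) (y i)" using k y(1)[of i k] unfolding u_def by linarith
      then show ?thesis ..
    next
      case False
      then have "w i l + u l = min (x i) (y i)" using l x(1)[of i l] unfolding u_def by linarith
      then show ?thesis ..
    qed
  qed
  \<comment> \<open>Row i is taken from the point with the smaller row minimum, and is the union
    when the minima tie, as in row j.\<close>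
  have mem: "k \<in> min_type w u i \<longleftrightarrow> (k \<in> min_type w z i \<and> y i \<le> x i) \<or> (k \<in> min_type w z' i \<and> x i \<le> y i)"
    for i k
    unfolding type x(3) y(3) mem_Collect_eq u_def using x(1)[of i k] y(1)[of i k] by linarith
  \<comment> \<open>In column k the pointwise minimum selects one of the two points for all rows at
    once, so column k of the new type lies inside that of the selected point. This bounds coarse
    types by the maximum.\<close>
  have sub: "{i. k \<in> min_type w u i} \<subseteq> {i. k \<in> min_type w z i} \<or> {i. k \<in> min_type w u i} \<subseteq> {i. k \<in> min_type w z' i}"
    for k
  proof (cases "z k \<le> v k")
    case True
    have "k \<in> min_type w z i" if "k \<in> min_type w u i" for i
      using that True y(1)[of i k] unfolding type y(3) mem_Collect_eq u_def by linarith
    then show ?thesis by blast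
  next
    case False
    have "k \<in> min_type w z' i" if "k \<in> min_type w u i" for i
      using that False x(1)[of i k] unfolding type x(3) mem_Collect_eq u_def by linarith
    then show ?thesis by blast
  qed
  have "coarse_type (min_type w u) k \<le> max (coarse_type (min_type w z) k) (coarse_type (min_type w z') k)" for k
  proof -
    from sub[of k] show ?thesis
    proof
      assume "{i. k \<in> min_type w u i} \<subseteq> {i. k \<in> min_type w z i}"
      then have "coarse_type (min_type w u) k \<le> coarse_type (min_type w z) k"
        unfolding coarse_type_def by (intro card_mono) auto
      then show ?thesis by simp
    next
      assume "{i. k \<in> min_type w u i} \<subseteq> {i. k \<in> min_type w z' i}"
      then have "coarse_type (min_type w u) k \<le> coarse_type (min_type w z') k"
        unfolding coarse_type_def by (intro card_mono) auto
      then show ?thesis by simp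
    qed
  qed
  moreover have "min_type w u j = min_type w z j \<union> min_type w z' j"
    using mem[of _ j] xj by auto
  moreover have "min_type w u i = min_type w z i" if "min_type w z i = min_type w z' i" for i
    using mem[of _ i] that by (auto simp: linear)
  ultimately show ?thesis by blast
qed

locale generic_weights =
  fixes w :: "'n::finite \<Rightarrow> 'd::finite \<Rightarrow> real"
  assumes forest_min_type: "forest (min_type w z)"
begin

abbreviation cells :: "('n \<Rightarrow> 'd set) set" where "cells \<equiv> range (min_type w)"

lemma cells_nonempty: "I \<in> cells \<Longrightarrow> I j \<noteq> {}"
  by (erule rangeE) (simp add: min_type_nonempty)

lemma cells_forest: "I \<in> cells \<Longrightarrow> forest I"
  by (erule rangeE) (simp add: forest_min_type)

text \<open>A forest has potentials a, b with a j + b k equal to 0 on the edges of \<open>J\<close>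
  and 1 on the other edges of \<open>I\<close>. Moving z along b by a small positive e keeps
  \<open>J\<close> tight and loosens the rest of \<open>I\<close>, while the finitely many strict
  inequalities off \<open>I\<close> survive.\<close>

lemma cells_down:
  assumes I: "I \<in> cells" and ne: "\<And>j. J j \<noteq> {}" and sub: "\<And>j. J j \<subseteq> I j"
  shows "J \<in> cells"
proof -
  obtain z where z: "I = min_type w z" using I by blast
  obtain y where y: "\<And>j k. y j \<le> w j k + z k" "\<And>j. min_type w z j = {k. w j k + z k = y j}"
    using min_type_ex[of w z] by blast
  define s where "s j k = w j k + z k - y j" for j k
  have s0: "0 < s j k" if "k \<notin> I j" for j k
    using y(1)[of j k] that unfolding z y(2) s_def by simp
  have sI: "s j k = 0" if "k \<in> I j" for j k using that unfolding z y(2) s_def by simp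
  obtain a b where ab: "\<And>j k. k \<in> I j \<Longrightarrow> a j + b k = (if k \<in> J j then 0 else (1::real))"
    using forest_potential[OF cells_forest[OF I], of "\<lambda>j k. if k \<in> J j then 0 else 1"] by blast
  have "\<forall>p\<in>{p. snd p \<notin> I (fst p)}. \<forall>\<^sub>F e in at_right 0. e * \<bar>a (fst p) + b (snd p)\<bar> < s (fst p) (snd p)"
  proof
    fix p assume "p \<in> {p. snd p \<notin> I (fst p)}"
    then have "0 < s (fst p) (snd p)" using s0 by simp
    moreover have "((\<lambda>e. e * \<bar>a (fst p) + b (snd p)\<bar>) \<longlongrightarrow> 0) (at_right 0)"
      by (auto intro!: tendsto_eq_intros)
    ultimately show "\<forall>\<^sub>F e in at_right 0. e * \<bar>a (fst p) + b (snd p)\<bar> < s (fst p) (snd p)"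
      by (rule order_tendstoD(2)[rotated])
  qed
  then have "\<forall>\<^sub>F e in at_right (0::real). \<forall>p\<in>{p. snd p \<notin> I (fst p)}. e * \<bar>a (fst p) + b (snd p)\<bar> < s (fst p) (snd p)"
    by (intro eventually_ball_finite) auto
  then have "\<forall>\<^sub>F e in at_right (0::real). 0 < e \<and> (\<forall>p\<in>{p. snd p \<notin> I (fst p)}. e * \<bar>a (fst p) + b (snd p)\<bar> < s (fst p) (snd p))"
    by (intro eventually_conj eventually_at_right_less)
  then obtain e :: real where e0: "0 < e"
    and e1: "\<forall>p\<in>{p. snd p \<notin> I (fst p)}. e * \<bar>a (fst p) + b (snd p)\<bar> < s (fst p) (snd p)"
    using eventually_happens'[OF trivial_limit_at_right_real] by blast
  have e: "0 < e" "\<And>j k. k \<notin> I j \<Longrightarrow> e * \<bar>a j + b k\<bar> < s j k"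
    using e0 bspec[OF e1, of "(_, _)"] by simp_all
  define z' where "z' k = z k + e * b k" for k
  define y' where "y' j = y j - e * a j" for j
  have diff: "w j k + z' k - y' j = s j k + e * (a j + b k)" for j k
    unfolding z'_def y'_def s_def by (simp add: distrib_left)
  have pos: "0 < w j k + z' k - y' j" if "k \<notin> J j" for j k
  proof (cases "k \<in> I j")
    case True
    then show ?thesis unfolding diff using that sI ab e(1) by simp
  next
    case False
    have "\<bar>e * (a j + b k)\<bar> < s j k" using e(2)[OF False] e(1) by (simp add: abs_mult)
    then show ?thesis unfolding diff by linarith
  qed
  have zero: "w j k + z' k = y' j" if "k \<in> J j" for j k
  proof -
    have "k \<in> I j" using that sub by blast
    then show ?thesis using diff[of j k] that sI[of k j] ab[of k j] by simp
  qed
  have "min_type w z' j = {k. w j k + z' k = y' j}" for j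
  proof (rule min_type_eqI)
    show "y' j \<le> w j k + z' k" for j k using pos[of k j] zero[of k j] by (cases "k \<in> J j") auto
    show "\<exists>k. w j k + z' k = y' j" for j using ne[of j] zero by blast
  qed
  also have "{k. w j k + z' k = y' j} = J j" for j using pos[of _ j] zero[of _ j] by force
  finally have "min_type w z' = J" by (rule ext)
  then show ?thesis by blast
qed

text \<open>Each matrix is a cheapest transport for the potentials of its own cell. Equal column
  sums make the cost difference independent of z, so \<open>m'\<close> is optimal for
  \<open>I\<close> too. Slackness puts it on the edges of \<open>I\<close>, where the balanced
  difference of the two matrices vanishes.\<close>

lemma transport_unique:
  assumes I: "I \<in> cells" and J: "J \<in> cells" and m: "transport I m" and m': "transport J m'"
    and eq: "column_sums m = column_sums m'"
  shows "m = m'"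
proof -
  define W where "W m z = (\<Sum>j\<in>UNIV. \<Sum>k\<in>UNIV. m j k * (w j k + z k))" for m z
  have eqs: "(\<Sum>j\<in>UNIV. m j k) = (\<Sum>j\<in>UNIV. m' j k)" for k
    using eq unfolding column_sums_def by (simp add: Finite_Cartesian_Product.vec_eq_iff)
  have split: "W m z - W m' z = (\<Sum>j\<in>UNIV. \<Sum>k\<in>UNIV. (m j k - m' j k) * w j k)" for z
  proof -
    have "W m z - W m' z = (\<Sum>j\<in>UNIV. \<Sum>k\<in>UNIV. (m j k - m' j k) * w j k) +
       (\<Sum>j\<in>UNIV. \<Sum>k\<in>UNIV. (m j k - m' j k) * z k)"
      unfolding W_def sum_subtractf[symmetric] sum.distrib[symmetric]
      by (intro sum.cong refl) (simp add: algebra_simps)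
    also have "(\<Sum>j\<in>UNIV. \<Sum>k\<in>UNIV. (m j k - m' j k) * z k) = 0"
      by (subst sum.swap) (simp add: sum_subtractf eqs flip: sum_distrib_right)
    finally show ?thesis by simp
  qed
  have opt: "\<exists>z Y. W m1 z = Y \<and> Y \<le> W m2 z \<and> (W m2 z = Y \<longrightarrow> transport I1 m2)"
    if I1: "I1 \<in> cells" and m1: "transport I1 m1" and m2: "transport I2 m2" for I1 I2 m1 m2
  proof -
    obtain z where z: "I1 = min_type w z" using I1 by blast
    obtain y where y: "\<And>j k. y j \<le> w j k + z k" "\<And>j. min_type w z j = {k. w j k + z k = y j}"
      using min_type_ex[of w z] by blast
    have I1: "I1 = (\<lambda>j. {k. w j k + z k = y j})" using y(2) unfolding z by blast
    have "W m1 z = sum y UNIV" unfolding W_def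
      using transport_value(2)[OF m1, of y w z, OF y(1)] m1 I1 by simp
    moreover have "sum y UNIV \<le> W m2 z" unfolding W_def by (rule transport_value(1)[OF m2 y(1)])
    moreover have "W m2 z = sum y UNIV \<longrightarrow> transport I1 m2" unfolding W_def I1
      using transport_value(2)[OF m2, of y w z, OF y(1)] by simp
    ultimately show ?thesis by blast
  qed
  obtain z Y where 1: "W m z = Y" "Y \<le> W m' z" "W m' z = Y \<longrightarrow> transport I m'"
    using opt[OF I m m'] by blast
  obtain z' Y' where 2: "W m' z' = Y'" "Y' \<le> W m z'" using opt[OF J m' m] by blast
  have "W m' z = Y" using 1 2 split[of z] split[of z'] by linarith
  then have tI: "transport I m'" using 1 by blast
  have "m j k - m' j k = 0" for j k
  proof (rule forest_zero[OF cells_forest[OF I]])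
    show "m j k - m' j k = 0" if "k \<notin> I j" for j k using that m tI by (simp add: transport_def)
    show "(\<Sum>k\<in>UNIV. m j k - m' j k) = 0" for j using m tI by (simp add: transport_def sum_subtractf)
    show "(\<Sum>j\<in>UNIV. m j k - m' j k) = 0" for k by (simp add: sum_subtractf eqs)
  qed
  then show ?thesis by (simp add: fun_eq_iff)
qed

text \<open>The test point comes from the matrix that is uniform on every row of \<open>J\<close>:
  it is positive on all edges of \<open>J\<close>, and by uniqueness of transports its support lies
  in \<open>I\<close>.\<close>

lemma mixed_cell_subset_iff:
  assumes I: "I \<in> cells" and J: "J \<in> cells"
  shows "mixed_cell J \<subseteq> mixed_cell I \<longleftrightarrow> (\<forall>j. J j \<subseteq> I j)"
proof
  assume sub: "mixed_cell J \<subseteq> mixed_cell I"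
  define m where "m j k = (if k \<in> J j then 1 / real (card (J j)) else 0)" for j k
  have card: "card (J j) \<noteq> 0" for j using cells_nonempty[OF J, of j] by simp
  have m: "transport J m" unfolding transport_def m_def using card by (simp add: sum.If_cases)
  then have "column_sums m \<in> mixed_cell J" unfolding mixed_cell_iff by blast
  then obtain m' where m': "transport I m'" "column_sums m = column_sums m'"
    using sub unfolding mixed_cell_iff by (metis mixed_cell_iff subsetD)
  have "m = m'" by (rule transport_unique[OF J I m m'])
  have "k \<in> I j" if k: "k \<in> J j" for j k
  proof (rule ccontr)
    assume "k \<notin> I j"
    then have "m j k = 0" using m'(1) unfolding \<open>m = m'\<close> transport_def by blast
    then show False using k card by (simp add: m_def)
  qed
  then show "\<forall>j. J j \<subseteq> I j" by blast
next
  assume "\<forall>j. J j \<subseteq> I j"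
  then show "mixed_cell J \<subseteq> mixed_cell I" using transport_mono[of J _ I] unfolding subset_iff mixed_cell_iff by blast
qed

lemma mixed_cell_inject: "I \<in> cells \<Longrightarrow> J \<in> cells \<Longrightarrow> mixed_cell I = mixed_cell J \<longleftrightarrow> I = J"
  using mixed_cell_subset_iff[of I J] mixed_cell_subset_iff[of J I] by (auto simp: fun_eq_iff)

lemma mixed_cell_inj_on: "inj_on mixed_cell cells"
  by (simp add: inj_on_def mixed_cell_inject)

lemma complex: "polyhedral_complex (mixed_complex cells)"
  using mixed_subdivision_min_type[of w] unfolding mixed_subdivision_def polyhedral_subdivision_def
  by (elim conjE)

lemma mixed_cell_Int_face:
  assumes "I \<in> cells" "J \<in> cells"
  shows "(mixed_cell I \<inter> mixed_cell J) face_of mixed_cell I"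
proof -
  have "\<forall>C\<in>mixed_complex cells. \<forall>D\<in>mixed_complex cells. (C \<inter> D) face_of C \<and> (C \<inter> D) face_of D"
    using complex unfolding polyhedral_complex_def by (elim conjE)
  then show ?thesis
    using imageI[OF assms(1), of mixed_cell] imageI[OF assms(2), of mixed_cell] unfolding mixed_complex_def by blast
qed

text \<open>A smaller cell is its own intersection with the larger one, and in a polyhedral complex
  intersections are faces.\<close>

lemma mixed_cell_face_of_iff:
  assumes I: "I \<in> cells" and J: "J \<in> cells"
  shows "mixed_cell J face_of mixed_cell I \<longleftrightarrow> (\<forall>j. J j \<subseteq> I j)"
proof
  assume "mixed_cell J face_of mixed_cell I"
  then show "\<forall>j. J j \<subseteq> I j" using mixed_cell_subset_iff[OF I J] face_of_imp_subset by blast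
next
  assume "\<forall>j. J j \<subseteq> I j"
  then have "mixed_cell I \<inter> mixed_cell J = mixed_cell J" using mixed_cell_subset_iff[OF I J] by blast
  then show "mixed_cell J face_of mixed_cell I" using mixed_cell_Int_face[OF I J] by simp
qed

lemma face_of_mixed_cell:
  assumes "I \<in> cells" "G face_of mixed_cell I" "G \<noteq> {}"
  shows "\<exists>J\<in>cells. G = mixed_cell J"
proof -
  have "\<forall>C\<in>mixed_complex cells. \<forall>F. F face_of C \<and> F \<noteq> {} \<longrightarrow> F \<in> mixed_complex cells"
    using complex unfolding polyhedral_complex_def by (elim conjE)
  moreover have "mixed_cell I \<in> mixed_complex cells" using assms(1) unfolding mixed_complex_def by (rule imageI)
  ultimately have "G \<in> mixed_complex cells" using assms(2,3) by simp
  then show ?thesis unfolding mixed_complex_def by fast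
qed

lemma mixed_cell_nonempty:
  assumes "I \<in> cells"
  shows "mixed_cell I \<noteq> {}"
proof -
  have "\<exists>m. transport I m" by (rule transport_ex) (rule cells_nonempty[OF assms])
  then show ?thesis using mixed_cell_iff by blast
qed

lemma aff_dim_mixed_cell: "I \<in> cells \<Longrightarrow> aff_dim (mixed_cell I) = int (cell_dim I)"
  by (rule mixed_cell_dim) (erule cells_forest, erule cells_nonempty)

text \<open>Faces are rowwise subtuples, and by the dimension formula a facet loses exactly one
  element in all rows together.\<close>

lemma facet_of_mixed_cell_iff:
  assumes I: "I \<in> cells" and J: "J \<in> cells"
  shows "mixed_cell J facet_of mixed_cell I \<longleftrightarrow> cell_facet J I"
proof
  assume F: "mixed_cell J facet_of mixed_cell I"
  then have sub: "J j \<subseteq> I j" for j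
    using mixed_cell_face_of_iff[OF I J] unfolding facet_of_def by blast
  have dim: "cell_dim I = cell_dim J + 1"
    using F unfolding facet_of_def aff_dim_mixed_cell[OF I] aff_dim_mixed_cell[OF J] by linarith
  have cardJ: "card (J j) \<ge> 1" for j using cells_nonempty[OF J, of j] by (simp add: Suc_le_eq card_gt_0_iff)
  have le: "card (J j) \<le> card (I j)" for j using sub by (intro card_mono) auto
  have "(\<Sum>j\<in>UNIV. card (I j) - card (J j)) = cell_dim I - cell_dim J"
  proof -
    have "(\<Sum>j\<in>UNIV. card (I j) - card (J j)) + cell_dim J = cell_dim I"
      unfolding cell_dim_def sum.distrib[symmetric]
      using le cardJ by (intro sum.cong refl) (simp add: le_diff_conv2)
    then show ?thesis by simp
  qed
  then have one: "(\<Sum>j\<in>UNIV. card (I j) - card (J j)) = Suc 0" using dim by simp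
  then obtain j where j: "card (I j) - card (J j) = Suc 0" "\<And>i. i \<noteq> j \<Longrightarrow> card (I i) - card (J i) = 0"
    using sum_eq_Suc0_iff[of UNIV "\<lambda>j. card (I j) - card (J j)"] by auto
  have "J i = I i" if "i \<noteq> j" for i
    using j(2)[OF that] le[of i] sub[of i] by (intro card_subset_eq) auto
  moreover have "card (I j - J j) = Suc 0" using j(1) sub[of j] by (simp add: card_Diff_subset)
  then obtain k where k: "I j - J j = {k}" by (metis One_nat_def card_1_singletonE)
  ultimately have "J = I(j := I j - {k})" using sub[of j] by (auto simp: fun_eq_iff)
  moreover have "k \<in> I j" using k by blast
  moreover have "I j \<noteq> {k}" using calculation cells_nonempty[OF J, of j] by auto
  ultimately show "cell_facet J I" unfolding cell_facet_def by blast
next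
  assume CF: "cell_facet J I"
  have "mixed_cell J face_of mixed_cell I" using mixed_cell_face_of_iff[OF I J] cell_facet_sub[OF CF] by blast
  moreover have "cell_dim I = Suc (cell_dim J)" by (rule cell_facet_dim[OF CF])
  ultimately show "mixed_cell J facet_of mixed_cell I"
    unfolding facet_of_def aff_dim_mixed_cell[OF I] aff_dim_mixed_cell[OF J]
    using mixed_cell_nonempty[OF J] by simp
qed

section \<open>Vertices and labels\<close>

text \<open>Take k in every row that contains it and any element elsewhere. Since such a vertex
  exists for every k, the least common multiple of the vertex labels is the coarse type of the
  cell.\<close>

lemma vertex_attaining:
  assumes I: "I \<in> cells"
  shows "\<exists>J\<in>cells. (\<forall>j. J j \<subseteq> I j) \<and> cell_dim J = 0 \<and> coarse_type J k = coarse_type I k"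
proof -
  define J where "J j = {if k \<in> I j then k else (SOME l. l \<in> I j)}" for j
  have some: "(SOME l. l \<in> I j) \<in> I j" for j using cells_nonempty[OF I, of j] by (simp add: some_in_eq)
  have sub: "J j \<subseteq> I j" for j unfolding J_def using some by auto
  have "J \<in> cells" by (rule cells_down[OF I _ sub]) (simp add: J_def)
  moreover have "cell_dim J = 0" unfolding cell_dim_def J_def by simp
  moreover have "coarse_type J k = coarse_type I k"
    unfolding coarse_type_def J_def by (rule arg_cong[where f = card]) (use some in auto)
  ultimately show ?thesis using sub by blast
qed

lemma lcm_label_mixed_cell:
  assumes I: "I \<in> cells"
  shows "lcm_label cells (mixed_cell I) = coarse_type I"
proof
  fix k
  let ?S = "{coarse_type J k | J. J \<in> cells \<and> aff_dim (mixed_cell J) = 0 \<and> mixed_cell J face_of mixed_cell I}"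
  have "Max ?S = coarse_type I k"
  proof (rule Max_eqI)
    show "finite ?S" by (rule finite_subset[of _ "(\<lambda>J. coarse_type J k) ` UNIV"]) auto
    show "t \<le> coarse_type I k" if "t \<in> ?S" for t
      using that mixed_cell_face_of_iff[OF I] coarse_type_mono[of _ I k] by blast
    obtain J where J: "J \<in> cells" "\<And>j. J j \<subseteq> I j" "cell_dim J = 0" "coarse_type J k = coarse_type I k"
      using vertex_attaining[OF I, of k] by blast
    have "aff_dim (mixed_cell J) = 0" using aff_dim_mixed_cell[OF J(1)] J(3) by simp
    moreover have "mixed_cell J face_of mixed_cell I" using mixed_cell_face_of_iff[OF I J(1)] J(2) by blast
    ultimately show "coarse_type I k \<in> ?S" using J(1,4) by (intro CollectI exI[of _ J]) simp
  qed
  then show "lcm_label cells (mixed_cell I) k = coarse_type I k" unfolding lcm_label_def .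
qed

text \<open>The lattice point lies in some cell, and its transport matrix there is integral, hence
  has a single entry 1 in each row and zeros elsewhere. The support of that matrix is again a cell
  by \<open>cells_down\<close>.\<close>

lemma vertex_of_type:
  assumes t: "(\<Sum>k\<in>UNIV. t k) = CARD('n)"
  shows "\<exists>I\<in>cells. cell_dim I = 0 \<and> coarse_type I = t"
proof -
  define x :: "real^'d" where "x = (\<chi> k. real (t k))"
  have "x /\<^sub>R real CARD('n) \<in> simplex_face UNIV"
    unfolding simplex_face_iff x_def using t by (simp flip: sum_distrib_left of_nat_sum)
  moreover have "x = real CARD('n) *\<^sub>R (x /\<^sub>R real CARD('n))" by simp
  ultimately have "x \<in> dilated_simplex CARD('n)" unfolding dilated_simplex_def by (rule image_eqI[rotated])
  moreover have "\<Union>(mixed_complex cells) = (dilated_simplex CARD('n) :: (real^'d) set)"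
    using mixed_subdivision_min_type[of w] unfolding mixed_subdivision_def polyhedral_subdivision_def by blast
  ultimately obtain I where I: "I \<in> cells" "x \<in> mixed_cell I" unfolding mixed_complex_def by blast
  then obtain m where m: "transport I m" "x = column_sums m" unfolding mixed_cell_iff by blast
  have int: "m j k \<in> \<int>" for j k
    by (rule forest_transport_integral[OF cells_forest[OF I(1)] m(1)]) (simp add: m(2)[symmetric] x_def)
  have m01: "m j k = of_bool (m j k \<noteq> 0)" for j k
  proof -
    have "m j k \<le> (\<Sum>k\<in>UNIV. m j k)" by (rule member_le_sum) (use m(1) in \<open>auto simp: transport_def\<close>)
    then have "0 \<le> m j k" "m j k \<le> 1" using m(1) by (auto simp: transport_def)
    moreover obtain i where "m j k = of_int i" using int[of j k] by (auto elim: Ints_cases)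
    ultimately have "i = 0 \<or> i = 1" by auto
    then show ?thesis using \<open>m j k = of_int i\<close> by auto
  qed
  define J where "J j = {k. m j k \<noteq> 0}" for j
  have row: "card (J j) = 1" for j
  proof -
    have "(\<Sum>k\<in>UNIV. m j k) = (\<Sum>k\<in>UNIV. of_bool (k \<in> J j))"
      by (rule sum.cong) (use m01 in \<open>auto simp: J_def\<close>)
    also have "\<dots> = real (card (J j))" by simp
    finally show ?thesis using m(1) by (simp add: transport_def)
  qed
  have col: "coarse_type J k = t k" for k
  proof -
    have "real (t k) = (\<Sum>j\<in>UNIV. m j k)" using m(2) by (simp add: x_def column_sums_def Finite_Cartesian_Product.vec_eq_iff)
    also have "\<dots> = (\<Sum>j\<in>UNIV. of_bool (j \<in> {j. k \<in> J j}))"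
      by (rule sum.cong) (use m01 in \<open>auto simp: J_def\<close>)
    also have "\<dots> = real (coarse_type J k)" unfolding coarse_type_def by simp
    finally show ?thesis by simp
  qed
  have "J \<in> cells"
  proof (rule cells_down[OF I(1)])
    show "J j \<noteq> {}" for j using row[of j] by auto
    show "J j \<subseteq> I j" for j using m(1) unfolding J_def transport_def by blast
  qed
  moreover have "cell_dim J = 0" unfolding cell_dim_def row by simp
  ultimately show ?thesis using col by blast
qed

end

text \<open>Genericity is not read off from fineness directly: a generic refinement exists, and
  fineness identifies it with \<Sigma>.\<close>

lemma fine_regular_generic:
  assumes "regular_mixed_subdivision \<Sigma>" "fine_mixed_subdivision \<Sigma>"
  shows "\<exists>w. generic_weights w \<and> \<Sigma> = range (min_type w)"
proof -
  obtain w where w: "\<Sigma> = range (min_type w)" using regular_mixed_subdivision_ex[OF assms(1)] by blast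
  obtain w' where w': "\<And>z. forest (min_type w' z)" "refines (range (min_type w')) \<Sigma>"
    using generic_refinement[of w] unfolding w by blast
  have "range (min_type w') = \<Sigma>"
    using assms(2) w'(2) mixed_subdivision_min_type[of w'] unfolding fine_mixed_subdivision_def by blast
  then show ?thesis using w'(1) generic_weights.intro by blast
qed

section \<open>Incidence numbers\<close>

text \<open>The determinant behind \<open>relative_orientation\<close>, kept before taking its sign
  so that linearity and row operations apply.\<close>

definition odet :: "'v::euclidean_space list \<Rightarrow> 'v list \<Rightarrow> real" where
  "odet bs cs = Determinant.det (Matrix.mat (length cs) (length cs) (\<lambda>(i, j). bs ! i \<bullet> cs ! j))"

lemma relative_orientation_sgn: "real_of_int (relative_orientation bs cs) = sgn (odet bs cs)"
  unfolding relative_orientation_def odet_def Let_def by simp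

lemma odet_matrix_mult:
  assumes "length bs' = length cs" "length bs = length cs"
    and M: "M \<in> carrier_mat (length cs) (length cs)"
    and eq: "\<And>i. i < length cs \<Longrightarrow> bs' ! i = (\<Sum>l<length cs. (M $$ (i, l)) *\<^sub>R bs ! l)"
  shows "odet bs' cs = Determinant.det M * odet bs cs"
proof -
  let ?r = "length cs"
  let ?A = "Matrix.mat ?r ?r (\<lambda>(i, j). bs ! i \<bullet> cs ! j)"
  have "Matrix.mat ?r ?r (\<lambda>(i, j). bs' ! i \<bullet> cs ! j) = M * ?A"
  proof (rule eq_matI)
    fix i j assume "i < dim_row (M * ?A)" "j < dim_col (M * ?A)"
    then have ij: "i < ?r" "j < ?r" using M by auto
    have "(M * ?A) $$ (i, j) = (\<Sum>l = 0..<?r. M $$ (i, l) * (bs ! l \<bullet> cs ! j))"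
      using ij M by (simp add: scalar_prod_def)
    also have "\<dots> = bs' ! i \<bullet> cs ! j"
      unfolding eq[OF ij(1)] inner_sum_left by (simp add: atLeast0LessThan)
    finally show "Matrix.mat ?r ?r (\<lambda>(i, j). bs' ! i \<bullet> cs ! j) $$ (i, j) = (M * ?A) $$ (i, j)"
      using ij by simp
  qed (use M in auto)
  then show ?thesis unfolding odet_def using det_mult[OF M, of ?A] by simp
qed

text \<open>Laplace expansion along the first row: the row is linear in x and the cofactors do not
  see it, so the zero vector can serve as a placeholder in them.\<close>

lemma odet_Cons:
  "\<exists>v. \<forall>x. odet (x # bs) cs = x \<bullet> v" if cs: "cs \<noteq> []"
proof -
  let ?r = "length cs"
  let ?A = "\<lambda>x. Matrix.mat ?r ?r (\<lambda>(i, j). (x # bs) ! i \<bullet> cs ! j)"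
  have "odet (x # bs) cs = x \<bullet> (\<Sum>j<?r. cofactor (?A 0) 0 j *\<^sub>R cs ! j)" for x
  proof -
    have del: "mat_delete (?A x) 0 j = mat_delete (?A 0) 0 j" for j
      unfolding mat_delete_def by (rule eq_matI) auto
    have "odet (x # bs) cs = (\<Sum>j<?r. ?A x $$ (0, j) * cofactor (?A x) 0 j)"
      unfolding odet_def by (rule laplace_expansion_row) (use cs in auto)
    also have "\<dots> = (\<Sum>j<?r. (x \<bullet> cs ! j) * cofactor (?A 0) 0 j)"
      by (rule sum.cong) (use cs in \<open>auto simp: cofactor_def del\<close>)
    finally show ?thesis by (simp add: inner_sum_right mult.commute)
  qed
  then show ?thesis by blast
qed

lemma odet_repeat:
  assumes "b \<in> set bs" "length cs = Suc (length bs)"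
  shows "odet (b # bs) cs = 0"
proof -
  obtain i where i: "i < length bs" "bs ! i = b" using assms(1) by (metis in_set_conv_nth)
  show ?thesis unfolding odet_def
  proof (rule det_identical_rows[of _ "length cs" 0 "Suc i"])
    show "Matrix.row (Matrix.mat (length cs) (length cs) (\<lambda>(i, j). (b # bs) ! i \<bullet> cs ! j)) 0 =
      Matrix.row (Matrix.mat (length cs) (length cs) (\<lambda>(i, j). (b # bs) ! i \<bullet> cs ! j)) (Suc i)"
      using i assms(2) by (intro eq_vecI) auto
  qed (use i assms(2) in auto)
qed

text \<open>Repeated rows make the functional vanish on the span of the other vectors. The
  determinant thus depends on the first vector only modulo that span, which frees incidence numbers
  from the choice of outward vector.\<close>

lemma odet_Cons_functional:
  assumes "length cs = Suc (length bs)"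
  obtains v where "\<And>x. odet (x # bs) cs = x \<bullet> v" "\<And>x. x \<in> span (set bs) \<Longrightarrow> x \<bullet> v = 0"
proof -
  have "cs \<noteq> []" using assms by auto
  from odet_Cons[OF this, of bs] obtain v where v: "\<And>x. odet (x # bs) cs = x \<bullet> v" by blast
  have "set bs \<subseteq> {x. x \<bullet> v = 0}" using odet_repeat[OF _ assms] v by auto
  moreover have "subspace {x. x \<bullet> v = 0}" by (simp add: subspace_def inner_add_left)
  ultimately have "span (set bs) \<subseteq> {x. x \<bullet> v = 0}" by (rule span_minimal)
  then show thesis using that[OF v] by blast
qed

lemma odet_commute:
  assumes "length bs = length cs"
  shows "odet bs cs = odet cs bs"
proof -
  let ?A = "Matrix.mat (length cs) (length cs) (\<lambda>(i, j). bs ! i \<bullet> cs ! j)"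
  have "transpose_mat ?A = Matrix.mat (length bs) (length bs) (\<lambda>(i, j). cs ! i \<bullet> bs ! j)"
    by (rule eq_matI) (use assms in \<open>auto simp: inner_commute\<close>)
  then show ?thesis unfolding odet_def using det_transpose[of ?A "length cs"] by simp
qed

lemma odet_Cons_orthogonal:
  assumes "length bs = length cs" and orth: "\<And>c. c \<in> set cs \<Longrightarrow> x \<bullet> c = 0"
  shows "odet (x # bs) (y # cs) = (x \<bullet> y) * odet bs cs"
proof -
  let ?r = "Suc (length cs)"
  let ?A = "Matrix.mat ?r ?r (\<lambda>(i, j). (x # bs) ! i \<bullet> (y # cs) ! j)"
  have "odet (x # bs) (y # cs) = (\<Sum>j<?r. ?A $$ (0, j) * cofactor ?A 0 j)"
    unfolding odet_def list.size(4) add_Suc_right add_0_right by (rule laplace_expansion_row) auto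
  also have "\<dots> = ?A $$ (0, 0) * cofactor ?A 0 0 + (\<Sum>j<length cs. ?A $$ (0, Suc j) * cofactor ?A 0 (Suc j))"
    by (rule sum.lessThan_Suc_shift)
  also have "(\<Sum>j<length cs. ?A $$ (0, Suc j) * cofactor ?A 0 (Suc j)) = 0"
    by (rule sum.neutral) (use orth in auto)
  also have "mat_delete ?A 0 0 = Matrix.mat (length cs) (length cs) (\<lambda>(i, j). bs ! i \<bullet> cs ! j)"
    unfolding mat_delete_def by (rule eq_matI) auto
  then have "cofactor ?A 0 0 = odet bs cs" unfolding cofactor_def odet_def by simp
  finally show ?thesis by simp
qed

text \<open>Gram determinant by orthogonalization: the first vector is replaced by its component
  orthogonal to the others, in the rows by \<open>odet_Cons_functional\<close> and in the columns by
  symmetry, after which a factor x \<bullet> x splits off.\<close>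

lemma odet_self_pos: "distinct bs \<Longrightarrow> independent (set bs) \<Longrightarrow> 0 < odet bs bs"
proof (induction bs)
  case Nil
  then show ?case by (simp add: odet_def det_def)
next
  case (Cons b bs)
  have ind: "independent (set bs)" using Cons.prems(2) by (simp add: independent_insert split: if_splits)
  have nb: "b \<notin> span (set bs)" using Cons.prems by (simp add: independent_insert)
  obtain p x where p: "p \<in> span (set bs)" "\<And>u. u \<in> span (set bs) \<Longrightarrow> x \<bullet> u = 0" "b = p + x"
    using orthogonal_subspace_decomp_exists[of "set bs" b] unfolding real_inner_class.orthogonal_def by metis
  have replace: "odet (b # bs) cs = odet (x # bs) cs" if l: "length cs = Suc (length bs)" for cs
  proof -
    obtain v where "\<And>x. odet (x # bs) cs = x \<bullet> v" "\<And>x. x \<in> span (set bs) \<Longrightarrow> x \<bullet> v = 0"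
      using odet_Cons_functional[OF l] by blast
    then show ?thesis using p(1,3) by (simp add: inner_add_left)
  qed
  have "odet (b # bs) (b # bs) = odet (x # bs) (b # bs)" by (rule replace) simp
  also have "\<dots> = odet (b # bs) (x # bs)" by (rule odet_commute) simp
  also have "\<dots> = odet (x # bs) (x # bs)" by (rule replace) simp
  also have "\<dots> = (x \<bullet> x) * odet bs bs"
    by (rule odet_Cons_orthogonal) (use p(2) span_base in auto)
  finally have "odet (b # bs) (b # bs) = (x \<bullet> x) * odet bs bs" .
  moreover have "x \<noteq> 0" using nb p(1,3) by auto
  ultimately show ?case using Cons.IH Cons.prems(1) ind by simp
qed

lemma matrix_of_span:
  assumes bs: "distinct bs" and sub: "\<And>v. v \<in> set vs \<Longrightarrow> v \<in> span (set bs)"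
  shows "\<exists>M \<in> carrier_mat (length vs) (length bs). \<forall>i<length vs. vs ! i = (\<Sum>l<length bs. (M $$ (i, l)) *\<^sub>R bs ! l)"
proof -
  have "\<exists>u. v = (\<Sum>b\<in>set bs. u b *\<^sub>R b)" if "v \<in> set vs" for v
    using sub[OF that] unfolding span_finite[OF finite_set] by blast
  then obtain u where u: "\<And>v. v \<in> set vs \<Longrightarrow> v = (\<Sum>b\<in>set bs. u v b *\<^sub>R b)" by metis
  let ?M = "Matrix.mat (length vs) (length bs) (\<lambda>(i, l). u (vs ! i) (bs ! l))"
  have "vs ! i = (\<Sum>l<length bs. (?M $$ (i, l)) *\<^sub>R bs ! l)" if i: "i < length vs" for i
  proof -
    have "vs ! i = (\<Sum>b\<in>set bs. u (vs ! i) b *\<^sub>R b)" by (rule u) (use i in simp)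
    also have "\<dots> = (\<Sum>l<length bs. u (vs ! i) (bs ! l) *\<^sub>R bs ! l)"
      using bij_betw_nth[OF bs, of "{..<length bs}" "set bs"] by (intro sum.reindex_bij_betw[symmetric]) auto
    finally show ?thesis using i by simp
  qed
  then show ?thesis by (intro bexI[of _ ?M]) auto
qed

text \<open>Top-degree alternating forms on a space are proportional.\<close>

lemma odet_proportional:
  assumes bs: "distinct bs" "independent (set bs)" and vs: "length vs = length bs"
    "\<And>v. v \<in> set vs \<Longrightarrow> v \<in> span (set bs)" and cs: "length cs = Suc (length bs)"
  shows "sgn (odet (x # vs) cs) = sgn (odet vs bs) * sgn (odet (x # bs) cs)"
proof -
  let ?r = "length bs"
  obtain M where M: "M \<in> carrier_mat ?r ?r"
    "\<And>i. i < ?r \<Longrightarrow> vs ! i = (\<Sum>l<?r. (M $$ (i, l)) *\<^sub>R bs ! l)"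
    using matrix_of_span[of bs vs, OF bs(1) vs(2)] unfolding vs(1) by blast
  have 1: "odet vs bs = Determinant.det M * odet bs bs"
    by (rule odet_matrix_mult) (use M vs in auto)
  \<comment> \<open>The block matrix with a corner entry 1 and the block M: it fixes x and rewrites
    vs in terms of bs, so its determinant is that of M.\<close>
  let ?N = "Matrix.mat (Suc ?r) (Suc ?r) (\<lambda>(i, l). case i of 0 \<Rightarrow> if l = 0 then 1 else 0
      | Suc i \<Rightarrow> (case l of 0 \<Rightarrow> 0 | Suc l \<Rightarrow> M $$ (i, l)))"
  have "odet (x # vs) cs = Determinant.det ?N * odet (x # bs) cs"
  proof (rule odet_matrix_mult)
    fix i assume i: "i < length cs"
    show "(x # vs) ! i = (\<Sum>l<length cs. (?N $$ (i, l)) *\<^sub>R (x # bs) ! l)"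
    proof (cases i)
      case 0
      then show ?thesis unfolding cs by (simp add: sum.lessThan_Suc_shift del: sum.lessThan_Suc)
    next
      case (Suc i')
      then show ?thesis using i M(2)[of i'] unfolding cs by (simp add: sum.lessThan_Suc_shift del: sum.lessThan_Suc)
    qed
  qed (use vs cs in auto)
  moreover have "Determinant.det ?N = Determinant.det M"
  proof -
    have "Determinant.det ?N = (\<Sum>j<Suc ?r. ?N $$ (0, j) * cofactor ?N 0 j)"
      by (rule laplace_expansion_row) auto
    also have "\<dots> = ?N $$ (0, 0) * cofactor ?N 0 0 + (\<Sum>j<?r. ?N $$ (0, Suc j) * cofactor ?N 0 (Suc j))"
      by (rule sum.lessThan_Suc_shift)
    also have "\<dots> = cofactor ?N 0 0" by simp
    also have "mat_delete ?N 0 0 = M" unfolding mat_delete_def by (rule eq_matI) (use M(1) in auto)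
    then have "cofactor ?N 0 0 = Determinant.det M" unfolding cofactor_def by simp
    finally show ?thesis .
  qed
  ultimately show ?thesis using 1 odet_self_pos[OF bs] by (simp add: sgn_mult)
qed

lemma odet_swap:
  assumes "length cs = Suc (Suc (length bs))"
  shows "odet (x # y # bs) cs = - odet (y # x # bs) cs"
proof -
  let ?n = "length cs"
  let ?A = "Matrix.mat ?n ?n (\<lambda>(i, j). (y # x # bs) ! i \<bullet> cs ! j)"
  have "Matrix.mat ?n ?n (\<lambda>(i, j). (x # y # bs) ! i \<bullet> cs ! j) = swaprows 0 1 ?A"
    by (rule eq_matI) (use assms in \<open>auto simp: nth_Cons split: nat.splits\<close>)
  then show ?thesis unfolding odet_def using det_swaprows[of 0 ?n 1 ?A] assms by simp
qed

section \<open>Outward vectors and incidence signs\<close>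

definition outward :: "'v::euclidean_space set \<Rightarrow> 'v set \<Rightarrow> 'v \<Rightarrow> bool" where
  "outward H G u \<longleftrightarrow> (\<exists>x\<in>G. \<exists>y\<in>H - G. u = x - y)"

definition direction_basis :: "'v::euclidean_space list \<Rightarrow> 'v set \<Rightarrow> bool" where
  "direction_basis bs H \<longleftrightarrow> distinct bs \<and> independent (set bs) \<and> span (set bs) = span (directions H)"

lemma length_direction_basis:
  assumes "direction_basis bs H" "H \<noteq> {}"
  shows "int (length bs) = aff_dim H"
proof -
  have "length bs = dim (set bs)"
    using assms(1) dim_eq_card_independent distinct_card unfolding direction_basis_def by metis
  also have "\<dots> = dim (directions H)" using assms(1) dim_span unfolding direction_basis_def by metis
  finally show ?thesis using aff_dim_directions[OF assms(2)] by simp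
qed

text \<open>Let a be a functional exposing \<open>G\<close> in \<open>H\<close>. Outward vectors
  have positive a-value, and by a dimension count the directions of \<open>G\<close> are the kernel
  of a among those of \<open>H\<close>. Two outward vectors therefore agree modulo this kernel up to
  the ratio of their a-values.\<close>

lemma outward_proportional:
  assumes H: "polytope H" and F: "G facet_of H" and o1: "outward H G u" and o2: "outward H G v"
  shows "\<exists>l>0. v - l *\<^sub>R u \<in> span (directions G)" "u \<notin> span (directions G)" "u \<in> span (directions H)"
proof -
  have face: "G face_of H" and G: "G \<noteq> {}" and dim: "aff_dim G = aff_dim H - 1"
    using F unfolding facet_of_def by auto
  have GH: "G \<subseteq> H" by (rule face_of_imp_subset[OF face])
  have "G exposed_face_of H"
    using exposed_face_of_polyhedron[OF polytope_imp_polyhedron[OF H]] face by blast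
  then obtain a b where ab: "H \<subseteq> {x. a \<bullet> x \<le> b}" "G = H \<inter> {x. a \<bullet> x = b}"
    unfolding exposed_face_of_def by blast
  have apos: "0 < a \<bullet> u" if u: "outward H G u" for u
  proof -
    obtain x y where "x \<in> G" "y \<in> H - G" "u = x - y" using u unfolding outward_def by blast
    moreover from this have "a \<bullet> x = b" "a \<bullet> y < b" using ab by (auto simp: order_less_le)
    ultimately show ?thesis by (simp add: inner_diff_right)
  qed
  have inH: "u \<in> span (directions H)" if "outward H G u" for u
    using that GH unfolding outward_def directions_def by (intro span_base) blast
  have sub: "span (directions G) \<subseteq> span (directions H) \<inter> {x. a \<bullet> x = 0}"
  proof
    fix x assume x: "x \<in> span (directions G)"
    have "directions G \<subseteq> directions H" using GH unfolding directions_def by blast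
    then have "x \<in> span (directions H)" using x span_mono by blast
    moreover have "directions G \<subseteq> {x. a \<bullet> x = 0}" using ab(2) unfolding directions_def by (auto simp: inner_diff_right)
    then have "a \<bullet> x = 0" using span_minimal[OF _ subspace_hyperplane] x by blast
    ultimately show "x \<in> span (directions H) \<inter> {x. a \<bullet> x = 0}" by blast
  qed
  have Hne: "H \<noteq> {}" using G GH by blast
  have dims: "dim (span (directions H)) = dim (span (directions G)) + 1"
    using dim aff_dim_directions[OF G] aff_dim_directions[OF Hne] by simp
  have sp: "subspace (span (directions H) \<inter> {x. a \<bullet> x = 0})"
    by (intro subspace_inter subspace_span subspace_hyperplane)
  have "span (directions H) \<inter> {x. a \<bullet> x = 0} \<noteq> span (directions H)"
    using inH[OF o1] apos[OF o1] by force
  then have "dim (span (directions H) \<inter> {x. a \<bullet> x = 0}) < dim (span (directions H))"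
    using subspace_dim_equal[OF sp subspace_span] dim_subset[of "span (directions H) \<inter> {x. a \<bullet> x = 0}" "span (directions H)"]
    by fastforce
  then have eq: "span (directions G) = span (directions H) \<inter> {x. a \<bullet> x = 0}"
    by (intro subspace_dim_equal[OF subspace_span sp sub]) (use dims in simp)
  show "u \<in> span (directions H)" by (rule inH[OF o1])
  show "u \<notin> span (directions G)" unfolding eq using apos[OF o1] by simp
  let ?l = "(a \<bullet> v) / (a \<bullet> u)"
  have "0 < ?l" using apos o1 o2 by simp
  moreover have "v - ?l *\<^sub>R u \<in> span (directions G)" unfolding eq
    using inH[OF o1] inH[OF o2] apos[OF o1] by (auto intro!: span_diff span_scale simp: inner_diff_right)
  ultimately show "\<exists>l>0. v - l *\<^sub>R u \<in> span (directions G)" by blast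
qed

lemma outward_ex:
  assumes "G facet_of H"
  shows "outward H G ((SOME x. x \<in> G) - (SOME y. y \<in> H - G))"
proof -
  have "G \<noteq> {}" "G \<subseteq> H" "aff_dim G \<noteq> aff_dim H"
    using assms face_of_imp_subset unfolding facet_of_def by auto
  then have "G \<noteq> {}" "H - G \<noteq> {}" by auto
  then show ?thesis unfolding outward_def by (metis some_in_eq)
qed

text \<open>Positive factors and changes along \<open>G\<close> do not affect the sign of the
  determinant as a function of its first vector, so the arbitrary choices in
  \<open>incidence\<close> may be replaced by any outward vector.\<close>

lemma facet_orientation:
  assumes H: "polytope H" and F: "G facet_of H" and u: "outward H G u"
    and bH: "direction_basis (ori H) H" and bG: "direction_basis (ori G) G"
  shows "incidence ori H G = relative_orientation (u # ori G) (ori H)"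
    and "odet (u # ori G) (ori H) \<noteq> 0" and "length (ori H) = Suc (length (ori G))"
proof -
  have G: "G \<noteq> {}" and dim: "aff_dim G = aff_dim H - 1" and "H \<noteq> {}"
    using F face_of_imp_subset unfolding facet_of_def by auto
  then show len: "length (ori H) = Suc (length (ori G))"
    using length_direction_basis[OF bH] length_direction_basis[OF bG] by simp
  have spG: "span (set (ori G)) = span (directions G)" and spH: "span (set (ori H)) = span (directions H)"
    using bG bH unfolding direction_basis_def by auto
  obtain f where f: "\<And>x. odet (x # ori G) (ori H) = x \<bullet> f" "\<And>x. x \<in> span (set (ori G)) \<Longrightarrow> x \<bullet> f = 0"
    using odet_Cons_functional[OF len] by blast
  let ?v = "(SOME x. x \<in> G) - (SOME y. y \<in> H - G)"
  obtain l where l: "l > 0" "?v - l *\<^sub>R u \<in> span (directions G)"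
    using outward_proportional(1)[OF H F u outward_ex[OF F]] by blast
  have "?v \<bullet> f = l * (u \<bullet> f)" using f(2)[of "?v - l *\<^sub>R u"] l(2) spG by (simp add: inner_diff_left)
  then have "real_of_int (incidence ori H G) = real_of_int (relative_orientation (u # ori G) (ori H))"
    unfolding incidence_def relative_orientation_sgn f(1) using l(1) by (simp add: sgn_mult)
  then show "incidence ori H G = relative_orientation (u # ori G) (ori H)" by simp
  show "odet (u # ori G) (ori H) \<noteq> 0"
  proof -
    \<comment> \<open>An outward vector followed by a basis for \<open>G\<close> is a basis for
      \<open>H\<close>, in which \<open>ori H\<close> can be expanded; so the determinant divides a
      positive Gram determinant.\<close>
    have nu: "u \<notin> span (set (ori G))" "u \<in> span (set (ori H))"
      using outward_proportional(2,3)[OF H F u u] spG spH by auto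
    then have dist: "distinct (u # ori G)" using bG span_base unfolding direction_basis_def by auto
    have ind: "independent (set (u # ori G))"
      using nu(1) bG unfolding direction_basis_def by (simp add: independent_insert)
    have "directions G \<subseteq> directions H" using F face_of_imp_subset unfolding facet_of_def directions_def by blast
    then have "span (set (ori G)) \<subseteq> span (set (ori H))" unfolding spG spH by (rule span_mono)
    then have "set (u # ori G) \<subseteq> span (set (ori H))"
      using nu(2) span_base[of _ "set (ori G)"] by auto
    moreover have "card (set (u # ori G)) = card (set (ori H))"
      using distinct_card[OF dist] distinct_card[of "ori H"] bH len unfolding direction_basis_def by simp
    ultimately have "span (set (ori H)) \<subseteq> span (set (u # ori G))"
      using card_eq_dim[of "set (u # ori G)" "span (set (ori H))"] ind
        dim_eq_card_independent[of "set (ori H)"] bH span_superset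
      unfolding direction_basis_def by (metis List.finite_set dim_span order_refl subset_trans)
    then obtain M where M: "M \<in> carrier_mat (length (ori H)) (length (ori H))"
      "\<And>i. i < length (ori H) \<Longrightarrow> ori H ! i = (\<Sum>l<length (ori H). (M $$ (i, l)) *\<^sub>R (u # ori G) ! l)"
      using matrix_of_span[OF dist, of "ori H"] span_base len by (metis length_Cons subsetD)
    have "odet (ori H) (ori H) = Determinant.det M * odet (u # ori G) (ori H)"
      by (rule odet_matrix_mult) (use M len in auto)
    moreover have "0 < odet (ori H) (ori H)" using bH odet_self_pos unfolding direction_basis_def by blast
    ultimately show ?thesis by auto
  qed
qed

lemma incidence_nonzero:
  assumes "polytope H" "G facet_of H" "direction_basis (ori H) H" "direction_basis (ori G) G"
  shows "incidence ori H G = 1 \<or> incidence ori H G = - 1"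
proof -
  note fo = facet_orientation[OF assms(1,2) outward_ex[OF assms(2)] assms(3,4)]
  have "real_of_int (incidence ori H G) = 1 \<or> real_of_int (incidence ori H G) = - 1"
    unfolding fo(1) relative_orientation_sgn using fo(2) by (auto simp: sgn_if)
  then show ?thesis by linarith
qed

text \<open>A vector pointing out of \<open>J\<^sub>1\<close> through \<open>K\<close> also points out of \<open>H\<close> through \<open>J\<^sub>2\<close>,
  so the two products compare the frames \<open>(u\<^sub>2, u\<^sub>1, ori K)\<close> and \<open>(u\<^sub>1, u\<^sub>2, ori K)\<close> with \<open>ori H\<close>.\<close>

lemma incidence_diamond:
  assumes H: "polytope H" and J: "J1 facet_of H" "J2 facet_of H" and K: "K facet_of J1" "K facet_of J2"
    and int: "J1 \<inter> J2 = K"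
    and b: "direction_basis (ori H) H" "direction_basis (ori J1) J1" "direction_basis (ori J2) J2"
      "direction_basis (ori K) K"
  shows "incidence ori H J1 * incidence ori J1 K + incidence ori H J2 * incidence ori J2 K = 0"
proof -
  have J12: "J1 \<subseteq> H" "J2 \<subseteq> H" "polytope J1" "polytope J2"
    using J face_of_imp_subset face_of_polytope_polytope[OF H] unfolding facet_of_def by auto
  obtain u1 u2 where u: "outward J1 K u1" "outward J2 K u2" using outward_ex[OF K(1)] outward_ex[OF K(2)] by blast
  \<comment> \<open>A point of \<open>J1\<close> outside \<open>K\<close> is outside
    \<open>J2\<close>, because the two facets meet exactly in \<open>K\<close>.\<close>
  have u': "outward H J2 u1" "outward H J1 u2" using u J12 int unfolding outward_def by blast+
  note o1 = facet_orientation[OF H J(1) u'(2) b(1,2)] facet_orientation[OF J12(3) K(1) u(1) b(2,4)]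
  note o2 = facet_orientation[OF H J(2) u'(1) b(1,3)] facet_orientation[OF J12(4) K(2) u(2) b(3,4)]
  have signs: "sgn (odet (v # u # ori K) (ori H)) = sgn (odet (u # ori K) (ori J)) * sgn (odet (v # ori J) (ori H))"
    if "polytope J" and "K facet_of J" and "outward J K u" and "direction_basis (ori J) J"
      and "length (ori H) = Suc (length (ori J))" and "length (ori J) = Suc (length (ori K))" for J u v
  proof (rule odet_proportional)
    show "distinct (ori J)" "independent (set (ori J))" using that(4) unfolding direction_basis_def by auto
    show "x \<in> span (set (ori J))" if "x \<in> set (u # ori K)" for x
    proof -
      have "directions K \<subseteq> directions J"
        using \<open>K facet_of J\<close> face_of_imp_subset unfolding facet_of_def directions_def by blast
      then have "span (set (ori K)) \<subseteq> span (set (ori J))"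
        using b(4) \<open>direction_basis (ori J) J\<close> span_mono unfolding direction_basis_def by metis
      moreover have "u \<in> span (set (ori J))"
        using outward_proportional(3)[OF \<open>polytope J\<close> \<open>K facet_of J\<close> \<open>outward J K u\<close> \<open>outward J K u\<close>]
          \<open>direction_basis (ori J) J\<close> unfolding direction_basis_def by metis
      ultimately show ?thesis using \<open>x \<in> set (u # ori K)\<close> span_base by auto
    qed
  qed (use that in auto)
  have "real_of_int (incidence ori H J1 * incidence ori J1 K + incidence ori H J2 * incidence ori J2 K)
    = sgn (odet (u2 # u1 # ori K) (ori H)) + sgn (odet (u1 # u2 # ori K) (ori H))"
    unfolding of_int_add of_int_mult o1(1,4) o2(1,4) relative_orientation_sgn
    using signs[OF J12(3) K(1) u(1) b(2) o1(3,6), of u2] signs[OF J12(4) K(2) u(2) b(3) o2(3,6), of u1]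
    by (simp add: mult.commute)
  also have "\<dots> = 0" using odet_swap[of "ori H" "ori K" u2 u1] o1(3,6) by (simp add: sgn_minus)
  finally show ?thesis by linarith
qed

text \<open>Points have empty orientation lists, so both signs are those of one linear functional at
  the opposite vectors \<open>v1 - v2\<close> and \<open>v2 - v1\<close>.\<close>

lemma incidence_edge:
  assumes H: "polytope H" and G: "{v1} facet_of H" "{v2} facet_of H" "v1 \<noteq> v2"
    and b: "direction_basis (ori H) H" "direction_basis (ori {v1}) {v1}" "direction_basis (ori {v2}) {v2}"
  shows "incidence ori H {v1} + incidence ori H {v2} = 0"
proof -
  have v: "v1 \<in> H" "v2 \<in> H" using G face_of_imp_subset unfolding facet_of_def by auto
  have out: "outward H {v1} (v1 - v2)" "outward H {v2} (v2 - v1)" unfolding outward_def using v G(3) by auto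
  have nil: "ori {v1} = []" "ori {v2} = []"
    using length_direction_basis[OF b(2)] length_direction_basis[OF b(3)] by auto
  note o1 = facet_orientation[OF H G(1) out(1) b(1,2)] and o2 = facet_orientation[OF H G(2) out(2) b(1,3)]
  obtain f where f: "\<And>x. odet [x] (ori H) = x \<bullet> f" using odet_Cons_functional[of "ori H" "[]"] o1(3) nil by auto
  have "real_of_int (incidence ori H {v1} + incidence ori H {v2}) = sgn ((v1 - v2) \<bullet> f) + sgn ((v2 - v1) \<bullet> f)"
    unfolding of_int_add o1(1) o2(1) relative_orientation_sgn nil f ..
  also have "(v2 - v1) \<bullet> f = - ((v1 - v2) \<bullet> f)" by (simp add: inner_diff_left)
  finally show ?thesis by (simp add: sgn_minus)
qed

section \<open>Acyclic matchings\<close>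

text \<open>A discrete Morse matching with the single critical cell v; \<open>Lo\<close> holds the
  lower partners and \<open>up\<close> sends them to the upper ones. The rank drops from a to any
  other lower partner that is a facet of \<open>up a\<close>, which excludes closed gradient paths
  and also forces \<open>up\<close> to be injective on \<open>Lo\<close>.\<close>

definition acyclic_matching :: "('c \<Rightarrow> 'c \<Rightarrow> bool) \<Rightarrow> 'c set \<Rightarrow> 'c \<Rightarrow> 'c set \<Rightarrow> ('c \<Rightarrow> 'c) \<Rightarrow> ('c \<Rightarrow> nat) \<Rightarrow> bool" where
  "acyclic_matching facet X v Lo up r \<longleftrightarrow>
     v \<in> X \<and> v \<notin> Lo \<and> Lo \<subseteq> X \<and> up ` Lo \<subseteq> X \<and> X \<subseteq> insert v (Lo \<union> up ` Lo) \<and>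
     (\<forall>a\<in>Lo. facet a (up a)) \<and>
     (\<forall>a\<in>Lo. \<forall>a'\<in>Lo. a' \<noteq> a \<and> facet a' (up a) \<longrightarrow> r a' < r a)"

definition block :: "('n \<Rightarrow> 'd set) set \<Rightarrow> 'n set \<Rightarrow> ('n \<Rightarrow> 'd set) \<Rightarrow> ('n \<Rightarrow> 'd set) set" where
  "block C R I = {J \<in> C. \<forall>j\<in>R. J j = I j}"

text \<open>
  The rows outside \<open>R\<close> are matched one at a time. The blocks with prescribed row \<open>j\<close> are matched
  inductively, each leaving one cell; the values of row \<open>j\<close> are all nonempty subsets of a set
  containing \<open>\<kappa>\<close>, and the remaining cells are matched by inserting \<open>\<kappa>\<close> into row \<open>j\<close>.
\<close>

lemma acyclic_matching_block:
  fixes C :: "('n::finite \<Rightarrow> 'd::finite set) set"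
  assumes ne: "\<And>I j. I \<in> C \<Longrightarrow> I j \<noteq> {}"
    and down: "\<And>I J. I \<in> C \<Longrightarrow> (\<And>j. J j \<noteq> {}) \<Longrightarrow> (\<And>j. J j \<subseteq> I j) \<Longrightarrow> J \<in> C"
    and join: "\<And>I J j. I \<in> C \<Longrightarrow> J \<in> C \<Longrightarrow> \<exists>K\<in>C. K j = I j \<union> J j \<and> (\<forall>i. I i = J i \<longrightarrow> K i = I i)"
  shows "I0 \<in> C \<Longrightarrow> (\<And>j. j \<notin> R \<Longrightarrow> \<exists>k. I0 j = {k}) \<Longrightarrow>
    \<exists>Lo up r. acyclic_matching cell_facet (block C R I0) I0 Lo up r"
proof (induction "card (- R)" arbitrary: R I0)
  case 0
  then have "R = UNIV" by auto
  then have "block C R I0 = {I0}" using 0 unfolding block_def by auto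
  then have "acyclic_matching cell_facet (block C R I0) I0 {} id (\<lambda>_. 0)"
    unfolding acyclic_matching_def by simp
  then show ?case by blast
next
  case (Suc n)
  have "- R \<noteq> {}" using Suc.hyps(2) by force
  then obtain j where j: "j \<notin> R" by blast
  obtain \<kappa> where \<kappa>: "I0 j = {\<kappa>}" using Suc.prems(2)[OF j] by blast
  have cardR: "n = card (- insert j R)"
  proof -
    have "- insert j R = (- R) - {j}" by auto
    then show ?thesis using Suc.hyps(2) j by simp
  qed
  have I0: "I0 \<in> block C R I0" using Suc.prems(1) by (simp add: block_def)
  \<comment> \<open>A cell of the block whose row j is as large as possible; by joins it contains
    row j of every other cell of the block.\<close>
  obtain M where M: "M \<in> block C R I0" "\<And>I. I \<in> block C R I0 \<Longrightarrow> card (I j) \<le> card (M j)"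
    using finite_has_maximal[of "(\<lambda>I. card (I j)) ` block C R I0"] I0
      arg_max_nat_lemma[of "\<lambda>I. I \<in> block C R I0" I0 "\<lambda>I. card (I j)" "Suc CARD('d)"]
    by (metis card_mono finite_code le_imp_less_Suc top_greatest)
  have MC: "M \<in> C" "\<And>i. i \<in> R \<Longrightarrow> M i = I0 i" using M(1) by (auto simp: block_def)
  have sub: "I j \<subseteq> M j" if I: "I \<in> block C R I0" for I
  proof -
    obtain K where K: "K \<in> C" "K j = M j \<union> I j" "\<And>i. M i = I i \<Longrightarrow> K i = M i"
      using join[OF MC(1), of I j] I by (auto simp: block_def)
    then have "K \<in> block C R I0" using MC I by (auto simp: block_def)
    then have "card (M j \<union> I j) \<le> card (M j)" using M(2) K(2) by metis
    then have "M j = M j \<union> I j" by (intro card_seteq) auto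
    then show ?thesis by blast
  qed
  define c where "c i = (SOME k. k \<in> M i)" for i
  have c: "c i \<in> M i" for i unfolding c_def using ne[OF MC(1), of i] by (simp add: some_in_eq)
  \<comment> \<open>The critical cell intended for the block with row j equal to L. For L =
    {\<kappa>} it is the prescribed \<open>I0\<close>, so that \<open>I0\<close> is what remains in
    the end; otherwise the free rows are shrunk to single elements of \<open>M\<close>.\<close>
  define D where "D L = (if L = {\<kappa>} then I0 else (\<lambda>i. if i \<in> R then I0 i else if i = j then L else {c i}))" for L
  have Dj: "D L j = L" for L unfolding D_def using j \<kappa> by auto
  have DR: "i \<in> R \<Longrightarrow> D L i = I0 i" for i L unfolding D_def by auto
  have Ds: "\<exists>k. D L i = {k}" if "i \<notin> insert j R" for L i
    unfolding D_def using that Suc.prems(2)[of i] by auto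
  have DC: "D L \<in> C" if L: "L \<noteq> {}" "L \<subseteq> M j" for L
  proof (cases "L = {\<kappa>}")
    case True
    then show ?thesis using Suc.prems(1) by (simp add: D_def)
  next
    case False
    show ?thesis
    proof (rule down[OF MC(1)])
      show "D L i \<noteq> {}" for i unfolding D_def using False L ne[OF Suc.prems(1)] by auto
      show "D L i \<subseteq> M i" for i unfolding D_def using False L c MC(2) by auto
    qed
  qed
  have "\<exists>Lo up r. acyclic_matching cell_facet (block C (insert j R) (D L)) (D L) Lo up r"
    if "L \<noteq> {}" "L \<subseteq> M j" for L
    by (rule Suc.hyps(1)[OF cardR DC[OF that] Ds])
  then obtain Lo up r where match: "\<And>L. L \<noteq> {} \<Longrightarrow> L \<subseteq> M j \<Longrightarrow>
      acyclic_matching cell_facet (block C (insert j R) (D L)) (D L) (Lo L) (up L) (r L)" by metis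
  have blk: "I \<in> block C (insert j R) (D L) \<longleftrightarrow> I \<in> block C R I0 \<and> I j = L" for I L
    using DR Dj by (auto simp: block_def)
  have rows: "I j \<noteq> {} \<and> I j \<subseteq> M j" if "I \<in> block C R I0" for I
    using sub[OF that] that ne by (auto simp: block_def)
  have LoD: "D L \<notin> Lo L" and LoS: "Lo L \<subseteq> block C (insert j R) (D L)"
    and upS: "up L ` Lo L \<subseteq> block C (insert j R) (D L)"
    and cov: "block C (insert j R) (D L) \<subseteq> insert (D L) (Lo L \<union> up L ` Lo L)"
    and fac: "\<And>a. a \<in> Lo L \<Longrightarrow> cell_facet a (up L a)"
    and rk: "\<And>a a'. a \<in> Lo L \<Longrightarrow> a' \<in> Lo L \<Longrightarrow> a' \<noteq> a \<Longrightarrow> cell_facet a' (up L a) \<Longrightarrow> r L a' < r L a"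
    if L: "L \<noteq> {}" "L \<subseteq> M j" for L
    using match[OF L] unfolding acyclic_matching_def by (elim conjE, simp)+
  have Dblk: "D L \<in> block C R I0" if L: "L \<noteq> {}" "L \<subseteq> M j" for L
    using DC[OF L] DR by (simp add: block_def)
  have \<kappa>M: "\<kappa> \<in> M j" using rows[OF I0] \<kappa> by simp
  define Lo' where "Lo' = {a \<in> block C R I0. a \<in> Lo (a j)} \<union> {D L | L. L \<noteq> {} \<and> L \<subseteq> M j \<and> \<kappa> \<notin> L}"
  define up' where "up' a = (if a \<in> Lo (a j) then up (a j) a else D (insert \<kappa> (a j)))" for a
  \<comment> \<open>A strict bound on inner ranks, so that \<open>r'\<close> compares
    \<open>g\<close> first and the inner rank second. Cells left over by the inner matchings get
    inner rank 0, below all matched lower partners.\<close>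
  define N where "N = Suc (Suc (Max (range (\<lambda>(L, a). r L a))))"
  define inner_rank where "inner_rank a = (if a \<in> Lo (a j) then Suc (r (a j) a) else 0)" for a
  \<comment> \<open>Deleting an element of row j lowers the first summand by 2, which outweighs the
    indicator. For a leftover \<open>D L\<close>, another lower partner below its upper partner has
    a row j of the same size containing \<kappa>, and the indicator drops.\<close>
  define g where "g a = 2 * card (a j) + of_bool (\<kappa> \<notin> a j)" for a :: "'n \<Rightarrow> 'd set"
  define r' where "r' a = g a * N + inner_rank a" for a
  have innerN: "inner_rank a < N" for a
  proof -
    have "r (a j) a \<le> Max (range (\<lambda>(L, a). r L a))" by (rule Max_ge) (auto intro: rev_image_eqI[of "(a j, a)"])
    then show ?thesis unfolding inner_rank_def N_def by simp
  qed
  have gless: "r' a' < r' a" if "g a' < g a" for a a'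
  proof -
    have "r' a' < Suc (g a') * N" unfolding r'_def using innerN[of a'] by simp
    also have "\<dots> \<le> g a * N" using that by (intro mult_right_mono) auto
    also have "\<dots> \<le> r' a" unfolding r'_def by simp
    finally show ?thesis .
  qed
  have cases: "(a \<in> block C R I0 \<and> a \<in> Lo (a j)) \<or> (\<exists>L. a = D L \<and> L \<noteq> {} \<and> L \<subseteq> M j \<and> \<kappa> \<notin> L \<and> a \<notin> Lo (a j))"
    if "a \<in> Lo'" for a
  proof -
    from that consider "a \<in> block C R I0" "a \<in> Lo (a j)"
      | L where "a = D L" "L \<noteq> {}" "L \<subseteq> M j" "\<kappa> \<notin> L" unfolding Lo'_def by blast
    then show ?thesis
    proof cases
      case 2
      then have "a \<notin> Lo (a j)" using LoD[OF 2(2,3)] Dj by simp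
      then show ?thesis using 2 by blast
    qed simp
  qed
  have Dupd: "(D (insert \<kappa> L))(j := L) = D L" if "L \<noteq> {}" "\<kappa> \<notin> L" for L
  proof -
    have "L \<noteq> {\<kappa>}" "insert \<kappa> L \<noteq> {\<kappa>}" using that by auto
    then show ?thesis using j by (intro ext) (simp add: D_def)
  qed
  have upD: "up' (D L) = D (insert \<kappa> L)" if "L \<noteq> {}" "L \<subseteq> M j" for L
    unfolding up'_def using LoD[OF that] Dj by simp
  have "acyclic_matching cell_facet (block C R I0) I0 Lo' up' r'"
    unfolding acyclic_matching_def
  proof (intro conjI ballI impI)
    show "I0 \<in> block C R I0" by (rule I0)
    show "I0 \<notin> Lo'"
    proof
      assume "I0 \<in> Lo'"
      then have "I0 \<in> Lo {\<kappa>} \<or> (\<exists>L. I0 = D L \<and> \<kappa> \<notin> L)" using cases \<kappa> by metis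
      moreover have "I0 = D {\<kappa>}" by (simp add: D_def)
      ultimately show False using LoD[of "{\<kappa>}"] \<kappa>M Dj by (metis empty_not_insert insertI1 insert_subset empty_subsetI)
    qed
    show "Lo' \<subseteq> block C R I0" unfolding Lo'_def using Dblk by auto
    show "up' ` Lo' \<subseteq> block C R I0"
    proof
      fix b assume "b \<in> up' ` Lo'"
      then obtain a where a: "a \<in> Lo'" "b = up' a" by blast
      from cases[OF a(1)] show "b \<in> block C R I0"
      proof
        assume h: "a \<in> block C R I0 \<and> a \<in> Lo (a j)"
        then have "up (a j) a \<in> block C (insert j R) (D (a j))" using upS[of "a j"] rows by blast
        then show ?thesis using h a(2) blk unfolding up'_def by simp
      next
        assume "\<exists>L. a = D L \<and> L \<noteq> {} \<and> L \<subseteq> M j \<and> \<kappa> \<notin> L \<and> a \<notin> Lo (a j)"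
        then obtain L where L: "a = D L" "L \<noteq> {}" "L \<subseteq> M j" by blast
        show ?thesis unfolding a(2) L(1) upD[OF L(2,3)] using Dblk[of "insert \<kappa> L"] \<kappa>M L by simp
      qed
    qed
    show "block C R I0 \<subseteq> insert I0 (Lo' \<union> up' ` Lo')"
    proof
      fix I assume I: "I \<in> block C R I0"
      define L where "L = I j"
      have L: "L \<noteq> {}" "L \<subseteq> M j" using rows[OF I] unfolding L_def by auto
      have "I \<in> block C (insert j R) (D L)" using I by (simp add: blk L_def)
      then consider "I = D L" | "I \<in> Lo L" | a where "a \<in> Lo L" "I = up L a" using cov[OF L] by blast
      then show "I \<in> insert I0 (Lo' \<union> up' ` Lo')"
      proof cases
        case 1
        show ?thesis
        proof (cases "\<kappa> \<in> L")
          case False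
          then have "I \<in> Lo'" using 1 L unfolding Lo'_def by blast
          then show ?thesis by blast
        next
          case True
          show ?thesis
          proof (cases "L = {\<kappa>}")
            case True
            then show ?thesis using 1 by (simp add: D_def)
          next
            case False
            have L': "L - {\<kappa>} \<noteq> {}" "L - {\<kappa>} \<subseteq> M j" using False True L by auto
            have "D (L - {\<kappa>}) \<in> Lo'" using L' unfolding Lo'_def by blast
            moreover have "up' (D (L - {\<kappa>})) = I" unfolding upD[OF L'] 1 using True by (simp add: insert_absorb)
            ultimately show ?thesis by blast
          qed
        qed
      next
        case 2
        then have "I \<in> Lo'" using I unfolding Lo'_def L_def by blast
        then show ?thesis by blast
      next
        case 3
        have ab: "a \<in> block C R I0" "a j = L" using LoS[OF L] 3(1) blk by auto
        then have "a \<in> Lo'" "up' a = I" using 3 unfolding Lo'_def up'_def by auto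
        then show ?thesis by blast
      qed
    qed
    show "cell_facet a (up' a)" if "a \<in> Lo'" for a
      using cases[OF that]
    proof
      assume h: "a \<in> block C R I0 \<and> a \<in> Lo (a j)"
      then show ?thesis using fac[of "a j" a] rows unfolding up'_def by simp
    next
      assume "\<exists>L. a = D L \<and> L \<noteq> {} \<and> L \<subseteq> M j \<and> \<kappa> \<notin> L \<and> a \<notin> Lo (a j)"
      then obtain L where L: "a = D L" "L \<noteq> {}" "L \<subseteq> M j" "\<kappa> \<notin> L" by blast
      have "D L = (D (insert \<kappa> L))(j := D (insert \<kappa> L) j - {\<kappa>})"
        using Dupd[OF L(2,4)] L(4) unfolding Dj by simp
      moreover have "\<kappa> \<in> D (insert \<kappa> L) j" "D (insert \<kappa> L) j \<noteq> {\<kappa>}" unfolding Dj using L by auto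
      ultimately show ?thesis unfolding L(1) upD[OF L(2,3)] cell_facet_def by blast
    qed
    show "r' a' < r' a" if a: "a \<in> Lo'" and a': "a' \<in> Lo'" and h: "a' \<noteq> a \<and> cell_facet a' (up' a)" for a a'
    proof -
      obtain i k where ik: "k \<in> up' a i" "up' a i \<noteq> {k}" "a' = (up' a)(i := up' a i - {k})"
        using h unfolding cell_facet_def by blast
      have a'b: "a' \<in> block C R I0" using a' Dblk unfolding Lo'_def by auto
      from cases[OF a] show ?thesis
      proof
        assume h1: "a \<in> block C R I0 \<and> a \<in> Lo (a j)"
        let ?L = "a j"
        have L: "?L \<noteq> {}" "?L \<subseteq> M j" using rows h1 by auto
        have up: "up' a = up ?L a" using h1 by (simp add: up'_def)
        have upj: "up' a j = ?L" using upS[OF L] h1 blk unfolding up by blast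
        show ?thesis
        proof (cases "i = j")
          case True
          then have "a' j = ?L - {k}" "k \<in> ?L" using ik upj by auto
          then have "Suc (card (a' j)) = card ?L" by (metis card_Suc_Diff1 finite)
          then have "g a' < g a" unfolding g_def by (auto simp: of_bool_def)
          then show ?thesis by (rule gless)
        next
          case False
          then have a'j: "a' j = ?L" using ik(3) upj by simp
          then have "g a' = g a" unfolding g_def by simp
          moreover have "inner_rank a' < inner_rank a"
          proof (cases "a' \<in> Lo ?L")
            case True
            then show ?thesis using rk[OF L, of a a'] h h1 a'j up unfolding inner_rank_def by simp
          next
            case False
            then show ?thesis using h1 a'j unfolding inner_rank_def by simp
          qed
          ultimately show ?thesis unfolding r'_def by simp
        qed
      next
        assume "\<exists>L. a = D L \<and> L \<noteq> {} \<and> L \<subseteq> M j \<and> \<kappa> \<notin> L \<and> a \<notin> Lo (a j)"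
        then obtain L where L: "a = D L" "L \<noteq> {}" "L \<subseteq> M j" "\<kappa> \<notin> L" by blast
        have up: "up' a = D (insert \<kappa> L)" unfolding L(1) by (rule upD[OF L(2,3)])
        \<comment> \<open>Rows in \<open>R\<close> agree throughout the block, and the remaining
          rows of \<open>up' a\<close> other than j have a single element; so only row j can lose
          one.\<close>
        have "i = j"
        proof (rule ccontr)
          assume "i \<noteq> j"
          have "i \<notin> R"
          proof
            assume "i \<in> R"
            then have "a' i = up' a i" using a'b DR unfolding up block_def by simp
            then show False using ik(1,3) by auto
          qed
          then obtain k' where "up' a i = {k'}" using Ds[of i "insert \<kappa> L"] \<open>i \<noteq> j\<close> unfolding up by blast
          then show False using ik(1,2) by simp
        qed
        then have a'j: "a' j = insert \<kappa> L - {k}" "k \<in> insert \<kappa> L" using ik(1,3) Dj unfolding up by auto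
        have "k \<noteq> \<kappa>"
        proof
          assume "k = \<kappa>"
          then have "a' = a" using ik(3) \<open>i = j\<close> L(4) Dupd[OF L(2,4)] unfolding up unfolding L(1) by (simp add: Dj)
          then show False using h by blast
        qed
        then have "\<kappa> \<in> a' j" using a'j by simp
        moreover have "Suc (card (a' j)) = card (insert \<kappa> L)"
          unfolding a'j(1) using a'j(2) by (intro card_Suc_Diff1) auto
        then have "card (a' j) = card L" using L(4) by simp
        ultimately have "g a' < g a" unfolding g_def L(1) Dj using L(4) by simp
        then show ?thesis by (rule gless)
      qed
    qed
  qed
  then show ?case by blast
qed

section \<open>Linear algebra of a matching\<close>

text \<open>Ordered by rank, the matrix \<open>e (up b) a\<close> is triangular with nonzero
  diagonal and is solved by back substitution: round m settles all equations with
  \<open>N \<le> r a + m\<close>.\<close>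

lemma matching_solve:
  fixes e :: "'c \<Rightarrow> 'c \<Rightarrow> 'k::field" and r :: "'c \<Rightarrow> nat"
  assumes Lo: "finite Lo" and unit: "\<And>a. a \<in> Lo \<Longrightarrow> e (up a) a \<noteq> 0"
    and rank: "\<And>a a'. a \<in> Lo \<Longrightarrow> a' \<in> Lo \<Longrightarrow> a' \<noteq> a \<Longrightarrow> e (up a) a' \<noteq> 0 \<Longrightarrow> r a' < r a"
  shows "\<exists>u. \<forall>a\<in>Lo. (\<Sum>b\<in>Lo. e (up b) a * u b) = f a"
proof -
  obtain N where N: "\<And>a. a \<in> Lo \<Longrightarrow> r a < N"
    using Lo finite_nat_set_iff_bounded[of "r ` Lo"] by auto
  have "\<exists>u. \<forall>a\<in>Lo. N \<le> r a + m \<longrightarrow> (\<Sum>b\<in>Lo. e (up b) a * u b) = f a" for m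
  proof (induction m)
    case 0
    then show ?case using N by fastforce
  next
    case (Suc m)
    then obtain u where u: "\<And>a. a \<in> Lo \<Longrightarrow> N \<le> r a + m \<Longrightarrow> (\<Sum>b\<in>Lo. e (up b) a * u b) = f a" by blast
    \<comment> \<open>Only unknowns of rank N - Suc m are corrected. If b differs from a and occurs
      in equation a, then b has the larger rank, so the equations already settled stay
      intact.\<close>
    define v where "v b = (if r b + Suc m = N then (f b - (\<Sum>b'\<in>Lo. e (up b') b * u b')) / e (up b) b else 0)" for b
    have "(\<Sum>b\<in>Lo. e (up b) a * (u b + v b)) = f a" if a: "a \<in> Lo" and m: "N \<le> r a + Suc m" for a
    proof -
      have other: "e (up b) a * v b = 0" if "b \<in> Lo - {a}" for b
      proof (cases "e (up b) a = 0")
        case False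
        then have "r a < r b" using rank[of b a] a that by blast
        then have "v b = 0" using m unfolding v_def by simp
        then show ?thesis by simp
      qed simp
      have "(\<Sum>b\<in>Lo. e (up b) a * v b) = e (up a) a * v a + (\<Sum>b\<in>Lo - {a}. e (up b) a * v b)"
        by (rule sum.remove[OF Lo a])
      also have "(\<Sum>b\<in>Lo - {a}. e (up b) a * v b) = 0" by (rule sum.neutral) (use other in blast)
      also have "e (up a) a * v a + 0 = f a - (\<Sum>b'\<in>Lo. e (up b') a * u b')"
      proof (cases "r a + Suc m = N")
        case True
        then show ?thesis using unit[OF a] by (simp add: v_def)
      next
        case False
        then show ?thesis using u[OF a] m by (simp add: v_def)
      qed
      finally show ?thesis by (simp add: distrib_left sum.distrib)
    qed
    then show ?case by (intro exI[of _ "\<lambda>b. u b + v b"]) blast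
  qed
  from this[of N] show ?thesis by (meson le_add2)
qed

text \<open>Triangularity again: in the equation of a lower partner a of maximal rank with
  \<open>f (up a)\<close> nonzero, all other terms vanish.\<close>

lemma matching_injective:
  fixes e :: "'c \<Rightarrow> 'c \<Rightarrow> 'k::field" and r :: "'c \<Rightarrow> nat"
  assumes Lo: "finite Lo" and unit: "\<And>a. a \<in> Lo \<Longrightarrow> e (up a) a \<noteq> 0"
    and rank: "\<And>a a'. a \<in> Lo \<Longrightarrow> a' \<in> Lo \<Longrightarrow> a' \<noteq> a \<Longrightarrow> e (up a) a' \<noteq> 0 \<Longrightarrow> r a' < r a"
    and X: "finite X" "up ` Lo \<subseteq> X" and supp: "\<And>x. f x \<noteq> 0 \<Longrightarrow> x \<in> up ` Lo"
    and z: "\<And>a. a \<in> Lo \<Longrightarrow> (\<Sum>b\<in>X. e b a * f b) = 0"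
  shows "f x = 0"
proof (rule ccontr)
  assume "f x \<noteq> 0"
  then obtain a0 where "a0 \<in> Lo" "f (up a0) \<noteq> 0" using supp by blast
  then have "{a\<in>Lo. f (up a) \<noteq> 0} \<noteq> {}" "finite {a\<in>Lo. f (up a) \<noteq> 0}" using Lo by auto
  then have "Max (r ` {a\<in>Lo. f (up a) \<noteq> 0}) \<in> r ` {a\<in>Lo. f (up a) \<noteq> 0}" by (intro Max_in) auto
  then obtain a where a: "a \<in> Lo" "f (up a) \<noteq> 0" "r a = Max (r ` {a\<in>Lo. f (up a) \<noteq> 0})" by auto
  have max: "r b \<le> r a" if "b \<in> Lo" "f (up b) \<noteq> 0" for b
    unfolding a(3) by (rule Max_ge) (use Lo that in auto)
  have other: "e b a * f b = 0" if "b \<in> X - {up a}" for b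
  proof (rule ccontr)
    assume nz: "e b a * f b \<noteq> 0"
    then obtain c where c: "c \<in> Lo" "b = up c" using supp[of b] by auto
    then have "r a < r c" using rank[OF c(1) a(1)] nz that by auto
    then show False using max[OF c(1)] c(2) nz by auto
  qed
  have "(\<Sum>b\<in>X. e b a * f b) = e (up a) a * f (up a) + (\<Sum>b\<in>X - {up a}. e b a * f b)"
    by (rule sum.remove[OF X(1)]) (use a X(2) in auto)
  also have "(\<Sum>b\<in>X - {up a}. e b a * f b) = 0" by (rule sum.neutral) (use other in blast)
  finally show False using z[OF a(1)] unit[OF a(1)] a(2) by simp
qed

text \<open>In degree \<open>0\<close> the augmentation plays the role of the differential.\<close>

lemma acyclic_matching_exact:
  fixes e :: "'c \<Rightarrow> 'c \<Rightarrow> 'k::field" and dim :: "'c \<Rightarrow> nat"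
  assumes X: "finite X" and match: "acyclic_matching facet X v Lo up r"
    and e: "\<And>a b. a \<in> X \<Longrightarrow> b \<in> X \<Longrightarrow> e b a \<noteq> 0 \<longleftrightarrow> facet a b"
    and dim: "\<And>a b. facet a b \<Longrightarrow> dim b = Suc (dim a)" and v: "dim v = 0"
    and dd: "\<And>a c. a \<in> X \<Longrightarrow> c \<in> X \<Longrightarrow> (\<Sum>b\<in>X. e b a * e c b) = 0"
    and aug: "\<And>b. b \<in> X \<Longrightarrow> dim b = Suc 0 \<Longrightarrow> (\<Sum>a\<in>X. e b a) = 0"
    and f: "\<And>x. f x \<noteq> 0 \<Longrightarrow> x \<in> X \<and> dim x = i"
    and cycle: "if i = 0 then sum f X = 0 else \<forall>a\<in>X. (\<Sum>b\<in>X. e b a * f b) = 0"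
  shows "\<exists>g. (\<forall>x. g x \<noteq> 0 \<longrightarrow> x \<in> X \<and> dim x = Suc i) \<and> (\<forall>a\<in>X. f a = (\<Sum>b\<in>X. e b a * g b))"
proof -
  have vX: "v \<in> X" and Lo: "Lo \<subseteq> X" and up: "up ` Lo \<subseteq> X" and cov: "X \<subseteq> insert v (Lo \<union> up ` Lo)"
    and fac: "\<And>a. a \<in> Lo \<Longrightarrow> facet a (up a)"
    and rk: "\<And>a a'. a \<in> Lo \<Longrightarrow> a' \<in> Lo \<Longrightarrow> a' \<noteq> a \<Longrightarrow> facet a' (up a) \<Longrightarrow> r a' < r a"
    using match unfolding acyclic_matching_def by (elim conjE, simp)+
  define L where "L m = {a\<in>Lo. dim a = m}" for m
  have L: "finite (L m)" "L m \<subseteq> Lo" for m unfolding L_def using finite_subset[OF Lo X] by auto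
  have unit: "e (up a) a \<noteq> 0" if "a \<in> Lo" for a using that fac e Lo up by blast
  have rank: "r a' < r a" if "a \<in> Lo" "a' \<in> Lo" "a' \<noteq> a" "e (up a) a' \<noteq> 0" for a a'
    using that rk e Lo up by blast
  \<comment> \<open>A chain g on upper partners is chosen whose boundary agrees with f on the lower
    partners of dimension i. The difference h then lives on v and upper partners only.\<close>
  have "\<exists>u. \<forall>a\<in>L i. (\<Sum>b\<in>L i. e (up b) a * u b) = f a"
    by (rule matching_solve[where r = r]) (use L unit rank in blast)+
  then obtain u where u: "\<And>a. a \<in> L i \<Longrightarrow> (\<Sum>b\<in>L i. e (up b) a * u b) = f a" by blast
  have inj: "inj_on up (L i)"
  proof (rule inj_onI, rule ccontr)
    fix a b assume ab: "a \<in> L i" "b \<in> L i" "up a = up b" "a \<noteq> b"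
    then have "a \<in> Lo" "b \<in> Lo" using L by auto
    then have "r a < r b" "r b < r a" using rank[of a b] rank[of b a] unit[of a] unit[of b] ab(3,4) by auto
    then show False by simp
  qed
  define g where "g x = (if x \<in> up ` L i then u (the_inv_into (L i) up x) else 0)" for x
  have gup: "g (up a) = u a" if "a \<in> L i" for a
    using that by (simp add: g_def the_inv_into_f_f[OF inj])
  have gsum: "(\<Sum>b\<in>X. e b a * g b) = (\<Sum>b\<in>L i. e (up b) a * u b)" for a
  proof -
    have "(\<Sum>b\<in>X. e b a * g b) = (\<Sum>b\<in>up ` L i. e b a * g b)"
      by (rule sum.mono_neutral_right[OF X]) (use image_mono[OF L(2)[of i], of up] up in \<open>auto simp: g_def\<close>)
    also have "\<dots> = (\<Sum>b\<in>L i. e (up b) a * g (up b))" by (simp add: sum.reindex[OF inj])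
    also have "\<dots> = (\<Sum>b\<in>L i. e (up b) a * u b)" by (rule sum.cong) (auto simp: gup)
    finally show ?thesis .
  qed
  have gsupp: "x \<in> X \<and> dim x = Suc i" if nz: "g x \<noteq> 0" for x
  proof -
    obtain a where "a \<in> L i" "x = up a" using nz unfolding g_def by (auto split: if_splits)
    then show ?thesis using fac[of a] dim[of a "up a"] up unfolding L_def by auto
  qed
  define h where "h x = (if x \<in> X then f x - (\<Sum>b\<in>X. e b x * g b) else 0)" for x
  have hL: "h a = 0" if "a \<in> L i" for a using u[OF that] gsum by (simp add: h_def)
  have hdim: "x \<in> X \<and> dim x = i" if "h x \<noteq> 0" for x
  proof -
    have x: "x \<in> X" using that unfolding h_def by (auto split: if_splits)
    have "f x \<noteq> 0 \<or> (\<Sum>b\<in>X. e b x * g b) \<noteq> 0" using that x by (auto simp: h_def)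
    then have "dim x = i"
    proof
      assume "(\<Sum>b\<in>X. e b x * g b) \<noteq> 0"
      then obtain b where "b \<in> X" "e b x * g b \<noteq> 0" by (meson sum.neutral)
      then have "facet x b" "dim b = Suc i" using e[OF x] gsupp by auto
      then show ?thesis using dim by fastforce
    qed (use f in blast)
    then show ?thesis using x by blast
  qed
  have hsupp: "x = v \<or> x \<in> up ` Lo" if "h x \<noteq> 0" for x
    using hdim[OF that] cov hL[of x] that unfolding L_def by auto
  have "h x = 0" for x
  proof (cases "i = 0")
    \<comment> \<open>No upper partner has dimension 0, so h is concentrated in v, and its
      coefficient sum is 0.\<close>
    case True
    have hv: "h x = 0" if xv: "x \<noteq> v" for x
    proof (rule ccontr)
      assume nz: "h x \<noteq> 0"
      then obtain a where "a \<in> Lo" "x = up a" using hsupp xv by blast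
      then have "dim x \<noteq> 0" using fac[of a] dim[of a x] by auto
      then show False using hdim[OF nz] True by simp
    qed
    have "(\<Sum>x\<in>X. \<Sum>b\<in>X. e b x * g b) = (\<Sum>b\<in>X. (\<Sum>x\<in>X. e b x) * g b)"
      by (subst sum.swap) (simp add: sum_distrib_right)
    also have "\<dots> = 0"
    proof (rule sum.neutral, rule ballI)
      fix b assume "b \<in> X"
      then show "(\<Sum>x\<in>X. e b x) * g b = 0" using aug[of b] gsupp[of b] True by (cases "g b = 0") auto
    qed
    finally have "sum h X = 0" using cycle True by (simp add: h_def sum_subtractf)
    moreover have "sum h X = h v + sum h (X - {v})" by (rule sum.remove[OF X vX])
    moreover have "sum h (X - {v}) = 0" by (rule sum.neutral) (use hv in blast)
    ultimately have "h v = 0" by simp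
    then show ?thesis using hv by (cases "x = v") auto
  next
    \<comment> \<open>Here v has the wrong dimension, so h is a cycle supported on upper partners
      and \<open>matching_injective\<close> applies one dimension lower.\<close>
    case False
    then obtain i' where i': "i = Suc i'" using not0_implies_Suc by blast
    show ?thesis
    proof (rule matching_injective[where Lo = "L i'" and e = e and up = up and r = r and X = X])
      show "x \<in> up ` L i'" if nz: "h x \<noteq> 0" for x
      proof -
        have "x \<noteq> v" using hdim[OF nz] v i' by auto
        then obtain a where a: "a \<in> Lo" "x = up a" using hsupp[OF nz] by blast
        then have "dim a = i'" using dim[OF fac[OF a(1)]] hdim[OF nz] i' by simp
        then show ?thesis using a unfolding L_def by blast
      qed
      show "(\<Sum>b\<in>X. e b a * h b) = 0" if a: "a \<in> L i'" for a
      proof -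
        have aX: "a \<in> X" using a L Lo by blast
        have "(\<Sum>b\<in>X. e b a * h b) = (\<Sum>b\<in>X. e b a * f b) - (\<Sum>b\<in>X. e b a * (\<Sum>c\<in>X. e c b * g c))"
          by (simp add: h_def right_diff_distrib sum_subtractf)
        also have "(\<Sum>b\<in>X. e b a * f b) = 0" using cycle False aX by simp
        also have "(\<Sum>b\<in>X. e b a * (\<Sum>c\<in>X. e c b * g c)) = (\<Sum>c\<in>X. (\<Sum>b\<in>X. e b a * e c b) * g c)"
          unfolding sum_distrib_left sum_distrib_right by (subst sum.swap) (simp add: mult.assoc)
        also have "\<dots> = 0" using dd[OF aX] by simp
        finally show ?thesis by simp
      qed
    qed (use L unit rank X up in blast)+
  qed
  then have "f a = (\<Sum>b\<in>X. e b a * g b)" if "a \<in> X" for a using that unfolding h_def by (metis eq_iff_diff_eq_0)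
  then show ?thesis using gsupp by blast
qed

section \<open>Polynomials and powers of the irrelevant ideal\<close>

text \<open>With finitely many variables every exponent function has finite support, so exponents
  can be handled as plain functions.\<close>

definition expo :: "('m::finite \<Rightarrow> nat) \<Rightarrow> 'm \<Rightarrow>\<^sub>0 nat" where
  "expo t = Abs_poly_mapping t"

lemma lookup_expo [simp]: "Poly_Mapping.lookup (expo t) = t"
  unfolding expo_def by simp

lemma expo_add: "expo s + expo t = expo (\<lambda>i. s i + t i)"
  by (rule poly_mapping_eqI) (simp add: lookup_add)

lemma expo_lookup [simp]: "expo (Poly_Mapping.lookup q) = q"
  by (rule poly_mapping_eqI) simp

lemma expo_inject [simp]: "expo s = expo t \<longleftrightarrow> s = t"
  by (metis lookup_expo)

lemma expo_eq_iff: "expo s = q \<longleftrightarrow> s = Poly_Mapping.lookup q"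
  by (metis lookup_expo expo_lookup)

lemma var_power: "(var i :: ('m, 'k::comm_ring_1) mpolynomial) ^ n = Poly_Mapping.single (Poly_Mapping.single i n) 1"
proof (induction n)
  case 0
  then show ?case by simp
next
  case (Suc n)
  have "(var i :: ('m, 'k) mpolynomial) * Poly_Mapping.single (Poly_Mapping.single i n) 1
      = Poly_Mapping.single (Poly_Mapping.single i 1 + Poly_Mapping.single i n) (1 * 1)"
    unfolding var_def by (rule mult_single)
  then show ?case using Suc by (simp flip: single_add)
qed

lemma monom_of_expo: "monom_of t = (Poly_Mapping.single (expo t) 1 :: ('m::finite, 'k::comm_ring_1) mpolynomial)"
proof -
  have "(\<Prod>i\<in>A. (var i :: ('m, 'k) mpolynomial) ^ t i) = Poly_Mapping.single (\<Sum>i\<in>A. Poly_Mapping.single i (t i)) 1"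
    if "finite A" for A
    using that
  proof (induction A rule: finite_induct)
    case empty
    then show ?case by simp
  next
    case (insert i A)
    then show ?case by (simp add: var_power mult_single)
  qed
  moreover have "(\<Sum>i\<in>UNIV. Poly_Mapping.single i (t i)) = expo t"
    by (rule poly_mapping_eqI) (simp add: lookup_sum lookup_single when_def)
  ultimately show ?thesis unfolding monom_of_def by simp
qed

lemma monom_of_mult_single:
  "monom_of s * Poly_Mapping.single (expo t) c = Poly_Mapping.single (expo (\<lambda>i. s i + t i)) (c :: 'k::comm_ring_1)"
  unfolding monom_of_expo mult_single by (simp add: expo_add)

lemma poly_mapping_sum_single: "p = (\<Sum>t\<in>Poly_Mapping.keys p. Poly_Mapping.single t (Poly_Mapping.lookup p t))"
proof (rule poly_mapping_eqI)
  fix s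
  have "(\<Sum>t\<in>Poly_Mapping.keys p. Poly_Mapping.lookup (Poly_Mapping.single t (Poly_Mapping.lookup p t)) s)
      = (\<Sum>t\<in>Poly_Mapping.keys p. if t = s then Poly_Mapping.lookup p t else 0)"
    by (rule sum.cong) (auto simp: lookup_single when_def)
  then show "Poly_Mapping.lookup p s = Poly_Mapping.lookup (\<Sum>t\<in>Poly_Mapping.keys p. Poly_Mapping.single t (Poly_Mapping.lookup p t)) s"
    by (simp add: lookup_sum sum.delta in_keys_iff)
qed

text \<open>Divisibility is tested explicitly because truncated subtraction of exponents would
  otherwise point to a wrong coefficient.\<close>

lemma lookup_monom_of_mult:
  fixes p :: "('m::finite, 'k::comm_ring_1) mpolynomial"
  shows "Poly_Mapping.lookup (monom_of s * p) (expo u) =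
    (if \<forall>i. s i \<le> u i then Poly_Mapping.lookup p (expo (\<lambda>i. u i - s i)) else 0)"
proof -
  have eq: "expo (\<lambda>i. s i + Poly_Mapping.lookup t i) = expo u \<longleftrightarrow> (\<forall>i. s i \<le> u i) \<and> t = expo (\<lambda>i. u i - s i)" for t
  proof
    assume "expo (\<lambda>i. s i + Poly_Mapping.lookup t i) = expo u"
    then have u: "u = (\<lambda>i. s i + Poly_Mapping.lookup t i)" by simp
    show "(\<forall>i. s i \<le> u i) \<and> t = expo (\<lambda>i. u i - s i)" unfolding u by simp
  next
    assume "(\<forall>i. s i \<le> u i) \<and> t = expo (\<lambda>i. u i - s i)"
    then show "expo (\<lambda>i. s i + Poly_Mapping.lookup t i) = expo u" by simp
  qed
  have "monom_of s * p = (\<Sum>t\<in>Poly_Mapping.keys p. monom_of s * Poly_Mapping.single (expo (Poly_Mapping.lookup t)) (Poly_Mapping.lookup p t))"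
    by (subst (1) poly_mapping_sum_single[of p]) (simp add: sum_distrib_left)
  then have sum: "monom_of s * p = (\<Sum>t\<in>Poly_Mapping.keys p.
      Poly_Mapping.single (expo (\<lambda>i. s i + Poly_Mapping.lookup t i)) (Poly_Mapping.lookup p t))"
    unfolding monom_of_mult_single .
  have "Poly_Mapping.lookup (monom_of s * p) (expo u) =
      (\<Sum>t\<in>Poly_Mapping.keys p. if (\<forall>i. s i \<le> u i) \<and> t = expo (\<lambda>i. u i - s i) then Poly_Mapping.lookup p t else 0)"
    unfolding sum lookup_sum lookup_single when_def eq ..
  also have "\<dots> = (if \<forall>i. s i \<le> u i then Poly_Mapping.lookup p (expo (\<lambda>i. u i - s i)) else 0)"
  proof (cases "\<forall>i. s i \<le> u i")
    case True
    then show ?thesis by (simp add: sum.delta in_keys_iff)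
  next
    case False
    then show ?thesis by (simp only: simp_thms if_False sum.neutral_const)
  qed
  finally show ?thesis .
qed

lemma lookup_of_int_mult:
  "Poly_Mapping.lookup (of_int z * (p :: ('m, 'k::comm_ring_1) mpolynomial)) u = of_int z * Poly_Mapping.lookup p u"
  by (induction z rule: int_induct[of _ 0]) (simp_all add: distrib_right left_diff_distrib lookup_add lookup_minus)


section \<open>Ideals generated by monomials of bounded degree\<close>

lemma module_times: "Modules.module ((*) :: 'a::comm_ring_1 \<Rightarrow> 'a \<Rightarrow> 'a)"
  by unfold_locales (simp_all add: algebra_simps)

lemma ideal_generated_base: "x \<in> X \<Longrightarrow> x \<in> ideal_generated X"
  unfolding ideal_generated_def by (rule module.span_base[OF module_times])

lemma ideal_generated_mult: "x \<in> ideal_generated X \<Longrightarrow> c * x \<in> ideal_generated X"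
  unfolding ideal_generated_def by (rule module.span_scale[OF module_times])

lemma ideal_generated_sum: "(\<And>i. i \<in> A \<Longrightarrow> f i \<in> ideal_generated X) \<Longrightarrow> sum f A \<in> ideal_generated X"
  unfolding ideal_generated_def by (rule module.span_sum[OF module_times])

lemma ideal_generated_minimal:
  assumes "X \<subseteq> J" "0 \<in> J" "\<And>x y. x \<in> J \<Longrightarrow> y \<in> J \<Longrightarrow> x + y \<in> J" "\<And>c x. x \<in> J \<Longrightarrow> c * x \<in> J"
  shows "ideal_generated X \<subseteq> J"
  unfolding ideal_generated_def
  by (rule module.span_minimal[OF module_times assms(1)])
    (use assms(2-) in \<open>auto simp: module.subspace_def[OF module_times]\<close>)

definition degree_ideal :: "nat \<Rightarrow> ('m::finite, 'k::comm_ring_1) mpolynomial set" where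
  "degree_ideal n = {p. \<forall>t\<in>Poly_Mapping.keys p. n \<le> (\<Sum>i\<in>UNIV. Poly_Mapping.lookup t i)}"

lemma degree_ideal_mult:
  fixes p q :: "('m::finite, 'k::comm_ring_1) mpolynomial"
  assumes "p \<in> degree_ideal m" "q \<in> degree_ideal n"
  shows "p * q \<in> degree_ideal (m + n)"
proof -
  have "m + n \<le> (\<Sum>i\<in>UNIV. Poly_Mapping.lookup t i)" if t: "t \<in> Poly_Mapping.keys (p * q)" for t
  proof -
    obtain a b where ab: "t = a + b" "a \<in> Poly_Mapping.keys p" "b \<in> Poly_Mapping.keys q"
      using keys_mult[of p q] t by blast
    have "m \<le> (\<Sum>i\<in>UNIV. Poly_Mapping.lookup a i)" "n \<le> (\<Sum>i\<in>UNIV. Poly_Mapping.lookup b i)"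
      using assms ab unfolding degree_ideal_def by auto
    then show ?thesis unfolding ab(1) by (simp add: lookup_add sum.distrib)
  qed
  then show ?thesis unfolding degree_ideal_def by blast
qed

lemma degree_ideal_0: "degree_ideal 0 = UNIV"
  unfolding degree_ideal_def by simp

lemma degree_ideal_zero: "0 \<in> degree_ideal n"
  unfolding degree_ideal_def by simp

lemma degree_ideal_add: "p \<in> degree_ideal n \<Longrightarrow> q \<in> degree_ideal n \<Longrightarrow> p + q \<in> degree_ideal n"
  unfolding degree_ideal_def using keys_add[of p q] by blast

lemma degree_ideal_sum: "(\<And>i. i \<in> A \<Longrightarrow> f i \<in> degree_ideal n) \<Longrightarrow> sum f A \<in> degree_ideal n"
  by (induction A rule: infinite_finite_induct) (auto simp: degree_ideal_zero degree_ideal_add)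

lemma degree_ideal_scale: "p \<in> degree_ideal n \<Longrightarrow> c * p \<in> degree_ideal n"
  using degree_ideal_mult[of c 0 p n] by (simp add: degree_ideal_0)

lemma monom_of_degree_ideal:
  "n \<le> (\<Sum>i\<in>UNIV. t i) \<Longrightarrow> (monom_of t :: ('m::finite, 'k::comm_ring_1) mpolynomial) \<in> degree_ideal n"
  unfolding monom_of_expo degree_ideal_def by (auto split: if_splits)

lemma var_degree_ideal: "(var i :: ('m::finite, 'k::comm_ring_1) mpolynomial) \<in> degree_ideal 1"
  unfolding var_def degree_ideal_def
  by (auto simp: lookup_single when_def split: if_splits)

lemma single_split_var:
  fixes t :: "'m::finite \<Rightarrow>\<^sub>0 nat"
  assumes "Suc n \<le> (\<Sum>i\<in>UNIV. Poly_Mapping.lookup t i)"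
  shows "\<exists>i s. Poly_Mapping.single t (c :: 'k::comm_ring_1) = var i * Poly_Mapping.single s c
    \<and> n \<le> (\<Sum>i\<in>UNIV. Poly_Mapping.lookup s i)"
proof -
  have "\<exists>i. Poly_Mapping.lookup t i \<noteq> 0"
  proof (rule ccontr)
    assume "\<nexists>i. Poly_Mapping.lookup t i \<noteq> 0"
    then show False using assms by simp
  qed
  then obtain i where i: "Poly_Mapping.lookup t i \<noteq> 0" by blast
  define s where "s = t - Poly_Mapping.single i 1"
  have t: "t = Poly_Mapping.single i 1 + s"
    unfolding s_def using i
    by (intro poly_mapping_eqI) (auto simp: lookup_add lookup_minus lookup_single when_def)
  have "(\<Sum>j\<in>UNIV. Poly_Mapping.lookup t j) = (\<Sum>j\<in>UNIV. if i = j then 1 else 0) + (\<Sum>j\<in>UNIV. Poly_Mapping.lookup s j)"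
    unfolding sum.distrib[symmetric] by (rule sum.cong) (auto simp: t lookup_add lookup_single when_def)
  then have "n \<le> (\<Sum>j\<in>UNIV. Poly_Mapping.lookup s j)" using assms by simp
  moreover have "Poly_Mapping.single t c = var i * Poly_Mapping.single s c"
    unfolding var_def mult_single t by simp
  ultimately show ?thesis by blast
qed

lemma ideal_generated_var: "ideal_generated (range var) = (degree_ideal 1 :: ('m::finite, 'k::comm_ring_1) mpolynomial set)"
proof
  show "ideal_generated (range var) \<subseteq> (degree_ideal 1 :: ('m, 'k) mpolynomial set)"
    by (rule ideal_generated_minimal)
      (auto simp: degree_ideal_zero degree_ideal_add degree_ideal_scale intro: var_degree_ideal[unfolded One_nat_def])
  show "(degree_ideal 1 :: ('m, 'k) mpolynomial set) \<subseteq> ideal_generated (range var)"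
  proof
    fix p :: "('m, 'k) mpolynomial" assume p: "p \<in> degree_ideal 1"
    have "(\<Sum>t\<in>Poly_Mapping.keys p. Poly_Mapping.single t (Poly_Mapping.lookup p t)) \<in> ideal_generated (range var)"
    proof (rule ideal_generated_sum)
      fix t assume "t \<in> Poly_Mapping.keys p"
      then have "Suc 0 \<le> (\<Sum>i\<in>UNIV. Poly_Mapping.lookup t i)" using p unfolding degree_ideal_def by auto
      then obtain i s where "Poly_Mapping.single t (Poly_Mapping.lookup p t) = var i * Poly_Mapping.single s (Poly_Mapping.lookup p t)"
        using single_split_var by blast
      moreover have "Poly_Mapping.single s (Poly_Mapping.lookup p t) * var i \<in> ideal_generated (range var)"
        by (intro ideal_generated_mult ideal_generated_base rangeI)
      ultimately show "Poly_Mapping.single t (Poly_Mapping.lookup p t) \<in> ideal_generated (range var)"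
        by (simp add: mult.commute)
    qed
    then show "p \<in> ideal_generated (range var)" by (simp flip: poly_mapping_sum_single)
  qed
qed

text \<open>One variable splits off each monomial of degree at least \<open>Suc n\<close>;
  membership in the power thus becomes a test on exponents.\<close>

lemma ideal_power_var:
  "ideal_power (ideal_generated (range var)) n = (degree_ideal n :: ('m::finite, 'k::comm_ring_1) mpolynomial set)"
proof (induction n)
  case 0
  then show ?case by (simp add: degree_ideal_0)
next
  case (Suc n)
  let ?G = "{a * b | a b. a \<in> (degree_ideal 1 :: ('m, 'k) mpolynomial set) \<and> b \<in> degree_ideal n}"
  have "ideal_generated ?G = degree_ideal (Suc n)"
  proof
    show "ideal_generated ?G \<subseteq> degree_ideal (Suc n)"
    proof (rule ideal_generated_minimal)
      show "?G \<subseteq> degree_ideal (Suc n)" using degree_ideal_mult[of _ 1 _ n] by auto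
    qed (auto simp: degree_ideal_zero degree_ideal_add degree_ideal_scale)
    show "degree_ideal (Suc n) \<subseteq> ideal_generated ?G"
    proof
      fix p :: "('m, 'k) mpolynomial" assume p: "p \<in> degree_ideal (Suc n)"
      have "(\<Sum>t\<in>Poly_Mapping.keys p. Poly_Mapping.single t (Poly_Mapping.lookup p t)) \<in> ideal_generated ?G"
      proof (rule ideal_generated_sum)
        fix t assume "t \<in> Poly_Mapping.keys p"
        then have "Suc n \<le> (\<Sum>i\<in>UNIV. Poly_Mapping.lookup t i)" using p unfolding degree_ideal_def by auto
        then obtain i s where s: "Poly_Mapping.single t (Poly_Mapping.lookup p t) = var i * Poly_Mapping.single s (Poly_Mapping.lookup p t)"
          "n \<le> (\<Sum>i\<in>UNIV. Poly_Mapping.lookup s i)"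
          using single_split_var by blast
        have "Poly_Mapping.single s (Poly_Mapping.lookup p t) \<in> degree_ideal n"
          unfolding degree_ideal_def using s(2) by simp
        then have "Poly_Mapping.single t (Poly_Mapping.lookup p t) \<in> ?G"
          unfolding s(1) using var_degree_ideal by blast
        then show "Poly_Mapping.single t (Poly_Mapping.lookup p t) \<in> ideal_generated ?G" by (rule ideal_generated_base)
      qed
      then show "p \<in> ideal_generated ?G" by (simp flip: poly_mapping_sum_single)
    qed
  qed
  then show ?case unfolding ideal_power.simps Suc.IH unfolding ideal_generated_var .
qed

text \<open>Provides a divisor of degree exactly n of a monomial of degree at least n, to be
  realized as the label of a vertex.\<close>

lemma ex_le_with_sum:
  fixes t :: "'m::finite \<Rightarrow> nat"
  assumes "n \<le> (\<Sum>i\<in>UNIV. t i)"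
  shows "\<exists>s. (\<forall>i. s i \<le> t i) \<and> (\<Sum>i\<in>UNIV. s i) = n"
  using assms
proof (induction n)
  case 0
  then show ?case by (intro exI[of _ "\<lambda>_. 0"]) simp
next
  case (Suc n)
  then obtain s where s: "\<And>i. s i \<le> t i" "(\<Sum>i\<in>UNIV. s i) = n" by auto
  have "\<exists>i. s i < t i"
  proof (rule ccontr)
    assume "\<nexists>i. s i < t i"
    then have "(\<Sum>i\<in>UNIV. t i) \<le> (\<Sum>i\<in>UNIV. s i)" by (intro sum_mono) (simp add: not_less)
    then show False using s(2) Suc.prems by simp
  qed
  then obtain i where i: "s i < t i" by blast
  have "(\<Sum>j\<in>UNIV. (s(i := Suc (s i))) j) = (\<Sum>j\<in>UNIV. s j + (if j = i then 1 else 0))"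
    by (rule sum.cong) auto
  also have "\<dots> = Suc n" using s(2) by (simp add: sum.distrib)
  finally show ?case using s(1) i by (intro exI[of _ "s(i := Suc (s i))"]) auto
qed

section \<open>The boundary operator on mixed cells\<close>

text \<open>On edge sets a facet is the removal of one edge, so two successive facets are the
  removal of two edges in either order.\<close>

lemma cell_facet_edges:
  fixes I :: "'n \<Rightarrow> 'd set"
  assumes "\<And>j. J j \<noteq> {}"
  shows "cell_facet J I \<longleftrightarrow> (\<exists>p\<in>Sigma UNIV I. Sigma UNIV J = Sigma UNIV I - {p})"
proof
  assume "cell_facet J I"
  then obtain j k where "k \<in> I j" "J = I(j := I j - {k})" unfolding cell_facet_def by blast
  then have "(j, k) \<in> Sigma UNIV I" "Sigma UNIV J = Sigma UNIV I - {(j, k)}" by (auto split: if_splits)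
  then show "\<exists>p\<in>Sigma UNIV I. Sigma UNIV J = Sigma UNIV I - {p}" by blast
next
  assume "\<exists>p\<in>Sigma UNIV I. Sigma UNIV J = Sigma UNIV I - {p}"
  then obtain j k where jk: "k \<in> I j" "Sigma UNIV J = Sigma UNIV I - {(j, k)}" by auto
  have mem: "l \<in> J i \<longleftrightarrow> l \<in> I i \<and> (i, l) \<noteq> (j, k)" for i l
    using jk(2) by (metis DiffD1 DiffD2 DiffI SigmaD2 SigmaI UNIV_I singletonD singletonI)
  have "J = I(j := I j - {k})"
  proof
    fix i
    show "J i = (I(j := I j - {k})) i" using mem[of _ i] by (cases "i = j") auto
  qed
  moreover have "I j \<noteq> {k}" using assms[of j] mem[of _ j] by auto
  ultimately show "cell_facet J I" unfolding cell_facet_def using jk(1) by blast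
qed

lemma Sigma_UNIV_inject: "Sigma UNIV I = Sigma UNIV J \<longleftrightarrow> I = J"
proof
  assume "Sigma UNIV I = Sigma UNIV J"
  then have "k \<in> I j \<longleftrightarrow> k \<in> J j" for j k using mem_Sigma_iff[of j k UNIV I] mem_Sigma_iff[of j k UNIV J] by simp
  then show "I = J" by (intro ext) blast
qed simp

locale oriented_weights = generic_weights w
  for w :: "'n::finite \<Rightarrow> 'd::finite \<Rightarrow> real" +
  fixes ori :: "(real^'d) set \<Rightarrow> (real^'d) list"
  assumes oriented: "oriented_complex (mixed_complex cells) ori"
begin

lemma cell_polytope:
  assumes "I \<in> cells"
  shows "polytope (mixed_cell I)"
proof -
  have "\<forall>C\<in>mixed_complex cells. polytope C \<and> C \<noteq> {}"
    using complex unfolding polyhedral_complex_def by (elim conjE)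
  then show ?thesis using imageI[OF assms, of mixed_cell] unfolding mixed_complex_def by blast
qed

lemma cell_basis: "I \<in> cells \<Longrightarrow> direction_basis (ori (mixed_cell I)) (mixed_cell I)"
  by (erule rangeE)
    (use oriented in \<open>simp add: oriented_complex_def direction_basis_def directions_def mixed_complex_def\<close>)

lemma cell_facet_down: "I \<in> cells \<Longrightarrow> cell_facet J I \<Longrightarrow> J \<in> cells"
proof -
  assume I: "I \<in> cells" and F: "cell_facet J I"
  show "J \<in> cells"
  proof (rule cells_down[OF I])
    show "J j \<noteq> {}" for j using F cells_nonempty[OF I, of j] unfolding cell_facet_def by (auto split: if_splits)
  qed (rule cell_facet_sub[OF F])
qed

text \<open>Extended by zero off facets, so that boundary sums can run over all cells.\<close>

definition inc :: "('n \<Rightarrow> 'd set) \<Rightarrow> ('n \<Rightarrow> 'd set) \<Rightarrow> int" where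
  "inc I J = (if cell_facet J I then incidence ori (mixed_cell I) (mixed_cell J) else 0)"

lemma facet_incidence:
  assumes "I \<in> cells" "cell_facet J I"
  shows "mixed_cell J facet_of mixed_cell I" "inc I J = 1 \<or> inc I J = - 1"
proof -
  have J: "J \<in> cells" using assms by (rule cell_facet_down)
  show F: "mixed_cell J facet_of mixed_cell I" using facet_of_mixed_cell_iff[OF assms(1) J] assms(2) by simp
  show "inc I J = 1 \<or> inc I J = - 1"
    using incidence_nonzero[of "mixed_cell I" "mixed_cell J" ori, OF cell_polytope[OF assms(1)] F
        cell_basis[OF assms(1)] cell_basis[OF J]] assms(2)
    by (simp add: inc_def)
qed

text \<open>The intersection is a face of a cell, hence itself some cell \<open>L\<close>; lying in
  both cells, \<open>L\<close> is rowwise contained in \<open>K\<close>.\<close>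

lemma mixed_cell_Int:
  assumes "I \<in> cells" "J \<in> cells" "K \<in> cells" and K: "\<And>j. K j = I j \<inter> J j"
  shows "mixed_cell I \<inter> mixed_cell J = mixed_cell K"
proof
  show "mixed_cell K \<subseteq> mixed_cell I \<inter> mixed_cell J"
    using mixed_cell_subset_iff[OF assms(1,3)] mixed_cell_subset_iff[OF assms(2,3)] K by auto
  then have "mixed_cell I \<inter> mixed_cell J \<noteq> {}" using mixed_cell_nonempty[OF assms(3)] by auto
  then obtain L where L: "L \<in> cells" "mixed_cell I \<inter> mixed_cell J = mixed_cell L"
    using face_of_mixed_cell[OF assms(1) mixed_cell_Int_face[OF assms(1,2)]] by blast
  then have "L j \<subseteq> K j" for j
    using mixed_cell_subset_iff[OF assms(1) L(1)] mixed_cell_subset_iff[OF assms(2) L(1)] K by blast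
  then show "mixed_cell I \<inter> mixed_cell J \<subseteq> mixed_cell K"
    unfolding L(2) using mixed_cell_subset_iff[OF assms(3) L(1)] by blast
qed

text \<open>If \<open>K\<close> arises from \<open>I\<close> by deleting two edges p and q, exactly
  two cells lie in between, one for each order of deletion, and the diamond relation cancels
  them.\<close>

lemma inc_inc_zero:
  assumes I: "I \<in> cells" and K: "K \<in> cells"
  shows "(\<Sum>J\<in>cells. inc J K * inc I J) = 0"
proof (cases "\<exists>J. cell_facet J I \<and> cell_facet K J")
  case False
  then have "\<forall>J\<in>cells. inc J K * inc I J = 0" unfolding inc_def by auto
  then show ?thesis by (simp add: sum.neutral)
next
  case True
  then obtain J1 where J1: "cell_facet J1 I" "cell_facet K J1" by blast
  let ?E = "\<lambda>J. Sigma UNIV J :: ('n \<times> 'd) set"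
  note ne = cells_nonempty
  have J1c: "J1 \<in> cells" using cell_facet_down[OF I J1(1)] .
  obtain p where p: "p \<in> ?E I" "?E J1 = ?E I - {p}" using iffD1[OF cell_facet_edges[OF ne[OF J1c]] J1(1)] by (elim bexE)
  obtain q where q: "q \<in> ?E J1" "?E K = ?E J1 - {q}" using iffD1[OF cell_facet_edges[OF ne[OF K]] J1(2)] by (elim bexE)
  \<comment> \<open>The other order of deletion, q first. The result still contains
    \<open>K\<close>, so no row is empty and it is a cell.\<close>
  define J2 where "J2 j = {k \<in> I j. (j, k) \<noteq> q}" for j
  have EJ2: "?E J2 = ?E I - {q}" unfolding J2_def by auto
  have KJ2: "K j \<subseteq> J2 j" for j
  proof
    fix k assume "k \<in> K j"
    then have "(j, k) \<in> ?E K" by simp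
    then have "(j, k) \<in> ?E J2" unfolding q(2) p(2) EJ2 by blast
    then show "k \<in> J2 j" by simp
  qed
  have J2ne: "J2 j \<noteq> {}" for j using KJ2[of j] ne[OF K, of j] by blast
  have J2c: "J2 \<in> cells" by (rule cells_down[OF I J2ne]) (auto simp: J2_def)
  have qI: "q \<in> ?E I" "p \<noteq> q" using q(1) p(2) by auto
  have J2: "cell_facet J2 I" 
    by (rule iffD2[OF cell_facet_edges[OF J2ne]]) (rule bexI, rule EJ2, rule qI(1))
  have EK: "?E K = ?E J2 - {p}" "p \<in> ?E J2" unfolding EJ2 q(2) p(2) using p(1) qI(2) by blast+
  have KJ2f: "cell_facet K J2" 
    by (rule iffD2[OF cell_facet_edges[OF ne[OF K]]]) (rule bexI, rule EK(1), rule EK(2))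
  have only: "J = J1 \<or> J = J2" if J: "cell_facet J I" "cell_facet K J" for J
  proof -
    have Jc: "J \<in> cells" using cell_facet_down[OF I J(1)] .
    obtain p' where p': "p' \<in> ?E I" "?E J = ?E I - {p'}" using iffD1[OF cell_facet_edges[OF ne[OF Jc]] J(1)] by (elim bexE)
    obtain q' where q': "q' \<in> ?E J" "?E K = ?E J - {q'}" using iffD1[OF cell_facet_edges[OF ne[OF K]] J(2)] by (elim bexE)
    have "p' \<notin> ?E K" unfolding q'(2) p'(2) by blast
    then have "p' = p \<or> p' = q" using p'(1) unfolding q(2) p(2) by blast
    then have "?E J = ?E J1 \<or> ?E J = ?E J2" unfolding p'(2) p(2) EJ2 by blast
    then show ?thesis unfolding Sigma_UNIV_inject .
  qed
  have "?E J1 \<noteq> ?E J2" unfolding p(2) EJ2 using p(1) qI(2) by blast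
  then have J12: "J1 \<noteq> J2" by blast
  have int: "mixed_cell J1 \<inter> mixed_cell J2 = mixed_cell K"
  proof (rule mixed_cell_Int[OF J1c J2c K])
    fix j
    have "?E K = ?E J1 \<inter> ?E J2" unfolding q(2) p(2) EJ2 by blast
    then show "K j = J1 j \<inter> J2 j" by auto
  qed
  have "(\<Sum>J\<in>cells. inc J K * inc I J) = (\<Sum>J\<in>{J1, J2}. inc J K * inc I J)"
    by (rule sum.mono_neutral_right) (use J1c J2c only in \<open>auto simp: inc_def\<close>)
  also have "\<dots> = inc J1 K * inc I J1 + inc J2 K * inc I J2" using J12 by simp
  also have "\<dots> = 0"
    using incidence_diamond[of "mixed_cell I" "mixed_cell J1" "mixed_cell J2" "mixed_cell K" ori,
        OF cell_polytope[OF I] facet_incidence(1)[OF I J1(1)] facet_incidence(1)[OF I J2]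
          facet_incidence(1)[OF J1c J1(2)] facet_incidence(1)[OF J2c KJ2f] int
          cell_basis[OF I] cell_basis[OF J1c] cell_basis[OF J2c] cell_basis[OF K]]
      J1 J2 KJ2f
    by (simp add: inc_def mult.commute)
  finally show ?thesis .
qed

text \<open>A one-dimensional cell has one row with two elements and single elements elsewhere; its
  two facets are distinct points, with opposite signs.\<close>

lemma inc_edge_zero:
  assumes I: "I \<in> cells" and dim: "cell_dim I = Suc 0"
  shows "(\<Sum>J\<in>cells. inc I J) = 0"
proof -
  obtain j where j: "card (I j) - 1 = Suc 0" "\<And>i. i \<noteq> j \<Longrightarrow> card (I i) - 1 = 0"
    using dim sum_eq_Suc0_iff[of UNIV "\<lambda>j. card (I j) - 1"] unfolding cell_dim_def by auto
  have "card (I j) = 2" using j(1) by simp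
  then obtain k l where kl: "I j = {k, l}" "k \<noteq> l" unfolding card_2_iff by blast
  have single: "\<exists>m. I i = {m}" if "i \<noteq> j" for i
  proof -
    have "card (I i) \<noteq> 0" using cells_nonempty[OF I, of i] by simp
    then have "card (I i) = 1" using j(2)[OF that] by linarith
    then show ?thesis by (rule card_1_singletonE) blast
  qed
  let ?J1 = "I(j := {l})" and ?J2 = "I(j := {k})"
  have F: "cell_facet ?J1 I" "cell_facet ?J2 I"
  proof -
    have e: "{l} = I j - {k}" "{k} = I j - {l}" using kl by auto
    have "k \<in> I j" "l \<in> I j" "I j \<noteq> {k}" "I j \<noteq> {l}" using kl by auto
    then show "cell_facet ?J1 I" "cell_facet ?J2 I"
      unfolding cell_facet_def
      using arg_cong[OF e(1), of "\<lambda>X. I(j := X)"] arg_cong[OF e(2), of "\<lambda>X. I(j := X)"] by blast+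
  qed
  have J: "?J1 \<in> cells" "?J2 \<in> cells" using cell_facet_down[OF I] F by auto
  have J12: "?J1 \<noteq> ?J2" using kl(2) by (metis fun_upd_eqD singleton_inject)
  have only: "J = ?J1 \<or> J = ?J2" if "cell_facet J I" for J
  proof -
    obtain i m where im: "m \<in> I i" "I i \<noteq> {m}" "J = I(i := I i - {m})" using \<open>cell_facet J I\<close> unfolding cell_facet_def by blast
    have "i = j" using single[of i] im(1,2) by auto
    then have m: "m = k \<or> m = l" and Jm: "J = I(j := {k, l} - {m})" using im kl(1) by simp_all
    have "{k, l} - {k} = {l}" "{k, l} - {l} = {k}" using kl(2) by auto
    then show ?thesis using m unfolding Jm by metis
  qed
  have "\<exists>v. mixed_cell J = {v}" if "cell_facet J I" "J \<in> cells" for J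
  proof -
    have "aff_dim (mixed_cell J) = 0" using aff_dim_mixed_cell[OF that(2)] cell_facet_dim[OF that(1)] dim by simp
    then show ?thesis by (simp add: aff_dim_eq_0)
  qed
  then obtain v1 v2 where v: "mixed_cell ?J1 = {v1}" "mixed_cell ?J2 = {v2}" using F J by metis
  have v12: "v1 \<noteq> v2" using mixed_cell_inject[OF J] J12 v by auto
  have "(\<Sum>J\<in>cells. inc I J) = (\<Sum>J\<in>{?J1, ?J2}. inc I J)"
    by (rule sum.mono_neutral_right) (use J only in \<open>auto simp: inc_def\<close>)
  also have "\<dots> = inc I ?J1 + inc I ?J2" using J12 by simp
  also have "\<dots> = 0"
    using incidence_edge[of "mixed_cell I" v1 v2 ori] cell_polytope[OF I] facet_incidence(1)[OF I F(1)]
      facet_incidence(1)[OF I F(2)] v v12 cell_basis[OF I] cell_basis[OF J(1)] cell_basis[OF J(2)] F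
    by (simp add: inc_def)
  finally show ?thesis .
qed

section \<open>Cells below a multidegree\<close>

definition below :: "('d \<Rightarrow> nat) \<Rightarrow> ('n \<Rightarrow> 'd set) set" where
  "below \<beta> = {I \<in> cells. \<forall>k. coarse_type I k \<le> \<beta> k}"

lemma below_down:
  assumes I: "I \<in> below \<beta>" and "\<And>j. J j \<noteq> {}" and sub: "\<And>j. J j \<subseteq> I j"
  shows "J \<in> below \<beta>"
proof -
  have "J \<in> cells" by (rule cells_down[of I]) (use assms in \<open>auto simp: below_def\<close>)
  moreover have "coarse_type J k \<le> \<beta> k" for k
    using coarse_type_mono[of J I k] sub I order_trans unfolding below_def by blast
  ultimately show ?thesis by (simp add: below_def)
qed

lemma below_facet:
  assumes I: "I \<in> below \<beta>" and F: "cell_facet J I"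
  shows "J \<in> below \<beta>"
proof (rule below_down[OF I])
  have "J \<in> cells" using cell_facet_down[OF _ F] I by (simp add: below_def)
  then show "J j \<noteq> {}" for j by (rule cells_nonempty)
qed (rule cell_facet_sub[OF F])

lemma inc_inc_zero_below:
  assumes I: "I \<in> below \<beta>" and K: "K \<in> below \<beta>"
  shows "(\<Sum>J\<in>below \<beta>. of_int (inc J K) * of_int (inc I J)) = (0::'k::field)"
proof -
  have "(\<Sum>J\<in>below \<beta>. inc J K * inc I J) = (\<Sum>J\<in>cells. inc J K * inc I J)"
    by (rule sum.mono_neutral_left) (use below_facet[OF I] in \<open>auto simp: below_def inc_def\<close>)
  also have "\<dots> = 0" by (rule inc_inc_zero) (use I K in \<open>auto simp: below_def\<close>)
  finally show ?thesis by (simp flip: of_int_mult of_int_sum)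
qed

lemma inc_edge_zero_below:
  assumes I: "I \<in> below \<beta>" and dim: "cell_dim I = Suc 0"
  shows "(\<Sum>J\<in>below \<beta>. of_int (inc I J)) = (0::'k::field)"
proof -
  have "(\<Sum>J\<in>below \<beta>. inc I J) = (\<Sum>J\<in>cells. inc I J)"
    by (rule sum.mono_neutral_left) (use below_facet[OF I] in \<open>auto simp: below_def inc_def\<close>)
  also have "\<dots> = 0" by (rule inc_edge_zero[OF _ dim]) (use I in \<open>simp add: below_def\<close>)
  finally show ?thesis by (simp flip: of_int_sum)
qed

lemma below_join:
  assumes "I \<in> below \<beta>" "J \<in> below \<beta>"
  shows "\<exists>K\<in>below \<beta>. K j = I j \<union> J j \<and> (\<forall>i. I i = J i \<longrightarrow> K i = I i)"
proof -
  obtain z z' where z: "I = min_type w z" "J = min_type w z'" using assms unfolding below_def by blast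
  obtain u where u: "min_type w u j = I j \<union> J j" "\<forall>i. I i = J i \<longrightarrow> min_type w u i = I i"
    "\<And>k. coarse_type (min_type w u) k \<le> max (coarse_type I k) (coarse_type J k)"
    using min_type_join[of w j z z'] unfolding z by blast
  have "coarse_type (min_type w u) k \<le> \<beta> k" for k
  proof -
    have "coarse_type I k \<le> \<beta> k" "coarse_type J k \<le> \<beta> k" using assms unfolding below_def by auto
    then show ?thesis using u(3)[of k] by linarith
  qed
  then have "min_type w u \<in> below \<beta>" unfolding below_def by blast
  then show ?thesis using u(1,2) by blast
qed

text \<open>Downward closure and joins allow \<open>acyclic_matching_block\<close> with no row
  prescribed, the critical cell being any vertex below \<beta>. If nothing lies below \<beta> there
  is no such vertex, and the claim is trivial.\<close>

lemma below_exact: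
  fixes f :: "('n \<Rightarrow> 'd set) \<Rightarrow> 'k::field"
  assumes f: "\<And>I. f I \<noteq> 0 \<Longrightarrow> I \<in> below \<beta> \<and> cell_dim I = i"
    and cycle: "if i = 0 then sum f (below \<beta>) = 0
      else \<forall>J\<in>below \<beta>. (\<Sum>I\<in>below \<beta>. of_int (inc I J) * f I) = 0"
  shows "\<exists>g. (\<forall>I. g I \<noteq> 0 \<longrightarrow> I \<in> below \<beta> \<and> cell_dim I = Suc i) \<and>
    (\<forall>J\<in>below \<beta>. f J = (\<Sum>I\<in>below \<beta>. of_int (inc I J) * g I))"
proof (cases "below \<beta> = {}")
  case True
  then show ?thesis by (intro exI[of _ "\<lambda>_. 0"]) auto
next
  case False
  then obtain I1 where I1: "I1 \<in> below \<beta>" by blast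
  have cells: "I \<in> cells" if "I \<in> below \<beta>" for I using that by (simp add: below_def)
  define I0 where "I0 j = {SOME k. k \<in> I1 j}" for j
  have I0: "I0 \<in> below \<beta>"
  proof (rule below_down[OF I1])
    show "I0 j \<subseteq> I1 j" for j unfolding I0_def using cells_nonempty[OF cells[OF I1], of j] by (simp add: some_in_eq)
  qed (simp add: I0_def)
  have blk: "block (below \<beta>) {} I0 = below \<beta>" unfolding block_def by simp
  have "\<exists>Lo up r. acyclic_matching cell_facet (block (below \<beta>) {} I0) I0 Lo up r"
  proof (rule acyclic_matching_block)
    show "I j \<noteq> {}" if "I \<in> below \<beta>" for I j using cells_nonempty[OF cells[OF that]] .
    show "J \<in> below \<beta>" if "I \<in> below \<beta>" "\<And>j. J j \<noteq> {}" "\<And>j. J j \<subseteq> I j" for I J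
      using that by (rule below_down)
    show "\<exists>K\<in>below \<beta>. K j = I j \<union> J j \<and> (\<forall>i. I i = J i \<longrightarrow> K i = I i)"
      if "I \<in> below \<beta>" "J \<in> below \<beta>" for I J j using that by (rule below_join)
    show "\<exists>k. I0 j = {k}" for j by (simp add: I0_def)
  qed (rule I0)
  then obtain Lo up r where match: "acyclic_matching cell_facet (below \<beta>) I0 Lo up r"
    unfolding blk by (elim exE)
  show ?thesis
  proof (rule acyclic_matching_exact[OF _ match, where e = "\<lambda>I J. of_int (inc I J)" and dim = cell_dim and f = f])
    show "finite (below \<beta>)" by simp
    show "of_int (inc I J) \<noteq> (0::'k) \<longleftrightarrow> cell_facet J I" if "J \<in> below \<beta>" "I \<in> below \<beta>" for I J
    proof
      assume "of_int (inc I J) \<noteq> (0::'k)"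
      then show "cell_facet J I" unfolding inc_def by (auto split: if_splits)
    next
      assume "cell_facet J I"
      \<comment> \<open>The values 1 and -1 stay nonzero in every characteristic.\<close>
      then show "of_int (inc I J) \<noteq> (0::'k)" using facet_incidence(2)[OF cells[OF that(2)], of J] by auto
    qed
    show "cell_dim I = Suc (cell_dim J)" if "cell_facet J I" for I J :: "'n \<Rightarrow> 'd set"
      using that by (rule cell_facet_dim)
    show "cell_dim I0 = 0" unfolding cell_dim_def I0_def by simp
    show "(\<Sum>J\<in>below \<beta>. of_int (inc J K) * of_int (inc I J)) = (0::'k)" if "K \<in> below \<beta>" "I \<in> below \<beta>" for I K
      by (rule inc_inc_zero_below[OF that(2,1)])
    show "(\<Sum>J\<in>below \<beta>. of_int (inc I J)) = (0::'k)" if "I \<in> below \<beta>" "cell_dim I = Suc 0" for I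
      by (rule inc_edge_zero_below[OF that])
  qed (use f cycle in auto)
qed

end

section \<open>The resolution\<close>

context oriented_weights
begin

abbreviation (input) diff :: "((real^'d) set \<Rightarrow> ('d, 'k::field) mpolynomial) \<Rightarrow> (real^'d) set \<Rightarrow> ('d, 'k) mpolynomial" where
  "diff \<equiv> cellular_diff (mixed_complex cells) ori (lcm_label cells)"

lemma cellular_diff_mixed_cell:
  fixes f :: "(real^'d) set \<Rightarrow> ('d, 'k::field) mpolynomial"
  assumes J: "J \<in> cells"
  shows "diff f (mixed_cell J) =
    (\<Sum>I\<in>cells. of_int (inc I J) * (monom_of (\<lambda>k. coarse_type I k - coarse_type J k) * f (mixed_cell I)))"
proof -
  let ?F = "{I\<in>cells. cell_facet J I}"
  have set: "{H \<in> mixed_complex cells. mixed_cell J facet_of H} = mixed_cell ` ?F"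
  proof (intro equalityI subsetI)
    fix H assume "H \<in> {H \<in> mixed_complex cells. mixed_cell J facet_of H}"
    then obtain I where "I \<in> cells" "H = mixed_cell I" "mixed_cell J facet_of mixed_cell I"
      unfolding mixed_complex_def by blast
    then show "H \<in> mixed_cell ` ?F" using facet_of_mixed_cell_iff[OF _ J] by simp
  next
    fix H assume "H \<in> mixed_cell ` ?F"
    then obtain I where "I \<in> cells" "cell_facet J I" "H = mixed_cell I" by blast
    then show "H \<in> {H \<in> mixed_complex cells. mixed_cell J facet_of H}"
      using facet_of_mixed_cell_iff[OF _ J] unfolding mixed_complex_def by simp
  qed
  have inj: "inj_on mixed_cell ?F" using mixed_cell_inj_on by (rule inj_on_subset) auto
  have "diff f (mixed_cell J) = (\<Sum>I\<in>?F. of_int (incidence ori (mixed_cell I) (mixed_cell J)) *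
      monom_of (\<lambda>k. lcm_label cells (mixed_cell I) k - lcm_label cells (mixed_cell J) k) * f (mixed_cell I))"
    unfolding cellular_diff_def set sum.reindex[OF inj] o_def ..
  also have "\<dots> = (\<Sum>I\<in>?F. of_int (inc I J) * (monom_of (\<lambda>k. coarse_type I k - coarse_type J k) * f (mixed_cell I)))"
    by (rule sum.cong) (auto simp: lcm_label_mixed_cell J inc_def mult.assoc)
  also have "\<dots> = (\<Sum>I\<in>cells. of_int (inc I J) * (monom_of (\<lambda>k. coarse_type I k - coarse_type J k) * f (mixed_cell I)))"
    by (rule sum.mono_neutral_left) (auto simp: inc_def)
  finally show ?thesis .
qed

lemma cellular_diff_outside: "G \<notin> mixed_complex cells \<Longrightarrow> diff f G = 0"
proof -
  assume G: "G \<notin> mixed_complex cells"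
  have "{H \<in> mixed_complex cells. G facet_of H} = {}"
  proof (rule equals0I)
    fix H assume "H \<in> {H \<in> mixed_complex cells. G facet_of H}"
    then obtain I where I: "I \<in> cells" "G face_of mixed_cell I" "G \<noteq> {}"
      unfolding mixed_complex_def facet_of_def by blast
    then show False using face_of_mixed_cell[OF I] G unfolding mixed_complex_def by blast
  qed
  then show ?thesis unfolding cellular_diff_def by (simp only: sum.empty)
qed

section \<open>Multigraded strands\<close>

text \<open>Coordinates of the component of f in multidegree \<beta>: the generator of I has degree
  \<open>coarse_type I\<close>, which is subtracted from \<beta>. The guard keeps truncated
  subtraction from reading other coefficients.\<close>

definition strand :: "('d \<Rightarrow> nat) \<Rightarrow> ((real^'d) set \<Rightarrow> ('d, 'k::field) mpolynomial) \<Rightarrow> ('n \<Rightarrow> 'd set) \<Rightarrow> 'k" where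
  "strand \<beta> f I = (if I \<in> below \<beta>
     then Poly_Mapping.lookup (f (mixed_cell I)) (expo (\<lambda>k. \<beta> k - coarse_type I k)) else 0)"

text \<open>In a fixed multidegree the monomial factors only shift exponents, so the differential
  acts by bare incidence numbers.\<close>

lemma strand_diff:
  fixes f :: "(real^'d) set \<Rightarrow> ('d, 'k::field) mpolynomial"
  assumes J: "J \<in> below \<beta>"
  shows "strand \<beta> (diff f) J = (\<Sum>I\<in>below \<beta>. of_int (inc I J) * strand \<beta> f I)"
proof -
  have Jc: "J \<in> cells" and Jb: "\<And>k. coarse_type J k \<le> \<beta> k" using J by (auto simp: below_def)
  have "strand \<beta> (diff f) J = (\<Sum>I\<in>cells. of_int (inc I J) *
      Poly_Mapping.lookup (monom_of (\<lambda>k. coarse_type I k - coarse_type J k) * f (mixed_cell I)) (expo (\<lambda>k. \<beta> k - coarse_type J k)))"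
    using J by (simp add: strand_def cellular_diff_mixed_cell[OF Jc] lookup_sum lookup_of_int_mult)
  also have "\<dots> = (\<Sum>I\<in>cells. of_int (inc I J) * strand \<beta> f I)"
  proof (rule sum.cong[OF refl])
    fix I assume I: "I \<in> cells"
    show "of_int (inc I J) * Poly_Mapping.lookup (monom_of (\<lambda>k. coarse_type I k - coarse_type J k) * f (mixed_cell I)) (expo (\<lambda>k. \<beta> k - coarse_type J k))
      = of_int (inc I J) * strand \<beta> f I"
    proof (cases "cell_facet J I")
      case False
      then show ?thesis by (simp add: inc_def)
    next
      case True
      have JI: "coarse_type J k \<le> coarse_type I k" for k by (rule coarse_type_mono) (rule cell_facet_sub[OF True])
      have "(coarse_type I k - coarse_type J k \<le> \<beta> k - coarse_type J k) = (coarse_type I k \<le> \<beta> k)" for k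
        using JI[of k] Jb[of k] by linarith
      moreover have "\<beta> k - coarse_type J k - (coarse_type I k - coarse_type J k) = \<beta> k - coarse_type I k" for k
        using JI[of k] by linarith
      ultimately show ?thesis
        unfolding lookup_monom_of_mult strand_def below_def using I by simp
    qed
  qed
  also have "\<dots> = (\<Sum>I\<in>below \<beta>. of_int (inc I J) * strand \<beta> f I)"
    by (rule sum.mono_neutral_right) (auto simp: below_def strand_def)
  finally show ?thesis .
qed

text \<open>Every coefficient of a chain appears in the strand whose degree is its exponent plus the
  coarse type, so chains can be compared strand by strand.\<close>

lemma lookup_strand:
  assumes "J \<in> cells"
  shows "Poly_Mapping.lookup (f (mixed_cell J)) u = strand (\<lambda>k. Poly_Mapping.lookup u k + coarse_type J k) f J"
  using assms unfolding strand_def below_def by simp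

lemma chain_eqI:
  assumes f: "\<And>H. H \<notin> mixed_complex cells \<Longrightarrow> f H = 0" and g: "\<And>H. H \<notin> mixed_complex cells \<Longrightarrow> g H = 0"
    and eq: "\<And>\<beta> J. J \<in> below \<beta> \<Longrightarrow> strand \<beta> f J = strand \<beta> g J"
  shows "f = g"
proof
  fix H
  show "f H = g H"
  proof (cases "H \<in> mixed_complex cells")
    case True
    then obtain J where J: "J \<in> cells" "H = mixed_cell J" unfolding mixed_complex_def by blast
    show ?thesis unfolding J(2)
    proof (rule poly_mapping_eqI)
      fix u
      have "J \<in> below (\<lambda>k. Poly_Mapping.lookup u k + coarse_type J k)" using J(1) by (simp add: below_def)
      then show "Poly_Mapping.lookup (f (mixed_cell J)) u = Poly_Mapping.lookup (g (mixed_cell J)) u"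
        unfolding lookup_strand[OF J(1)] by (rule eq)
    qed
  qed (simp add: f g)
qed

lemma chains_outside: "f \<in> chains P i \<Longrightarrow> H \<notin> P \<Longrightarrow> f H = 0"
  unfolding chains_def by blast

lemma strand_chain: "f \<in> chains (mixed_complex cells) i \<Longrightarrow> strand \<beta> f I \<noteq> 0 \<Longrightarrow> I \<in> below \<beta> \<and> cell_dim I = i"
proof -
  assume f: "f \<in> chains (mixed_complex cells) i" and nz: "strand \<beta> f I \<noteq> 0"
  have I: "I \<in> below \<beta>" using nz unfolding strand_def by (auto split: if_splits)
  then have Ic: "I \<in> cells" by (simp add: below_def)
  have "f (mixed_cell I) \<noteq> 0" using nz I unfolding strand_def by auto
  then have "aff_dim (mixed_cell I) = int i" using f unfolding chains_def by blast
  then show ?thesis using I aff_dim_mixed_cell[OF Ic] by simp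
qed

lemma diff_chain:
  assumes f: "f \<in> chains (mixed_complex cells) (Suc i)"
  shows "diff f \<in> chains (mixed_complex cells) i"
  unfolding chains_def
proof (intro CollectI allI impI)
  fix G assume nz: "diff f G \<noteq> 0"
  then have G: "G \<in> mixed_complex cells" using cellular_diff_outside by blast
  then obtain J where J: "J \<in> cells" "G = mixed_cell J" unfolding mixed_complex_def by blast
  have "\<exists>I\<in>cells. of_int (inc I J) * (monom_of (\<lambda>k. coarse_type I k - coarse_type J k) * f (mixed_cell I)) \<noteq> 0"
    using nz unfolding J(2) cellular_diff_mixed_cell[OF J(1)] by (meson sum.neutral)
  then obtain I where Ic: "I \<in> cells"
    and nz': "of_int (inc I J) * (monom_of (\<lambda>k. coarse_type I k - coarse_type J k) * f (mixed_cell I)) \<noteq> 0"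
    by blast
  have I: "I \<in> cells" "inc I J \<noteq> 0" "f (mixed_cell I) \<noteq> 0" using Ic nz' by auto
  have "aff_dim (mixed_cell I) = int (Suc i)" using f I(3) unfolding chains_def by blast
  then have "cell_dim I = Suc i" using aff_dim_mixed_cell[OF I(1)] by simp
  moreover have "cell_facet J I" using I(2) unfolding inc_def by (auto split: if_splits)
  ultimately have "aff_dim G = int i" using cell_facet_dim[of J I] aff_dim_mixed_cell[OF J(1)] J(2) by simp
  then show "G \<in> mixed_complex cells \<and> aff_dim G = int i" using G by simp
qed

lemma diff_diff:
  fixes f :: "(real^'d) set \<Rightarrow> ('d, 'k::field) mpolynomial"
  shows "diff (diff f) = (\<lambda>_. 0)"
proof (rule chain_eqI)
  fix \<beta> K assume K: "K \<in> below \<beta>"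
  have "strand \<beta> (diff (diff f)) K = (\<Sum>J\<in>below \<beta>. of_int (inc J K) * (\<Sum>I\<in>below \<beta>. of_int (inc I J) * strand \<beta> f I))"
    unfolding strand_diff[OF K] by (rule sum.cong) (auto simp: strand_diff)
  also have "\<dots> = (\<Sum>I\<in>below \<beta>. (\<Sum>J\<in>below \<beta>. of_int (inc J K) * of_int (inc I J)) * strand \<beta> f I)"
    unfolding sum_distrib_left sum_distrib_right by (subst sum.swap) (simp add: mult.assoc)
  also have "\<dots> = (\<Sum>I\<in>below \<beta>. 0)" by (rule sum.cong) (simp_all add: inc_inc_zero_below K)
  finally show "strand \<beta> (diff (diff f)) K = strand \<beta> (\<lambda>_. 0) K" by (simp add: strand_def)
qed (auto simp: cellular_diff_outside)

text \<open>Solutions in the single multidegrees are glued to one chain. Its coefficients have to be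
  polynomials, which holds because only finitely many strands of f are nonzero.\<close>

lemma strands_exact:
  fixes f :: "(real^'d) set \<Rightarrow> ('d, 'k::field) mpolynomial"
  assumes f: "f \<in> chains (mixed_complex cells) i"
    and cycle: "\<And>\<beta>. if i = 0 then sum (strand \<beta> f) (below \<beta>) = 0
      else \<forall>J\<in>below \<beta>. (\<Sum>I\<in>below \<beta>. of_int (inc I J) * strand \<beta> f I) = 0"
  shows "f \<in> diff ` chains (mixed_complex cells) (Suc i)"
proof -
  \<comment> \<open>The last clause selects the zero solution for a zero strand; arbitrary solutions
    there could give infinite support.\<close>
  have ex: "\<exists>g. (\<forall>I. g I \<noteq> 0 \<longrightarrow> I \<in> below \<beta> \<and> cell_dim I = Suc i) \<and>
      (\<forall>J\<in>below \<beta>. strand \<beta> f J = (\<Sum>I\<in>below \<beta>. of_int (inc I J) * g I)) \<and>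
      ((\<forall>I. strand \<beta> f I = 0) \<longrightarrow> (\<forall>I. g I = 0))" for \<beta>
  proof (cases "\<forall>I. strand \<beta> f I = 0")
    case True
    then show ?thesis by (intro exI[of _ "\<lambda>_. 0"]) simp
  next
    case False
    then show ?thesis using below_exact[of "strand \<beta> f" \<beta> i, OF strand_chain[OF f] cycle] by blast
  qed
  define \<gamma> where "\<gamma> \<beta> = (SOME g. (\<forall>I. g I \<noteq> 0 \<longrightarrow> I \<in> below \<beta> \<and> cell_dim I = Suc i) \<and>
      (\<forall>J\<in>below \<beta>. strand \<beta> f J = (\<Sum>I\<in>below \<beta>. of_int (inc I J) * g I)) \<and>
      ((\<forall>I. strand \<beta> f I = 0) \<longrightarrow> (\<forall>I. g I = 0)))" for \<beta>
  have \<gamma>: "(\<forall>I. \<gamma> \<beta> I \<noteq> 0 \<longrightarrow> I \<in> below \<beta> \<and> cell_dim I = Suc i) \<and>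
      (\<forall>J\<in>below \<beta>. strand \<beta> f J = (\<Sum>I\<in>below \<beta>. of_int (inc I J) * \<gamma> \<beta> I)) \<and>
      ((\<forall>I. strand \<beta> f I = 0) \<longrightarrow> (\<forall>I. \<gamma> \<beta> I = 0))" for \<beta>
    unfolding \<gamma>_def by (rule someI_ex[OF ex])
  define B where "B = {\<beta>. \<exists>I. strand \<beta> f I \<noteq> 0}"
  have finB: "finite B"
  proof (rule finite_subset)
    show "B \<subseteq> (\<Union>I\<in>cells. (\<lambda>u k. Poly_Mapping.lookup u k + coarse_type I k) ` Poly_Mapping.keys (f (mixed_cell I)))"
    proof
      fix \<beta> assume "\<beta> \<in> B"
      then obtain I where I: "strand \<beta> f I \<noteq> 0" unfolding B_def by blast
      then have Ib: "I \<in> below \<beta>" unfolding strand_def by (auto split: if_splits)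
      let ?u = "expo (\<lambda>k. \<beta> k - coarse_type I k)"
      have "?u \<in> Poly_Mapping.keys (f (mixed_cell I))" using I Ib unfolding strand_def by (simp add: in_keys_iff)
      moreover have "\<beta> = (\<lambda>k. Poly_Mapping.lookup ?u k + coarse_type I k)" using Ib by (auto simp: below_def)
      ultimately show "\<beta> \<in> (\<Union>I\<in>cells. (\<lambda>u k. Poly_Mapping.lookup u k + coarse_type I k) ` Poly_Mapping.keys (f (mixed_cell I)))"
        using Ib unfolding below_def by blast
    qed
  qed (intro finite_UN_I finite_imageI finite finite_keys)
  \<comment> \<open>The coefficient of the monomial u at I is taken from the strand in degree u plus
    the coarse type of I.\<close>
  define c where "c I u = \<gamma> (\<lambda>k. Poly_Mapping.lookup u k + coarse_type I k) I" for I u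
  have finc: "finite {u. c I u \<noteq> 0}" for I
  proof -
    let ?h = "\<lambda>u k. Poly_Mapping.lookup u k + coarse_type I k :: nat"
    have "inj ?h"
    proof (rule injI)
      fix u v :: "'d \<Rightarrow>\<^sub>0 nat" assume "?h u = ?h v"
      then have "Poly_Mapping.lookup u k = Poly_Mapping.lookup v k" for k by (simp add: fun_eq_iff)
      then show "u = v" by (rule poly_mapping_eqI)
    qed
    moreover have "{u. c I u \<noteq> 0} \<subseteq> ?h -` B" unfolding c_def B_def using \<gamma> by blast
    ultimately show ?thesis using finite_vimageI[OF finB] finite_subset by blast
  qed
  define g where "g H = (if H \<in> mixed_complex cells then Abs_poly_mapping (c (the_inv_into cells mixed_cell H)) else 0)" for H
  have gcell: "Poly_Mapping.lookup (g (mixed_cell I)) = c I" if I: "I \<in> cells" for I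
  proof -
    have "mixed_cell I \<in> mixed_complex cells" using I unfolding mixed_complex_def by (rule imageI)
    then show ?thesis
      unfolding g_def the_inv_into_f_f[OF mixed_cell_inj_on I] using lookup_Abs_poly_mapping[OF finc[of I]] by simp
  qed
  have strand_g: "strand \<beta> g I = \<gamma> \<beta> I" if I: "I \<in> below \<beta>" for \<beta> I
  proof -
    have "I \<in> cells" "(\<lambda>k. \<beta> k - coarse_type I k + coarse_type I k) = \<beta>" using I by (auto simp: below_def)
    then show ?thesis using I by (simp add: strand_def gcell c_def)
  qed
  have "g \<in> chains (mixed_complex cells) (Suc i)"
    unfolding chains_def
  proof (intro CollectI allI impI)
    fix H assume nz: "g H \<noteq> 0"
    then have H: "H \<in> mixed_complex cells" unfolding g_def by (auto split: if_splits)
    then obtain I where I: "I \<in> cells" "H = mixed_cell I" unfolding mixed_complex_def by blast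
    have "c I \<noteq> (\<lambda>_. 0)"
    proof
      assume "c I = (\<lambda>_. 0)"
      then have "g H = 0" using gcell[OF I(1)] unfolding I(2) by (intro poly_mapping_eqI) simp
      then show False using nz by simp
    qed
    then obtain u where "c I u \<noteq> 0" by blast
    then have "cell_dim I = Suc i" using \<gamma> unfolding c_def by blast
    then show "H \<in> mixed_complex cells \<and> aff_dim H = int (Suc i)" using H aff_dim_mixed_cell[OF I(1)] I(2) by simp
  qed
  moreover have "f = diff g"
  proof (rule chain_eqI)
    fix \<beta> J assume J: "J \<in> below \<beta>"
    have "strand \<beta> f J = (\<Sum>I\<in>below \<beta>. of_int (inc I J) * \<gamma> \<beta> I)" using \<gamma>[of \<beta>] J by blast
    also have "\<dots> = strand \<beta> (diff g) J" unfolding strand_diff[OF J] by (rule sum.cong) (auto simp: strand_g)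
    finally show "strand \<beta> f J = strand \<beta> (diff g) J" .
  qed (use chains_outside[OF f] cellular_diff_outside in auto)
  ultimately show ?thesis by blast
qed

lemma exact_positive:
  assumes "1 \<le> i"
  shows "{f \<in> chains (mixed_complex cells) i. diff f = (\<lambda>_. (0 :: ('d, 'k::field) mpolynomial))}
    = diff ` chains (mixed_complex cells) (Suc i)"
proof (intro equalityI subsetI)
  fix f :: "(real^'d) set \<Rightarrow> ('d, 'k) mpolynomial"
  assume "f \<in> diff ` chains (mixed_complex cells) (Suc i)"
  then show "f \<in> {f \<in> chains (mixed_complex cells) i. diff f = (\<lambda>_. 0)}" using diff_chain diff_diff by auto
next
  fix f :: "(real^'d) set \<Rightarrow> ('d, 'k) mpolynomial"
  assume "f \<in> {f \<in> chains (mixed_complex cells) i. diff f = (\<lambda>_. 0)}"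
  then have f: "f \<in> chains (mixed_complex cells) i" and z: "diff f = (\<lambda>_. 0)" by auto
  show "f \<in> diff ` chains (mixed_complex cells) (Suc i)"
  proof (rule strands_exact[OF f])
    fix \<beta>
    have "(\<Sum>I\<in>below \<beta>. of_int (inc I J) * strand \<beta> f I) = 0" if "J \<in> below \<beta>" for J
    proof -
      have "strand \<beta> (diff f) J = 0" unfolding z by (simp add: strand_def)
      then show ?thesis using strand_diff[OF that, of f] by simp
    qed
    then show "if i = 0 then sum (strand \<beta> f) (below \<beta>) = 0
      else \<forall>J\<in>below \<beta>. (\<Sum>I\<in>below \<beta>. of_int (inc I J) * strand \<beta> f I) = 0" using assms by simp
  qed
qed

section \<open>The augmentation onto the ideal\<close>

text \<open>The map from degree 0 to the ideal that sends the generator of a vertex to its label; on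
  chains of degree 0 the other cells contribute nothing.\<close>

definition augment :: "((real^'d) set \<Rightarrow> ('d, 'k::field) mpolynomial) \<Rightarrow> ('d, 'k) mpolynomial" where
  "augment f = (\<Sum>I\<in>cells. monom_of (coarse_type I) * f (mixed_cell I))"

lemma augment_add: "augment (\<lambda>H. f H + g H) = augment f + augment g"
  unfolding augment_def by (simp add: distrib_left sum.distrib)

lemma augment_diff: "augment (\<lambda>H. f H - g H) = augment f - augment g"
  unfolding augment_def by (simp add: right_diff_distrib sum_subtractf)

lemma augment_scale: "augment (\<lambda>H. s * f H) = s * augment f"
  unfolding augment_def by (simp add: sum_distrib_left mult.left_commute)

lemma lookup_augment: "Poly_Mapping.lookup (augment f) (expo \<beta>) = sum (strand \<beta> f) (below \<beta>)"
proof -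
  have "Poly_Mapping.lookup (augment f) (expo \<beta>) = (\<Sum>I\<in>cells. strand \<beta> f I)"
    unfolding augment_def lookup_sum lookup_monom_of_mult
    by (rule sum.cong) (auto simp: strand_def below_def)
  also have "\<dots> = sum (strand \<beta> f) (below \<beta>)"
    by (rule sum.mono_neutral_right) (auto simp: below_def strand_def)
  finally show ?thesis .
qed

text \<open>Exactness at the end of the complex: strandwise the augmentation is the coefficient sum,
  so one direction is the case i = 0 of \<open>strands_exact\<close>, and the other holds because
  the signs at the two ends of an edge cancel.\<close>

lemma augment_eq_0_iff:
  fixes f :: "(real^'d) set \<Rightarrow> ('d, 'k::field) mpolynomial"
  assumes f: "f \<in> chains (mixed_complex cells) 0"
  shows "augment f = 0 \<longleftrightarrow> f \<in> diff ` chains (mixed_complex cells) 1"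
proof
  assume z: "augment f = 0"
  have "f \<in> diff ` chains (mixed_complex cells) (Suc 0)"
  proof (rule strands_exact[OF f])
    show "if (0::nat) = 0 then sum (strand \<beta> f) (below \<beta>) = 0
      else \<forall>J\<in>below \<beta>. (\<Sum>I\<in>below \<beta>. of_int (inc I J) * strand \<beta> f I) = 0" for \<beta>
      using lookup_augment[of f \<beta>] z by simp
  qed
  then show "f \<in> diff ` chains (mixed_complex cells) 1" by simp
next
  assume "f \<in> diff ` chains (mixed_complex cells) 1"
  then obtain g where g: "g \<in> chains (mixed_complex cells) (Suc 0)" "f = diff g" by auto
  show "augment f = 0"
  proof (rule poly_mapping_eqI)
    fix u :: "'d \<Rightarrow>\<^sub>0 nat"
    let ?b = "Poly_Mapping.lookup u"
    have "Poly_Mapping.lookup (augment f) (expo ?b) = (\<Sum>J\<in>below ?b. \<Sum>I\<in>below ?b. of_int (inc I J) * strand ?b g I)"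
      unfolding lookup_augment g(2) by (rule sum.cong) (auto simp: strand_diff)
    also have "\<dots> = (\<Sum>I\<in>below ?b. (\<Sum>J\<in>below ?b. of_int (inc I J)) * strand ?b g I)"
      unfolding sum_distrib_right by (rule sum.swap)
    also have "\<dots> = (\<Sum>I\<in>below ?b. 0)"
    proof (rule sum.cong[OF refl])
      fix I assume I: "I \<in> below ?b"
      show "(\<Sum>J\<in>below ?b. of_int (inc I J)) * strand ?b g I = 0"
      proof (cases "strand ?b g I = 0")
        case False
        then have dim: "cell_dim I = Suc 0" using strand_chain[OF g(1)] by blast
        have "(\<Sum>J\<in>below ?b. of_int (inc I J)) = (0::'k)" by (rule inc_edge_zero_below[OF I dim])
        then show ?thesis by simp
      qed simp
    qed
    finally show "Poly_Mapping.lookup (augment f) u = Poly_Mapping.lookup 0 u" by simp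
  qed
qed

lemma chains_closed:
  fixes f g :: "(real^'d) set \<Rightarrow> ('d, 'k::field) mpolynomial"
  assumes "f \<in> chains P i" "g \<in> chains P i"
  shows "(\<lambda>H. f H + g H) \<in> chains P i" "(\<lambda>H. f H - g H) \<in> chains P i" "(\<lambda>H. s * f H) \<in> chains P i"
proof -
  have supp: "h \<in> chains P i" if "\<And>H. h H \<noteq> 0 \<Longrightarrow> f H \<noteq> 0 \<or> g H \<noteq> 0"
    for h :: "(real^'d) set \<Rightarrow> ('d, 'k) mpolynomial"
    using that assms unfolding chains_def by blast
  show "(\<lambda>H. f H + g H) \<in> chains P i" by (rule supp) auto
  show "(\<lambda>H. f H - g H) \<in> chains P i" by (rule supp) auto
  show "(\<lambda>H. s * f H) \<in> chains P i" by (rule supp) auto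
qed

text \<open>Coarse types have total degree at least n. Conversely, a monomial of degree at least n
  is divisible by one of degree n, and every exponent of degree n is the coarse type of a
  vertex.\<close>

lemma augment_image: "augment ` chains (mixed_complex cells) 0 = (degree_ideal CARD('n) :: ('d, 'k::field) mpolynomial set)"
proof (intro equalityI subsetI)
  fix p :: "('d, 'k) mpolynomial" assume "p \<in> augment ` chains (mixed_complex cells) 0"
  then obtain f where p: "p = augment f" by blast
  show "p \<in> degree_ideal CARD('n)"
    unfolding p augment_def
  proof (rule degree_ideal_sum)
    fix I assume I: "I \<in> cells"
    have "(\<Sum>k\<in>UNIV. coarse_type I k) = cell_dim I + CARD('n)" by (rule sum_coarse_type) (rule cells_nonempty[OF I])
    then have "(monom_of (coarse_type I) :: ('d, 'k) mpolynomial) \<in> degree_ideal CARD('n)" by (intro monom_of_degree_ideal) simp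
    then show "monom_of (coarse_type I) * f (mixed_cell I) \<in> degree_ideal CARD('n)"
      using degree_ideal_scale by (subst mult.commute)
  qed
next
  fix p :: "('d, 'k) mpolynomial" assume p: "p \<in> degree_ideal CARD('n)"
  have mono: "Poly_Mapping.single t c \<in> augment ` chains (mixed_complex cells) 0"
    if "t \<in> Poly_Mapping.keys p" for t and c :: 'k
  proof -
    have "CARD('n) \<le> (\<Sum>k\<in>UNIV. Poly_Mapping.lookup t k)" using p \<open>t \<in> Poly_Mapping.keys p\<close> unfolding degree_ideal_def by blast
    then obtain s where s: "\<And>k. s k \<le> Poly_Mapping.lookup t k" "(\<Sum>k\<in>UNIV. s k) = CARD('n)"
      using ex_le_with_sum by metis
    obtain I where I: "I \<in> cells" "cell_dim I = 0" "coarse_type I = s" using vertex_of_type[OF s(2)] by blast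
    let ?q = "Poly_Mapping.single (expo (\<lambda>k. Poly_Mapping.lookup t k - s k)) c"
    let ?f = "\<lambda>H. if H = mixed_cell I then ?q else 0"
    have f: "?f \<in> chains (mixed_complex cells) 0"
      unfolding chains_def mixed_complex_def using I(1,2) aff_dim_mixed_cell[OF I(1)] by auto
    have "augment ?f = Poly_Mapping.single t c"
    proof -
      have "augment ?f = (\<Sum>J\<in>cells. if J = I then monom_of s * ?q else 0)"
        unfolding augment_def by (rule sum.cong) (use I mixed_cell_inject[OF _ I(1)] in auto)
      also have "\<dots> = monom_of s * ?q" using I(1) by simp
      also have "\<dots> = Poly_Mapping.single t c"
        unfolding monom_of_mult_single using s(1) by (simp add: expo_eq_iff fun_eq_iff)
      finally show ?thesis .
    qed
    then show ?thesis using f by (rule image_eqI[OF sym])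
  qed
  have "(\<Sum>t\<in>T. Poly_Mapping.single t (Poly_Mapping.lookup p t)) \<in> augment ` chains (mixed_complex cells) 0"
    if "finite T" "T \<subseteq> Poly_Mapping.keys p" for T
    using that
  proof (induction T rule: finite_induct)
    case empty
    have "(\<lambda>_. 0) \<in> chains (mixed_complex cells) 0" unfolding chains_def by simp
    then show ?case unfolding sum.empty by (rule image_eqI[rotated]) (simp add: augment_def)
  next
    case (insert t T)
    obtain f g where fg: "f \<in> chains (mixed_complex cells) 0" "Poly_Mapping.single t (Poly_Mapping.lookup p t) = augment f"
      "g \<in> chains (mixed_complex cells) 0" "(\<Sum>t\<in>T. Poly_Mapping.single t (Poly_Mapping.lookup p t)) = augment g"
    proof -
      have "Poly_Mapping.single t (Poly_Mapping.lookup p t) \<in> augment ` chains (mixed_complex cells) 0"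
        by (rule mono) (use insert.prems in simp)
      moreover have "(\<Sum>t\<in>T. Poly_Mapping.single t (Poly_Mapping.lookup p t)) \<in> augment ` chains (mixed_complex cells) 0"
        by (rule insert.IH) (use insert.prems in simp)
      ultimately show thesis using that by (elim imageE) simp
    qed
    have "(\<Sum>t\<in>insert t T. Poly_Mapping.single t (Poly_Mapping.lookup p t)) = augment (\<lambda>H. f H + g H)"
      unfolding sum.insert[OF insert.hyps] fg(2,4) augment_add ..
    then show ?case using chains_closed(1)[OF fg(1,3)] by (rule image_eqI)
  qed
  from this[OF finite_keys order_refl] show "p \<in> augment ` chains (mixed_complex cells) 0"
    by (simp flip: poly_mapping_sum_single)
qed

lemma augment_homogeneous:
  assumes f: "f \<in> chains (mixed_complex cells) 0" and h: "chain_homogeneous (lcm_label cells) b f"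
  shows "homogeneous b (augment f)"
  unfolding homogeneous_def
proof (intro ballI allI)
  fix u i assume "u \<in> Poly_Mapping.keys (augment f)"
  then have "Poly_Mapping.lookup (augment f) (expo (Poly_Mapping.lookup u)) \<noteq> 0" by (simp add: in_keys_iff)
  then obtain I where "strand (Poly_Mapping.lookup u) f I \<noteq> 0" unfolding lookup_augment by (meson sum.neutral)
  then have I: "I \<in> below (Poly_Mapping.lookup u)"
    and nz: "Poly_Mapping.lookup (f (mixed_cell I)) (expo (\<lambda>k. Poly_Mapping.lookup u k - coarse_type I k)) \<noteq> 0"
    unfolding strand_def by (auto split: if_splits)
  have Ic: "I \<in> cells" and le: "coarse_type I i \<le> Poly_Mapping.lookup u i" using I by (auto simp: below_def)
  have hom: "homogeneous (\<lambda>i. b i - int (coarse_type I i)) (f (mixed_cell I))"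
    using spec[OF h[unfolded chain_homogeneous_def], of "mixed_cell I"] unfolding lcm_label_mixed_cell[OF Ic] .
  have key: "expo (\<lambda>k. Poly_Mapping.lookup u k - coarse_type I k) \<in> Poly_Mapping.keys (f (mixed_cell I))"
    using nz by (simp add: in_keys_iff)
  have "int (Poly_Mapping.lookup u i - coarse_type I i) = b i - int (coarse_type I i)"
    using spec[OF bspec[OF hom[unfolded homogeneous_def] key], of i] by simp
  then show "int (Poly_Mapping.lookup u i) = b i" using le by linarith
qed

text \<open>By \<open>augment_eq_0_iff\<close> for the difference, the quotient by boundaries
  becomes a quotient by equality of augmentations.\<close>

lemma coker_rel_iff:
  "(f, g) \<in> coker_rel (mixed_complex cells) ori (lcm_label cells) \<longleftrightarrow>
     f \<in> chains (mixed_complex cells) 0 \<and> g \<in> chains (mixed_complex cells) 0 \<and> augment f = augment (g :: _ \<Rightarrow> ('d, 'k::field) mpolynomial)"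
proof (cases "f \<in> chains (mixed_complex cells) 0 \<and> g \<in> chains (mixed_complex cells) 0")
  case True
  then have "(\<lambda>H. f H - g H) \<in> chains (mixed_complex cells) 0" using chains_closed(2) by blast
  from augment_eq_0_iff[OF this] show ?thesis using True unfolding coker_rel_def augment_diff by simp
next
  case False
  then show ?thesis unfolding coker_rel_def by blast
qed

lemma coker_iso:
  "coker_graded_iso (mixed_complex cells) ori (lcm_label cells) (degree_ideal CARD('n) :: ('d, 'k::field) mpolynomial set)"
proof -
  define R where "R = (coker_rel (mixed_complex cells) ori (lcm_label cells) ::
    (((real^'d) set \<Rightarrow> ('d, 'k) mpolynomial) \<times> ((real^'d) set \<Rightarrow> ('d, 'k) mpolynomial)) set)"
  let ?C = "chains (mixed_complex cells) 0 :: ((real^'d) set \<Rightarrow> ('d, 'k) mpolynomial) set"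
  have R: "R `` {f} = {g \<in> ?C. augment g = augment f}" if "f \<in> ?C" for f
    using that unfolding R_def Image_singleton coker_rel_iff by auto
  \<comment> \<open>The augmentation is constant on classes, so the chosen representative does not
    matter.\<close>
  define \<psi> where "\<psi> X = augment (SOME f :: (real^'d) set \<Rightarrow> ('d, 'k) mpolynomial. f \<in> X)" for X
  have \<psi>: "\<psi> (R `` {f}) = augment f" if f: "f \<in> ?C" for f
  proof -
    have "(SOME g. g \<in> R `` {f}) \<in> R `` {f}" by (rule someI[of _ f]) (simp add: R[OF f] f)
    then show ?thesis unfolding \<psi>_def R[OF f] by simp
  qed
  have "bij_betw \<psi> (?C // R) (degree_ideal CARD('n))"
    unfolding bij_betw_def
  proof
    show "inj_on \<psi> (?C // R)"
    proof (rule inj_onI)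
      fix X Y assume "X \<in> ?C // R" "Y \<in> ?C // R" and eq: "\<psi> X = \<psi> Y"
      then obtain f g where fg: "f \<in> ?C" "X = R `` {f}" "g \<in> ?C" "Y = R `` {g}" by (auto elim!: quotientE)
      have "augment f = augment g" using eq unfolding fg(2,4) \<psi>[OF fg(1)] \<psi>[OF fg(3)] .
      then show "X = Y" unfolding fg(2,4) R[OF fg(1)] R[OF fg(3)] by simp
    qed
    have "\<psi> ` (?C // R) = augment ` ?C"
    proof (intro equalityI subsetI)
      fix p assume "p \<in> \<psi> ` (?C // R)"
      then obtain f where "f \<in> ?C" "p = \<psi> (R `` {f})" by (auto elim!: quotientE)
      then show "p \<in> augment ` ?C" using \<psi> by simp
    next
      fix p assume "p \<in> augment ` ?C"
      then obtain f where f: "f \<in> ?C" "p = augment f" by blast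
      have "R `` {f} \<in> ?C // R" by (rule quotientI[OF f(1)])
      then show "p \<in> \<psi> ` (?C // R)" using \<psi>[OF f(1)] f(2) by (metis imageI)
    qed
    then show "\<psi> ` (?C // R) = degree_ideal CARD('n)" unfolding augment_image .
  qed
  moreover have "\<forall>f\<in>?C. \<forall>g\<in>?C. \<psi> (R `` {\<lambda>H. f H + g H}) = \<psi> (R `` {f}) + \<psi> (R `` {g})"
  proof (intro ballI)
    fix f g assume f: "f \<in> ?C" and g: "g \<in> ?C"
    show "\<psi> (R `` {\<lambda>H. f H + g H}) = \<psi> (R `` {f}) + \<psi> (R `` {g})"
      unfolding \<psi>[OF chains_closed(1)[OF f g]] \<psi>[OF f] \<psi>[OF g] by (rule augment_add)
  qed
  moreover have "\<forall>s. \<forall>f\<in>?C. \<psi> (R `` {\<lambda>H. s * f H}) = s * \<psi> (R `` {f})"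
  proof (intro allI ballI)
    fix s f assume f: "f \<in> ?C"
    show "\<psi> (R `` {\<lambda>H. s * f H}) = s * \<psi> (R `` {f})"
      unfolding \<psi>[OF chains_closed(3)[OF f f]] \<psi>[OF f] by (rule augment_scale)
  qed
  moreover have "\<forall>b. \<forall>f\<in>?C. chain_homogeneous (lcm_label cells) b f \<longrightarrow> homogeneous b (\<psi> (R `` {f}))"
    by (simp add: \<psi> augment_homogeneous)
  ultimately show ?thesis unfolding coker_graded_iso_def Let_def R_def[symmetric]
    by (intro exI[of _ \<psi>] conjI)
qed

text \<open>The maximum is already reached at a vertex, which is a proper face because the cell has
  positive dimension.\<close>

lemma labels_compatible: "label_compatible (mixed_complex cells) (lcm_label cells)"
  unfolding label_compatible_def
proof (intro ballI impI allI)
  fix H i assume "H \<in> mixed_complex cells" and dim: "0 < aff_dim H"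
  then obtain I where I: "I \<in> cells" "H = mixed_cell I" unfolding mixed_complex_def by blast
  let ?S = "{lcm_label cells G i | G. G face_of H \<and> G \<noteq> {} \<and> G \<noteq> H}"
  have faces: "\<exists>J\<in>cells. G = mixed_cell J \<and> (\<forall>j. J j \<subseteq> I j)" if "G face_of H" "G \<noteq> {}" for G
    using face_of_mixed_cell[OF I(1), of G] that mixed_cell_face_of_iff[OF I(1)] unfolding I(2) by blast
  have "Max ?S = coarse_type I i"
  proof (rule Max_eqI)
    have "?S \<subseteq> (\<lambda>J. coarse_type J i) ` cells" using faces lcm_label_mixed_cell by fastforce
    then show "finite ?S" by (rule finite_subset) simp
    show "t \<le> coarse_type I i" if t: "t \<in> ?S" for t
    proof -
      obtain G where G: "t = lcm_label cells G i" "G face_of H" "G \<noteq> {}" using t by blast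
      obtain J where J: "J \<in> cells" "G = mixed_cell J" "\<And>j. J j \<subseteq> I j" using faces[OF G(2,3)] by blast
      show ?thesis unfolding G(1) J(2) lcm_label_mixed_cell[OF J(1)] by (rule coarse_type_mono[OF J(3)])
    qed
    obtain J where J: "J \<in> cells" "\<And>j. J j \<subseteq> I j" "cell_dim J = 0" "coarse_type J i = coarse_type I i"
      using vertex_attaining[OF I(1), of i] by blast
    have "mixed_cell J face_of H" unfolding I(2) using mixed_cell_face_of_iff[OF I(1) J(1)] J(2) by blast
    moreover have "mixed_cell J \<noteq> H" using dim aff_dim_mixed_cell[OF J(1)] J(3) by auto
    moreover have "coarse_type I i = lcm_label cells (mixed_cell J) i"
      unfolding lcm_label_mixed_cell[OF J(1)] J(4) ..
    ultimately show "coarse_type I i \<in> ?S" using mixed_cell_nonempty[OF J(1)] by blast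
  qed
  then show "lcm_label cells H i = Max ?S" unfolding I(2) lcm_label_mixed_cell[OF I(1)] by simp
qed

text \<open>Passing to a facet lowers the dimension and hence, by \<open>sum_coarse_type\<close>,
  the total degree of the coarse type; so every monomial in the differential is nonconstant.\<close>

lemma diff_in_irrelevant_ideal: "diff f G \<in> (irrelevant_ideal :: ('d, 'k::field) mpolynomial set)"
proof (cases "G \<in> mixed_complex cells")
  case False
  then show ?thesis unfolding irrelevant_ideal_def ideal_generated_var by (simp add: cellular_diff_outside degree_ideal_zero)
next
  case True
  then obtain J where J: "J \<in> cells" "G = mixed_cell J" unfolding mixed_complex_def by blast
  show ?thesis
    unfolding irrelevant_ideal_def ideal_generated_var J(2) cellular_diff_mixed_cell[OF J(1)]
  proof (rule degree_ideal_sum)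
    fix I assume I: "I \<in> cells"
    show "of_int (inc I J) * (monom_of (\<lambda>k. coarse_type I k - coarse_type J k) * f (mixed_cell I)) \<in> degree_ideal 1"
    proof (cases "cell_facet J I")
      case False
      then show ?thesis by (simp add: inc_def degree_ideal_zero)
    next
      case True
      have "(\<Sum>k\<in>UNIV. coarse_type I k) = cell_dim I + CARD('n)" "(\<Sum>k\<in>UNIV. coarse_type J k) = cell_dim J + CARD('n)"
        by (rule sum_coarse_type, rule cells_nonempty, rule I, rule sum_coarse_type, rule cells_nonempty, rule J(1))
      then have "(\<Sum>k\<in>UNIV. coarse_type J k) < (\<Sum>k\<in>UNIV. coarse_type I k)" using cell_facet_dim[OF True] by simp
      \<comment> \<open>This inequality holds whether or not the subtraction truncates.\<close>
      also have "(\<Sum>k\<in>UNIV. coarse_type I k) \<le> (\<Sum>k\<in>UNIV. coarse_type J k + (coarse_type I k - coarse_type J k))"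
        by (rule sum_mono) simp
      finally have "1 \<le> (\<Sum>k\<in>UNIV. coarse_type I k - coarse_type J k)" by (simp add: sum.distrib)
      then have "(monom_of (\<lambda>k. coarse_type I k - coarse_type J k) :: ('d, 'k) mpolynomial) \<in> degree_ideal 1"
        by (rule monom_of_degree_ideal)
      from degree_ideal_scale[OF this, of "f (mixed_cell I)"]
      have "monom_of (\<lambda>k. coarse_type I k - coarse_type J k) * f (mixed_cell I) \<in> degree_ideal 1"
        by (subst mult.commute)
      then show ?thesis by (rule degree_ideal_scale)
    qed
  qed
qed

theorem minimal_resolution:
  "supports_minimal_cellular_resolution (mixed_complex cells) ori (lcm_label cells)
     (degree_ideal CARD('n) :: ('d, 'k::field) mpolynomial set)"
  unfolding supports_minimal_cellular_resolution_def supports_cellular_resolution_def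
  by (intro conjI allI impI ballI oriented labels_compatible exact_positive coker_iso diff_in_irrelevant_ideal)

end

theorem corollary4p4:
  fixes \<Sigma> :: "('n::finite \<Rightarrow> 'd::finite set) set"
    and ori :: "(real^'d) set \<Rightarrow> (real^'d) list"
  assumes "mixed_subdivision \<Sigma>"
    and "regular_mixed_subdivision \<Sigma>"
    and "fine_mixed_subdivision \<Sigma>"
    and "oriented_complex (mixed_complex \<Sigma>) ori"
  shows "supports_minimal_cellular_resolution (mixed_complex \<Sigma>) ori (lcm_label \<Sigma>)
           (ideal_power (ideal_generated (range var)) CARD('n) :: ('d, 'k::field) mpolynomial set)"
proof -
  obtain w where w: "generic_weights w" "\<Sigma> = range (min_type w)"
    using fine_regular_generic[OF assms(2,3)] by blast
  interpret oriented_weights w ori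
    using w assms(4) by (simp add: oriented_weights_def oriented_weights_axioms_def)
  show ?thesis unfolding w(2) ideal_power_var by (rule minimal_resolution)
qed

end
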